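(* Let $n\ge1$ be an integer, $\delta>0$, $D\in\mathbb{R}$, $0<\tau<1$, and set $\epsilon=\frac{\mu_1-\mu_2}{8}\delta$. Let $m$ be a positive integer with $$m\ge 2\epsilon^{-2}\left(8\beta n\log\left(1+128\frac{\sqrt{2\beta n-1}}{2\sqrt{2\pi}}\epsilon^{-1}\right)+2\log(2)+D\right)$$ and let $\mathcal{P}=\{P_j\}_{j=1}^m$ be an independent sequence of uniformly distributed projections in $\mathrm{Proj}_{\mathbb{F}}(n,2n)$. Then with probability at least $1-\exp(-D)$, for all $X\in\mathrm{Proj}_{\mathbb{F}}(1,2n)$ and all $\tilde\Phi_{\mathcal{P}}(X)\in\{0,1\}^m$ with $$d_H(\Phi_{\mathcal{P}}(X),\tilde\Phi_{\mathcal{P}}(X))\le\tau$$ we have $$\|\tilde X-X\|\le\delta+2(\mu_1-\mu_2)^{-1}\tau,$$ where $\tilde X$ is the solution to the Principal Eigenspace Program (PEP) with input $\tilde\Phi_{\mathcal{P}}(X)$.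
   Context: $\mathbb{F}$ is either $\mathbb{R}$ or $\mathbb{C}$; $\beta=\frac12$ if $\mathbb{F}=\mathbb{R}$ and $\beta=1$ if $\mathbb{F}=\mathbb{C}$. $\mathrm{Proj}_{\mathbb{F}}(k,d)$ is the set of rank-$k$ orthogonal projections on $\mathbb{F}^d$; its uniform distribution is the unique probability measure invariant under conjugation by all orthogonal ($\mathbb{F}=\mathbb{R}$) or unitary ($\mathbb{F}=\mathbb{C}$) $d\times d$ matrices. $\|\cdot\|$ on matrices is the operator norm. $d_H$ is the normalized Hamming distance on $\{0,1\}^m$, i.e. the number of differing entries divided by $m$. The constants are $$\mu_1=\frac12+\frac{1}{\beta n\,4^{\beta n}B(\beta n,\beta n)},\qquad \mu_2=\frac12-\frac{1}{\beta n(2n-1)4^{\beta n}B(\beta n,\beta n)},$$ where $B(a,b)=\int_0^1 t^{a-1}(1-t)^{b-1}\,dt$ is the Beta function. For $P\in\mathrm{Proj}_{\mathbb{F}}(n,2n)$ and $X\in\mathrm{Proj}_{\mathbb{F}}(1,2n)$, $\phi_P(X)=1$ if $\mathrm{tr}(PX)\ge\frac12$ and $\phi_P(X)=0$ otherwise. For $\mathcal{P}=\{P_j\}_{j=1}^m$, the binary measurement map is $\Phi_{\mathcal{P}}(X)=(\phi_{P_j}(X))_{j=1}^m\in\{0,1\}^m$. (PEP) with input $b\in\{0,1\}^m$: put $Q_b=\frac1m\sum_{j=1}^m R_j$, where $R_j=P_j$ if $b_j=1$ and $R_j=I-P_j$ if $b_j=0$, and maximize $\mathrm{tr}(Q_bY)$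 over positive semidefinite $Y\in\mathbb{F}^{2n\times 2n}$ with $\mathrm{tr}(Y)\le1$. The solution is taken to be a rank-one orthogonal projection onto a line in the eigenspace of the largest eigenvalue of $Q_b$; when that eigenvalue is simple (which happens with probability 1 in this random model) it is the unique solution, namely the orthogonal projection onto that eigenspace. *)

theory Defs
  imports "HOL-Probability.Probability"
begin

section \<open>The scalar field\<close>

text \<open>
  The last class axiom leaves exactly two possibilities, the real field and the complex field,
  up to isometric isomorphism; both are instances.
  Conjugation is the reflection in the real axis, which is the identity over the reals.
\<close>

class real_or_complex = real_normed_field + euclidean_space +
  fixes sconj :: "'a \<Rightarrow> 'a"
    and sre :: "'a \<Rightarrow> real"
  assumes sre_inner: "sre x = inner x 1"
    and sconj_reflection: "sconj x = (2 * inner x 1) *\<^sub>R 1 - x"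
    and Basis_cases: "Basis = {1} \<or> (\<exists>i. i * i = - 1 \<and> Basis = {1, i})"

instantiation real :: real_or_complex
begin

definition sconj_real :: "real \<Rightarrow> real" where "sconj_real x = x"
definition sre_real :: "real \<Rightarrow> real" where "sre_real x = x"

instance
  by standard (auto simp: sconj_real_def sre_real_def)

end

instantiation complex :: real_or_complex
begin

definition sconj_complex :: "complex \<Rightarrow> complex" where "sconj_complex = cnj"
definition sre_complex :: "complex \<Rightarrow> real" where "sre_complex = Re"

instance
  by standard (auto simp: sconj_complex_def sre_complex_def inner_complex_def complex_eq_iff
      Basis_complex_def intro!: exI[of _ \<i>])

end

definition field_beta :: "'a::real_or_complex itself \<Rightarrow> real" where
  "field_beta _ = real DIM('a) / 2"

lemma field_beta_real: "field_beta TYPE(real) = 1 / 2"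
  and field_beta_complex: "field_beta TYPE(complex) = 1"
  by (simp_all add: field_beta_def)


section \<open>Projections and their uniform distribution\<close>

definition conj_transpose :: "'a::real_or_complex^'c^'r \<Rightarrow> 'a^'r^'c" where
  "conj_transpose A = (\<chi> i j. sconj (A $ j $ i))"

definition Proj :: "nat \<Rightarrow> ('a::real_or_complex^'d^'d) set" where
  "Proj k = {P. conj_transpose P = P \<and> P ** P = P \<and> rank P = k}"

definition unitary :: "'a::real_or_complex^'d^'d \<Rightarrow> bool" where
  "unitary U \<longleftrightarrow> conj_transpose U ** U = mat 1 \<and> U ** conj_transpose U = mat 1"

definition proj_space :: "nat \<Rightarrow> ('a::real_or_complex^'d^'d) measure" where
  "proj_space k = restrict_space borel (Proj k)"

definition uniform_on_Proj :: "nat \<Rightarrow> ('a::real_or_complex^'d^'d) measure \<Rightarrow> bool" where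
  "uniform_on_Proj k \<nu> \<longleftrightarrow>
     prob_space \<nu> \<and> sets \<nu> = sets (proj_space k) \<and>
     (\<forall>U. unitary U \<longrightarrow> distr \<nu> (proj_space k) (\<lambda>P. U ** P ** conj_transpose U) = \<nu>)"

definition op_norm :: "'a::real_or_complex^'d^'d \<Rightarrow> real" where
  "op_norm A = onorm (\<lambda>x. A *v x)"


section \<open>Binary measurements\<close>

text \<open>
  Bit strings of length \<open>m\<close> are functions \<open>nat \<Rightarrow> bool\<close> (with \<open>True\<close> for the bit 1) of which
  only the values at the indices below \<open>m\<close> are ever used. The trace of the product of two
  self-adjoint matrices is real, so taking real parts of such traces loses nothing.
\<close>

definition \<phi> :: "'a::real_or_complex^'d^'d \<Rightarrow> 'a^'d^'d \<Rightarrow> bool" where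
  "\<phi> P X \<longleftrightarrow> sre (trace (P ** X)) \<ge> 1 / 2"

definition \<Phi> :: "(nat \<Rightarrow> 'a::real_or_complex^'d^'d) \<Rightarrow> 'a^'d^'d \<Rightarrow> nat \<Rightarrow> bool" where
  "\<Phi> Ps X = (\<lambda>j. \<phi> (Ps j) X)"

definition hamming_dist :: "nat \<Rightarrow> (nat \<Rightarrow> bool) \<Rightarrow> (nat \<Rightarrow> bool) \<Rightarrow> real" where
  "hamming_dist m a b = real (card {j. j < m \<and> a j \<noteq> b j}) / real m"

definition \<mu>\<^sub>1 :: "real \<Rightarrow> nat \<Rightarrow> real" where
  "\<mu>\<^sub>1 \<beta> n = 1 / 2 + 1 / (\<beta> * real n * 4 powr (\<beta> * real n) * Beta (\<beta> * real n) (\<beta> * real n))"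

definition \<mu>\<^sub>2 :: "real \<Rightarrow> nat \<Rightarrow> real" where
  "\<mu>\<^sub>2 \<beta> n = 1 / 2 - 1 / (\<beta> * real n * (2 * real n - 1) * 4 powr (\<beta> * real n)
                        * Beta (\<beta> * real n) (\<beta> * real n))"


section \<open>The Principal Eigenspace Program\<close>

definition Q_mat ::
    "nat \<Rightarrow> (nat \<Rightarrow> 'a::real_or_complex^'d^'d) \<Rightarrow> (nat \<Rightarrow> bool) \<Rightarrow> 'a^'d^'d" where
  "Q_mat m Ps b = (1 / real m) *\<^sub>R (\<Sum>j<m. if b j then Ps j else mat 1 - Ps j)"

text \<open>
  The inner product on vectors is real-valued: over the complex field it is the real part of the
  Hermitian form, which for self-adjoint \<open>Y\<close> and equal arguments \<open>x\<close> is the whole of it.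
\<close>

definition pos_semidef :: "'a::real_or_complex^'d^'d \<Rightarrow> bool" where
  "pos_semidef Y \<longleftrightarrow> conj_transpose Y = Y \<and> (\<forall>x. 0 \<le> inner x (Y *v x))"

definition PEP_feasible :: "'a::real_or_complex^'d^'d \<Rightarrow> bool" where
  "PEP_feasible Y \<longleftrightarrow> pos_semidef Y \<and> sre (trace Y) \<le> 1"

definition PEP_maximizer :: "'a::real_or_complex^'d^'d \<Rightarrow> 'a^'d^'d \<Rightarrow> bool" where
  "PEP_maximizer Q Y \<longleftrightarrow>
     PEP_feasible Y \<and> (\<forall>Z. PEP_feasible Z \<longrightarrow> sre (trace (Q ** Z)) \<le> sre (trace (Q ** Y)))"

definition eigenspace :: "'a::real_or_complex^'d^'d \<Rightarrow> real \<Rightarrow> ('a^'d) set" where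
  "eigenspace Q r = {v. Q *v v = r *\<^sub>R v}"

definition largest_eigenvalue :: "'a::real_or_complex^'d^'d \<Rightarrow> real \<Rightarrow> bool" where
  "largest_eigenvalue Q r \<longleftrightarrow>
     eigenspace Q r \<noteq> {0} \<and> (\<forall>\<kappa>. eigenspace Q \<kappa> \<noteq> {0} \<longrightarrow> \<kappa> \<le> r)"

text \<open>
  If the largest eigenvalue is not simple, several matrices satisfy the following predicate;
  it singles out no particular one of them.
\<close>

definition PEP_solution ::
    "nat \<Rightarrow> (nat \<Rightarrow> 'a::real_or_complex^'d^'d) \<Rightarrow> (nat \<Rightarrow> bool) \<Rightarrow> 'a^'d^'d \<Rightarrow> bool" where
  "PEP_solution m Ps b Y \<longleftrightarrow>
     PEP_maximizer (Q_mat m Ps b) Y \<and> Y \<in> Proj 1 \<and>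
     (\<exists>r. largest_eigenvalue (Q_mat m Ps b) r \<and>
          range (\<lambda>v. Y *v v) \<subseteq> eigenspace (Q_mat m Ps b) r)"

end

theory Submission
  imports Defs
begin

text \<open>
  Write \<open>t\<^sub>v(P)\<close> for the quadratic form of a projection \<open>P\<close> at a unit vector \<open>v\<close>. A measurement of the line
  of \<open>x\<close> contributes \<open>P\<close> or \<open>I - P\<close> to the averaged matrix, according to whether \<open>t\<^sub>x(P) \<ge> 1/2\<close>; its
  quadratic form at \<open>y\<close> is called the response. The mean of the averaged matrix is
  \<open>\<mu>\<^sub>2 I + (\<mu>\<^sub>1 - \<mu>\<^sub>2) X\<close> (\<open>expectation_response\<close>). If for all unit vectors \<open>x\<close> and \<open>y\<close> the average
  response is within \<open>4 \<epsilon>\<close> of its mean, then a maximizer \<open>Y\<close> for bits with a fraction \<open>\<tau>\<close> of errors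
  satisfies \<open>(\<mu>\<^sub>1 - \<mu>\<^sub>2) s\<^sup>2 \<le> 2 (4 \<epsilon> + \<tau>) s\<close>, where \<open>s\<close> is the sine of the angle of \<open>X\<close> and \<open>Y\<close>, because \<open>Y\<close>
  beats \<open>X\<close> in the perturbed objective; and \<open>s\<close> is the norm of \<open>Y - X\<close> (\<open>PEP_solution_close\<close>). With
  \<open>8 \<epsilon> = (\<mu>\<^sub>1 - \<mu>\<^sub>2) \<delta>\<close> this is the claim, so all that remains is the uniform estimate.

  The means rest on the law of \<open>t\<^sub>v(P)\<close>, the symmetric beta law of parameter \<open>q = \<beta> n\<close>
  (\<open>quadratic_form_beta\<close>). By unitary invariance the vector may be drawn from the unit ball, which
  turns the law into a question about a fixed \<open>P\<close>: the volume of the vectors with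
  \<open>\<bar>P v\<bar>\<^sup>2 \<le> a\<close> and \<open>\<bar>v - P v\<bar>\<^sup>2 \<le> b\<close> is proportional to \<open>a\<^sup>q b\<^sup>q\<close> by scaling (\<open>box_vol_eq\<close>).

  For \<open>q \<ge> 1\<close> the uniform estimate follows from Hoeffding's inequality on nets of unit vectors: moving
  \<open>x\<close> to a point of the net changes only measurements close to the threshold, and the beta density is
  bounded (\<open>uniform_estimate\<close>). The only other case is the real plane, \<open>q = 1/2\<close>. There the factor of
  \<open>1/\<epsilon>\<close> under the logarithm is 0, so the assumption on \<open>m\<close> leaves no room for a net whose size depends
  on \<open>\<epsilon>\<close>. Instead, the projections become points of a circle, up to antipodes points of a half circle,
  and the response is an average of indicators of intervals of this half circle (\<open>response_sweep\<close>). A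
  deviation inequality for all intervals at once, of the type of the Dvoretzky-Kiefer-Wolfowitz
  inequality, is derived by symmetrization from a maximal inequality for sums of random signs
  (\<open>interval_deviation\<close>).
\<close>

section \<open>Scalars\<close>

text \<open>
  In these coordinates every identity for conjugation is a polynomial identity between real numbers.
\<close>

lemma scalar_cases:
  fixes x y :: "'a::real_or_complex"
  obtains (real) "\<And>z::'a. z = (inner z 1) *\<^sub>R 1"
  | (complex) i :: 'a where "i * i = -1" "inner 1 i = 0" "inner i i = 1"
      "\<And>z::'a. z = (inner z 1) *\<^sub>R 1 + (inner z i) *\<^sub>R i"
proof -
  have repr: "(\<Sum>b\<in>Basis. (inner z b) *\<^sub>R b) = z" for z :: 'a
    by (rule euclidean_representation)
  consider "Basis = {1::'a}" | i :: 'a where "i * i = - 1" "Basis = {1, i}"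
    using Basis_cases by blast
  then show thesis
  proof cases
    case 1
    then show thesis using that(1) repr by (metis (no_types, lifting) finite.emptyI empty_iff sum.empty sum.insert add.right_neutral)
  next
    case (2 i)
    have "i \<noteq> 1"
    proof
      assume "i = 1"
      with 2(1) have "(1::'a) = - 1" by simp
      then have "(2::'a) = 0" by (metis add.right_inverse one_add_one)
      then show False by simp
    qed
    have "i \<in> Basis" "1 \<in> (Basis :: 'a set)" using 2 by auto
    then have "inner 1 i = 0" "inner i i = 1"
      using \<open>i \<noteq> 1\<close> by (auto simp: inner_Basis)
    moreover have "z = (inner z 1) *\<^sub>R 1 + (inner z i) *\<^sub>R i" for z
      by (subst repr[of z, symmetric]) (use \<open>i \<noteq> 1\<close>[symmetric] in \<open>simp add: 2(2)\<close>)
    ultimately show thesis using that(2) 2 by blast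
  qed
qed

lemma inner_one_one [simp]: "inner (1::'a::real_or_complex) 1 = 1"
  by (metis norm_one power2_norm_eq_inner one_power2)

lemma sre_one [simp]: "sre (1::'a::real_or_complex) = 1"
  by (simp add: sre_inner)

lemma sre_zero [simp]: "sre (0::'a::real_or_complex) = 0"
  by (simp add: sre_inner)

lemma sre_sum: "sre (\<Sum>i\<in>I. f i) = (\<Sum>i\<in>I. sre (f i :: 'a::real_or_complex))"
  by (simp add: sre_inner inner_sum_left)

lemma sconj_zero [simp]: "sconj (0::'a::real_or_complex) = 0"
  by (simp add: sconj_reflection)

lemma sconj_one [simp]: "sconj (1::'a::real_or_complex) = 1"
  by (simp add: sconj_reflection algebra_simps flip: scaleR_2)

lemma sconj_add: "sconj (x + y) = sconj x + sconj (y::'a::real_or_complex)"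
  by (simp add: sconj_reflection inner_add_left algebra_simps)

lemma sconj_minus: "sconj (- x) = - sconj (x::'a::real_or_complex)"
  by (simp add: sconj_reflection algebra_simps)

lemma sconj_diff: "sconj (x - y) = sconj x - sconj (y::'a::real_or_complex)"
  by (simp add: sconj_reflection inner_diff_left algebra_simps)

lemma sconj_scaleR: "sconj (r *\<^sub>R x) = r *\<^sub>R sconj (x::'a::real_or_complex)"
  by (simp add: sconj_reflection algebra_simps)

lemma sconj_sconj [simp]: "sconj (sconj x) = (x::'a::real_or_complex)"
  by (simp add: sconj_reflection inner_diff_left algebra_simps)

lemma sconj_of_real [simp]: "sconj (of_real r) = (of_real r :: 'a::real_or_complex)"
  by (simp add: of_real_def sconj_scaleR)

lemma sconj_sum: "sconj (\<Sum>i\<in>I. f i) = (\<Sum>i\<in>I. sconj (f i :: 'a::real_or_complex))"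
  by (induction I rule: infinite_finite_induct) (auto simp: sconj_add)

lemma sconj_mult: "sconj (x * y) = sconj x * sconj (y::'a::real_or_complex)"
proof (cases rule: scalar_cases[where 'a='a])
  case real
  then have "sconj z = z" for z :: 'a
    by (metis sconj_one sconj_scaleR)
  then show ?thesis by simp
next
  case (complex i)
  define a b c d where "a = inner x 1" "b = inner x i" "c = inner y 1" "d = inner y i"
  have x: "x = a *\<^sub>R 1 + b *\<^sub>R i" and y: "y = c *\<^sub>R 1 + d *\<^sub>R i"
    using complex(4) by (simp_all add: a_b_c_d_def)
  have "sconj i = - i" using complex(2) by (simp add: sconj_reflection inner_commute)
  then show ?thesis
    unfolding x y by (simp add: sconj_add sconj_scaleR sconj_diff sconj_minus complex algebra_simps)
qed

lemma inner_eq_sre: "inner x y = sre (sconj x * (y::'a::real_or_complex))"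
proof (cases rule: scalar_cases[where 'a='a])
  case real
  have "inner x y = inner x 1 * inner y 1"
    by (subst real[of x], subst real[of y]) simp
  moreover have "sre (sconj x * y) = inner x 1 * inner y 1"
    by (subst real[of x], subst real[of y]) (simp add: sconj_scaleR sre_inner)
  ultimately show ?thesis by simp
next
  case (complex i)
  define a b c d where "a = inner x 1" "b = inner x i" "c = inner y 1" "d = inner y i"
  have x: "x = a *\<^sub>R 1 + b *\<^sub>R i" and y: "y = c *\<^sub>R 1 + d *\<^sub>R i"
    using complex(4) by (simp_all add: a_b_c_d_def)
  have si: "sconj i = - i" using complex(2) by (simp add: sconj_reflection inner_commute)
  show ?thesis
    unfolding x y using complex
    by (simp add: sconj_add sconj_scaleR si sre_inner inner_add_left inner_add_right inner_commute algebra_simps)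
qed

lemma sconj_mult_self: "sconj x * x = of_real ((norm (x::'a::real_or_complex))\<^sup>2)"
proof (cases rule: scalar_cases[where 'a='a])
  case real
  have "norm x = \<bar>inner x 1\<bar>" by (subst real[of x]) simp
  moreover have "sconj x = x"
    by (metis real sconj_one sconj_scaleR)
  moreover have "x * x = of_real ((inner x 1)\<^sup>2)"
    by (subst real[of x], subst (2) real[of x]) (simp add: of_real_def power2_eq_square)
  ultimately show ?thesis by simp
next
  case (complex i)
  define a b where "a = inner x 1" "b = inner x i"
  have x: "x = a *\<^sub>R 1 + b *\<^sub>R i"
    using complex(4) by (simp_all add: a_b_def)
  have si: "sconj i = - i" using complex(2) by (simp add: sconj_reflection inner_commute)
  have n: "(norm x)\<^sup>2 = a * a + b * b"
    unfolding x power2_norm_eq_inner using complex by (simp add: inner_add_left inner_add_right inner_commute)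
  show ?thesis unfolding n unfolding x using complex
    by (simp add: sconj_add sconj_scaleR si algebra_simps of_real_def)
qed

lemma norm_sconj [simp]: "norm (sconj x) = norm (x::'a::real_or_complex)"
proof -
  have "(norm (sconj x))\<^sup>2 = (norm x)\<^sup>2"
    unfolding power2_norm_eq_inner by (simp add: inner_eq_sre mult.commute)
  then show ?thesis by simp
qed

section \<open>The Hermitian form\<close>

definition herm :: "'a::real_or_complex^'n \<Rightarrow> 'a^'n \<Rightarrow> 'a" where
  "herm x y = (\<Sum>i\<in>UNIV. sconj (x $ i) * y $ i)"

lemma sre_herm: "sre (herm x y) = inner x y"
  by (simp add: herm_def sre_sum inner_vec_def inner_eq_sre)

lemma herm_diff_right: "herm x (y - z) = herm x y - herm x z"
  by (simp add: herm_def algebra_simps sum_subtractf)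

lemma herm_diff_left: "herm (x - y) z = herm x z - herm y z"
  by (simp add: herm_def algebra_simps sum_subtractf sconj_diff)

lemma herm_smult_right: "herm x (c *s y) = c * herm x y"
  by (simp add: herm_def sum_distrib_left algebra_simps)

lemma herm_smult_left: "herm (c *s x) y = sconj c * herm x y"
  by (simp add: herm_def sum_distrib_left algebra_simps sconj_mult)

lemma herm_commute: "herm y x = sconj (herm x y)"
  by (simp add: herm_def sconj_sum sconj_mult mult.commute)

lemma herm_self: "herm x x = of_real ((norm x)\<^sup>2)"
  by (simp add: herm_def sconj_mult_self norm_vec_def L2_set_def sum_nonneg)

lemma scaleR_eq_smult: "r *\<^sub>R (x::'a::real_or_complex^'n) = of_real r *s x"
  unfolding vec_eq_iff by (metis scaleR_conv_of_real vector_scaleR_component vector_smult_component)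

lemma norm_smult: "norm (c *s x) = norm c * norm (x::'a::real_or_complex^'n)"
  by (simp add: norm_vec_def L2_set_def norm_mult power_mult_distrib real_sqrt_mult
      flip: sum_distrib_left)

lemma herm_mult_right: "herm x (A *v y) = herm (conj_transpose A *v x) y"
proof -
  have "herm x (A *v y) = (\<Sum>i\<in>UNIV. \<Sum>j\<in>UNIV. sconj (x $ i) * (A $ i $ j * y $ j))"
    by (simp add: herm_def matrix_vector_mult_def sum_distrib_left)
  also have "\<dots> = (\<Sum>j\<in>UNIV. \<Sum>i\<in>UNIV. sconj (x $ i) * (A $ i $ j * y $ j))"
    by (rule sum.swap)
  also have "\<dots> = herm (conj_transpose A *v x) y"
    by (simp add: herm_def matrix_vector_mult_def sum_distrib_right sum_distrib_left
        conj_transpose_def sconj_sum sconj_mult mult_ac)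
  finally show ?thesis .
qed

lemma inner_mult_right: "inner x (A *v y) = inner (conj_transpose A *v x) y"
  by (simp add: herm_mult_right flip: sre_herm)

text \<open>
  The phase is the product divided by its absolute value. Aligning the phases of two vectors makes
  their real inner product equal to the absolute value of the Hermitian one.
\<close>

lemma obtain_phase:
  fixes x y :: "'a::real_or_complex^'n"
  obtains c :: 'a where "norm c = 1" "herm (c *s x) y = of_real (norm (herm x y))"
proof (cases "herm x y = 0")
  case True
  show ?thesis by (rule that[of 1]) (simp_all add: True herm_smult_left)
next
  case False
  let ?h = "herm x y"
  let ?c = "(1 / norm ?h) *\<^sub>R ?h"
  show ?thesis
  proof (rule that[of ?c])
    show "norm ?c = 1" using False by simp
    have "herm (?c *s x) y = of_real (1 / norm ?h) * (sconj ?h * ?h)"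
      by (simp only: herm_smult_left sconj_scaleR) (simp add: scaleR_conv_of_real)
    also have "\<dots> = of_real (1 / norm ?h * (norm ?h)\<^sup>2)"
      by (simp only: sconj_mult_self of_real_mult)
    also have "\<dots> = of_real (norm ?h)" using False by (simp add: power2_eq_square)
    finally show "herm (?c *s x) y = of_real (norm (herm x y))" .
  qed
qed

lemma norm_herm_le: "norm (herm x y) \<le> norm x * norm (y::'a::real_or_complex^'n)"
proof -
  obtain c :: 'a where c: "norm c = 1" "herm (c *s x) y = of_real (norm (herm x y))"
    by (rule obtain_phase)
  have "norm (herm x y) = inner (c *s x) y"
    unfolding sre_herm[symmetric] c(2) by (simp add: of_real_def sre_inner)
  also have "\<dots> \<le> norm (c *s x) * norm y" by (rule norm_cauchy_schwarz)
  finally show ?thesis using c by (simp add: norm_smult)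
qed

section \<open>Matrices\<close>

lemma linear_mult_vec: "linear (\<lambda>x. (A::'a::real_or_complex^'n^'m) *v x)"
  by (rule linearI) (simp_all add: vec_eq_iff matrix_vector_mult_def scaleR_sum_right
      distrib_left sum.distrib)

lemma bounded_linear_mult_vec: "bounded_linear (\<lambda>x. (A::'a::real_or_complex^'n^'m) *v x)"
  by (rule linear_linear[THEN iffD2, OF linear_mult_vec, simplified linear_conv_bounded_linear])

lemma matrix_vector_scaleR: "(A::'a::real_or_complex^'n^'m) *v (r *\<^sub>R x) = r *\<^sub>R (A *v x)"
  by (rule linear_scale[OF linear_mult_vec])

lemma scaleR_matrix_vector: "(r *\<^sub>R (A::'a::real_or_complex^'n^'m)) *v x = r *\<^sub>R (A *v x)"
  by (simp add: vec_eq_iff matrix_vector_mult_def scaleR_sum_right)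

lemma sum_matrix_vector: "(\<Sum>j\<in>J. (f j::'a::real_or_complex^'n^'m)) *v x = (\<Sum>j\<in>J. f j *v x)"
  by (induction J rule: infinite_finite_induct) (auto simp: matrix_vector_mult_add_rdistrib)

lemma conj_transpose_conj_transpose [simp]: "conj_transpose (conj_transpose A) = A"
  by (simp add: conj_transpose_def)

lemma conj_transpose_diff: "conj_transpose (A - B) = conj_transpose A - conj_transpose B"
  by (simp add: conj_transpose_def vec_eq_iff sconj_diff)

lemma conj_transpose_add: "conj_transpose (A + B) = conj_transpose A + conj_transpose B"
  by (simp add: conj_transpose_def vec_eq_iff sconj_add)

lemma conj_transpose_scaleR: "conj_transpose (r *\<^sub>R A) = r *\<^sub>R conj_transpose A"
  by (simp add: conj_transpose_def vec_eq_iff sconj_scaleR)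

lemma conj_transpose_sum: "conj_transpose (\<Sum>j\<in>J. f j) = (\<Sum>j\<in>J. conj_transpose (f j))"
  by (induction J rule: infinite_finite_induct)
    (auto simp: conj_transpose_add, auto simp: conj_transpose_def vec_eq_iff)

lemma conj_transpose_mat_1 [simp]: "conj_transpose (mat 1) = mat 1"
  by (simp add: conj_transpose_def vec_eq_iff mat_def)

lemma conj_transpose_mult:
  "conj_transpose (A ** B) = conj_transpose B ** conj_transpose A"
  by (simp add: conj_transpose_def vec_eq_iff matrix_matrix_mult_def sconj_sum sconj_mult mult.commute)

definition outer :: "'a::real_or_complex^'n \<Rightarrow> 'a^'n^'n" where
  "outer x = (\<chi> i j. x $ i * sconj (x $ j))"

lemma outer_vector: "outer x *v v = herm x v *s x"
  by (simp add: outer_def matrix_vector_mult_def herm_def vec_eq_iff sum_distrib_right sum_distrib_left mult_ac)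

lemma trace_mult_outer: "trace (A ** outer x) = herm x (A *v x)"
proof -
  have "trace (A ** outer x) = (\<Sum>i\<in>UNIV. \<Sum>k\<in>UNIV. A $ i $ k * (x $ k * sconj (x $ i)))"
    by (simp add: trace_def outer_def matrix_matrix_mult_def)
  also have "\<dots> = herm x (A *v x)"
    by (simp add: herm_def matrix_vector_mult_def sum_distrib_left mult_ac)
  finally show ?thesis .
qed

lemma sre_trace_mult_outer: "sre (trace (A ** outer x)) = inner x (A *v x)"
  by (simp add: trace_mult_outer sre_herm)

lemma conj_transpose_outer: "conj_transpose (outer x) = outer x"
  by (simp add: conj_transpose_def outer_def vec_eq_iff sconj_mult mult.commute)

section \<open>Orthogonal projections\<close>

lemma real_span_smult:
  fixes B :: "('a::real_or_complex^'n) set"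
  shows "vec.span B \<subseteq> span ((\<lambda>(e, b). e *s b) ` (Basis \<times> B))"
    (is "_ \<subseteq> span ?E")
proof
  fix v assume "v \<in> vec.span B"
  then show "v \<in> span ?E"
  proof (induction rule: vec.span_induct_alt)
    case base
    show ?case by (rule span_zero)
  next
    case (step c b y)
    have "c *s b = (\<Sum>e\<in>Basis. (inner c e) *\<^sub>R (e *s b))"
      by (subst euclidean_representation[of c, symmetric])
        (simp add: vec_eq_iff sum_distrib_right)
    also have "\<dots> \<in> span ?E"
      using step(1) by (intro span_sum span_scale span_base) force
    finally show ?case using step by (intro span_add)
  qed
qed

lemma real_dim_le:
  fixes S :: "('a::real_or_complex^'n) set"
  assumes "finite B" "S \<subseteq> vec.span B"
  shows "dim S \<le> DIM('a) * card B"
proof -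
  have "dim S \<le> card ((\<lambda>(e, b). e *s b) ` (Basis \<times> B))"
    using assms real_span_smult[of B] by (intro dim_le_card) auto
  also have "\<dots> \<le> card ((Basis :: 'a set) \<times> B)"
    using assms by (intro card_image_le) auto
  finally show ?thesis by (simp add: card_cartesian_product)
qed

text \<open>
  The scalar dimension of a subspace determines its real dimension: the generators of the subspace
  and of a complement both give upper bounds, and these add up to the dimension of the whole space.
\<close>

lemma real_dim_eq:
  fixes S :: "('a::real_or_complex^'n) set"
  assumes "vec.subspace S"
  shows "dim S = DIM('a) * vec.dim S"
proof -
  obtain B where B: "B \<subseteq> S" "vec.independent B" "S \<subseteq> vec.span B" "card B = vec.dim S"
    by (rule vec.basis_exists[of S]) auto
  define C where "C = vec.extend_basis B"
  have C: "B \<subseteq> C" "vec.independent C" "vec.span C = UNIV"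
    using vec.extend_basis_superset[OF B(2)] vec.independent_extend_basis[OF B(2)]
      vec.span_extend_basis[OF B(2)] by (auto simp: C_def)
  have fin: "finite C" "finite B" using C(2) B(2) vec.finiteI_independent by auto
  have cardC: "card C = CARD('n)"
  proof -
    have "vec.dim (UNIV :: ('a^'n) set) = card C"
      using C vec.span_UNIV by (intro vec.dim_eq_card) auto
    then show ?thesis unfolding vec_dim_card ..
  qed
  have BS: "vec.span B = S"
    using B assms by (metis subset_antisym vec.span_minimal)
  have subS: "subspace S"
    unfolding subspace_def
  proof (intro conjI ballI allI)
    show "0 \<in> S" using assms by (rule vec.subspace_0)
    show "x + y \<in> S" if "x \<in> S" "y \<in> S" for x y using assms that by (rule vec.subspace_add)
    show "r *\<^sub>R x \<in> S" if "x \<in> S" for r x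
      unfolding scaleR_eq_smult using assms that by (rule vec.subspace_scale)
  qed
  let ?T = "vec.span (C - B)"
  have "x \<in> {x + y |x y. x \<in> span S \<and> y \<in> span ?T}" for x
  proof -
    have "x \<in> vec.span (B \<union> (C - B))" using C by (simp add: Un_absorb1)
    then obtain u v where "x = u + v" "u \<in> S" "v \<in> ?T"
      unfolding vec.span_Un BS by blast
    then show ?thesis using span_base by blast
  qed
  then have sums: "{x + y |x y. x \<in> span S \<and> y \<in> span ?T} = UNIV" by blast
  have "CARD('n) * DIM('a) = dim (UNIV :: ('a^'n) set)" by simp
  also have "\<dots> \<le> dim (span S) + dim (span ?T)"
    using dim_sums_Int[OF subspace_span subspace_span, of S ?T] unfolding sums by linarith
  also have "\<dots> = dim S + dim ?T" by simp
  also have "dim ?T \<le> DIM('a) * card (C - B)"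
    using fin by (intro real_dim_le) auto
  also have "card (C - B) = CARD('n) - vec.dim S"
    using C fin B(4) cardC by (simp add: card_Diff_subset)
  finally have "CARD('n) * DIM('a) \<le> dim S + DIM('a) * (CARD('n) - vec.dim S)" by simp
  moreover have "dim S \<le> DIM('a) * vec.dim S"
    using real_dim_le[OF fin(2) B(3)] B(4) by simp
  moreover have "vec.dim S \<le> CARD('n)"
    using C(1) fin(1) cardC B(4) by (metis card_mono)
  then have "DIM('a) * vec.dim S \<le> DIM('a) * CARD('n)" by simp
  ultimately show ?thesis
    unfolding diff_mult_distrib2 mult.commute[of "CARD('n)"] by linarith
qed

lemma range_mult_vec_eq_span:
  "range (\<lambda>v. (A::'a::real_or_complex^'n^'n) *v v) = vec.span (columns A)"
proof
  show "range (\<lambda>v. A *v v) \<subseteq> vec.span (columns A)"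
    using matrix_vector_mult_in_columnspace_gen by blast
  have sub: "vec.subspace (range (\<lambda>v. A *v v))"
    by (metis vec.subspace_UNIV vec.subspace_image)
  have "columns A \<subseteq> range (\<lambda>v. A *v v)"
  proof
    fix c assume "c \<in> columns A"
    then obtain j where "c = column j A" by (auto simp: columns_def)
    then have "c = A *v axis j 1"
      by (simp add: vec_eq_iff column_def matrix_vector_mult_def axis_def if_distrib cong: if_cong)
    then show "c \<in> range (\<lambda>v. A *v v)" by blast
  qed
  then show "vec.span (columns A) \<subseteq> range (\<lambda>v. A *v v)"
    using sub by (rule vec.span_minimal)
qed

lemma dim_image_conj_le:
  fixes S :: "('a::real_or_complex^'n) set"
  shows "vec.dim ((\<lambda>v. \<chi> i. sconj (v $ i)) ` S) \<le> vec.dim S"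
proof -
  let ?c = "\<lambda>v::'a^'n. \<chi> i. sconj (v $ i)"
  obtain B where B: "B \<subseteq> S" "vec.independent B" "S \<subseteq> vec.span B" "card B = vec.dim S"
    by (rule vec.basis_exists[of S]) auto
  have fin: "finite B" using B(2) vec.finiteI_independent by auto
  have "?c v \<in> vec.span (?c ` B)" if "v \<in> vec.span B" for v
    using that
  proof (induction rule: vec.span_induct_alt)
    case base
    have "?c 0 = 0" by (simp add: vec_eq_iff)
    then show ?case by (simp add: vec.span_zero)
  next
    case (step r b y)
    have "?c (r *s b + y) = sconj r *s ?c b + ?c y"
      by (simp add: vec_eq_iff sconj_add sconj_mult)
    then show ?case using step by (auto intro!: vec.span_add vec.span_scale intro: vec.span_base)
  qed
  then have "?c ` S \<subseteq> vec.span (?c ` B)" using B(3) by blast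
  then have "vec.dim (?c ` S) \<le> card (?c ` B)" using fin by (intro vec.dim_le_card) auto
  also have "\<dots> \<le> card B" using fin by (rule card_image_le)
  finally show ?thesis using B by simp
qed

text \<open>
  The rank is defined by the rows. The columns of a self-adjoint matrix are the conjugate rows, and
  conjugation is semilinear, so it preserves dimensions.
\<close>

lemma dim_columns_self_adjoint:
  fixes A :: "'a::real_or_complex^'n^'n"
  assumes "conj_transpose A = A"
  shows "vec.dim (columns A) = rank A"
proof -
  let ?c = "\<lambda>v::'a^'n. \<chi> i. sconj (v $ i)"
  have A: "sconj (A $ i $ j) = A $ j $ i" for i j
    using assms by (metis (no_types, lifting) conj_transpose_def vec_lambda_beta)
  have rc: "row i A = ?c (column i A)" for i
    by (simp add: vec_eq_iff row_def column_def A)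
  have cr: "column i A = ?c (row i A)" for i
    by (simp add: vec_eq_iff row_def column_def A)
  have "rows A = ?c ` columns A" "columns A = ?c ` rows A"
    by (auto simp: rows_def columns_def rc intro!: image_eqI)
  then show ?thesis
    unfolding row_rank_def_gen by (metis dim_image_conj_le le_antisym)
qed

lemma Proj_D:
  assumes "P \<in> Proj k"
  shows Proj_adjoint: "conj_transpose P = P" and Proj_idem: "P *v (P *v v) = P *v v"
    and Proj_rank: "rank P = k"
  using assms by (auto simp: Proj_def matrix_vector_mul_assoc)

lemma inner_Proj: "P \<in> Proj k \<Longrightarrow> inner x (P *v y) = inner (P *v x) y"
  by (simp add: inner_mult_right Proj_adjoint)

lemma herm_Proj: "P \<in> Proj k \<Longrightarrow> herm x (P *v y) = herm (P *v x) y"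
  by (simp add: herm_mult_right Proj_adjoint)

lemma inner_Proj_self:
  assumes "P \<in> Proj k"
  shows "inner x (P *v x) = (norm (P *v x))\<^sup>2"
  using inner_Proj[OF assms, of x "P *v x"] unfolding Proj_idem[OF assms] power2_norm_eq_inner .

lemma norm_Proj_compl:
  assumes "P \<in> Proj k"
  shows "(norm (x - P *v x))\<^sup>2 = (norm x)\<^sup>2 - (norm (P *v x))\<^sup>2"
proof -
  have "inner x (P *v x) = (norm (P *v x))\<^sup>2" by (rule inner_Proj_self[OF assms])
  then show ?thesis
    by (simp add: power2_norm_eq_inner inner_diff_left inner_diff_right inner_commute)
qed

lemma norm_Proj_le:
  assumes "P \<in> Proj k"
  shows "norm (P *v x) \<le> norm x"
proof (rule power2_le_imp_le)
  show "(norm (P *v x))\<^sup>2 \<le> (norm x)\<^sup>2"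
    using norm_Proj_compl[OF assms, of x] zero_le_power2[of "norm (x - P *v x)"] by linarith
qed simp

lemma dim_range_Proj:
  assumes "(P::'a::real_or_complex^'n^'n) \<in> Proj k"
  shows "dim (range (\<lambda>v. P *v v)) = DIM('a) * k"
proof -
  have "dim (range (\<lambda>v. P *v v)) = DIM('a) * vec.dim (vec.span (columns P))"
    unfolding range_mult_vec_eq_span by (rule real_dim_eq[OF vec.subspace_span])
  then show ?thesis
    using dim_columns_self_adjoint[OF Proj_adjoint[OF assms]] by (simp add: Proj_rank[OF assms])
qed

lemma range_compl_Proj:
  assumes "P \<in> Proj k"
  shows "range (\<lambda>v. v - P *v v) = {v. P *v v = 0}"
  using Proj_idem[OF assms]
  by (auto simp: matrix_vector_mult_diff_distrib image_iff intro: exI)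
     (metis diff_zero)

lemma dim_range_compl_Proj:
  assumes "(P::'a::real_or_complex^'n^'n) \<in> Proj k"
  shows "dim (range (\<lambda>v. v - P *v v)) + DIM('a) * k = DIM('a) * CARD('n)"
proof -
  let ?S = "range (\<lambda>v. P *v v)" and ?T = "range (\<lambda>v. v - P *v v)"
  have lin: "linear (\<lambda>v. v - P *v v)"
    by (intro linear_compose_sub linear_id[unfolded id_def] linear_mult_vec)
  have "dim (?S \<union> ?T) = dim ?S + dim ?T"
  proof (rule dim_orthogonal_sum)
    fix x y assume "x \<in> ?S" "y \<in> ?T"
    then obtain u where "x = P *v u" and y: "P *v y = 0"
      using range_compl_Proj[OF assms] by blast
    then show "inner x y = 0" using inner_Proj[OF assms, of u y] by simp
  qed
  moreover have "span (?S \<union> ?T) = UNIV"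
  proof -
    have "v \<in> span (?S \<union> ?T)" for v
    proof -
      have "P *v v + (v - P *v v) \<in> span (?S \<union> ?T)" by (intro span_add span_base) auto
      moreover have "P *v v + (v - P *v v) = v" by simp
      ultimately show ?thesis by (simp only:)
    qed
    then show ?thesis by blast
  qed
  then have "dim (span (?S \<union> ?T)) = DIM('a^'n)" by (simp only: dim_UNIV)
  then have "dim (?S \<union> ?T) = DIM('a^'n)" by (simp only: dim_span)
  ultimately show ?thesis using dim_range_Proj[OF assms] by (simp add: mult.commute)
qed

text \<open>
  The ranges of \<open>P\<close> and \<open>I - P\<close> have the same real dimension, hence are isometric; \<open>J\<close> applies an
  isometry to one component of a vector and its inverse to the other one.
\<close>

lemma obtain_swap:
  fixes P :: "'a::real_or_complex^'n^'n"
  assumes P: "P \<in> Proj k" and n: "CARD('n) = 2 * k"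
  obtains J where "linear J" "\<And>v. norm (J v) = norm v" "\<And>v. J (J v) = v"
    "\<And>v. P *v (J v) = J (v - P *v v)"
proof -
  let ?S = "range (\<lambda>v. P *v v)" and ?T = "range (\<lambda>v. v - P *v v)"
  have lin: "linear (\<lambda>v. v - P *v v)"
    by (intro linear_compose_sub linear_id[unfolded id_def] linear_mult_vec)
  have "subspace ?S" "subspace ?T"
    by (intro linear_subspace_image lin linear_mult_vec subspace_UNIV)+
  moreover have "dim ?S = dim ?T"
    using dim_range_Proj[OF P] dim_range_compl_Proj[OF P] n by simp
  ultimately obtain f g where fg: "linear f" "linear g" "f ` ?S = ?T" "g ` ?T = ?S"
      "\<And>x. x \<in> ?S \<Longrightarrow> norm (f x) = norm x" "\<And>x. x \<in> ?T \<Longrightarrow> norm (g x) = norm x"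
      "\<And>x. x \<in> ?S \<Longrightarrow> g (f x) = x" "\<And>x. x \<in> ?T \<Longrightarrow> f (g x) = x"
    by (rule isometries_subspaces) blast
  define J where "J = (\<lambda>v. f (P *v v) + g (v - P *v v))"
  have linJ: "linear J"
    unfolding J_def
    by (intro linear_compose_add linear_compose[OF linear_mult_vec fg(1), unfolded o_def]
        linear_compose[OF lin fg(2), unfolded o_def])
  have fT: "f (P *v v) \<in> ?T" and gS: "g (v - P *v v) \<in> ?S" for v
    using fg(3,4) by blast+
  have PT: "P *v w = 0" if "w \<in> ?T" for w
    using that range_compl_Proj[OF P] by blast
  have PS: "P *v w = w" if "w \<in> ?S" for w
    using that Proj_idem[OF P] by auto
  have PJ: "P *v J v = g (v - P *v v)" for v
    by (simp add: J_def matrix_vector_right_distrib PT[OF fT] PS[OF gS])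
  have QJ: "J v - P *v J v = f (P *v v)" for v
    unfolding PJ by (simp add: J_def)
  have JJ: "J (J v) = v" for v
  proof -
    have "J (J v) = f (P *v J v) + g (J v - P *v J v)" by (rule fun_cong[OF J_def])
    also have "\<dots> = f (g (v - P *v v)) + g (f (P *v v))" unfolding QJ unfolding PJ ..
    finally show ?thesis using fg(7,8) by simp
  qed
  have nrm: "(norm w)\<^sup>2 = (norm (P *v w))\<^sup>2 + (norm (w - P *v w))\<^sup>2" for w
    using norm_Proj_compl[OF P, of w] by simp
  have "(norm (J v))\<^sup>2 = (norm v)\<^sup>2" for v
  proof -
    have "(norm (J v))\<^sup>2 = (norm (g (v - P *v v)))\<^sup>2 + (norm (f (P *v v)))\<^sup>2"
      using nrm[of "J v"] unfolding QJ unfolding PJ .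
    then show ?thesis using nrm[of v] fg(5)[of "P *v v"] fg(6)[of "v - P *v v"] by simp
  qed
  then have nJ: "norm (J v) = norm v" for v by simp
  have "J (v - P *v v) = g (v - P *v v)" for v
    unfolding J_def using Proj_idem[OF P]
    by (simp add: matrix_vector_mult_diff_distrib linear_0[OF fg(1)])
  then have "P *v (J v) = J (v - P *v v)" for v using PJ by simp
  with linJ nJ JJ show thesis by (rule that)
qed

section \<open>Lines\<close>

lemma Proj_1_outer:
  assumes "X \<in> Proj 1"
  obtains x where "norm x = 1" "X = outer x"
proof -
  have "vec.dim (range (\<lambda>v. X *v v)) = 1"
    unfolding range_mult_vec_eq_span using dim_columns_self_adjoint[OF Proj_adjoint[OF assms]]
    by (simp add: Proj_rank[OF assms])
  then obtain B where B: "B \<subseteq> range (\<lambda>v. X *v v)" "vec.independent B"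
      "range (\<lambda>v. X *v v) \<subseteq> vec.span B" "card B = 1"
    using vec.basis_exists by metis
  then obtain b where b: "B = {b}" by (meson card_1_singletonE)
  have "b \<noteq> 0" using B(2) unfolding b by (metis singletonI vec.dependent_zero)
  define x where "x = (1 / norm b) *\<^sub>R b"
  have nx: "norm x = 1" using \<open>b \<noteq> 0\<close> by (simp add: x_def)
  have "X *v b = b" using B(1) Proj_idem[OF assms] unfolding b by auto
  then have Xx: "X *v x = x" by (simp add: x_def matrix_vector_scaleR)
  have "X *v v = herm x v *s x" for v
  proof -
    have "X *v v \<in> vec.span {b}" using B(3) unfolding b by blast
    then obtain c where "X *v v = c *s b" by (auto simp: vec.span_singleton)
    moreover have "b = of_real (norm b) *s x"
      using \<open>b \<noteq> 0\<close> unfolding scaleR_eq_smult[symmetric] by (simp add: x_def)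
    ultimately obtain d where d: "X *v v = d *s x" by (metis vector_smult_assoc)
    have "herm x (X *v v) = d" unfolding d by (simp add: herm_smult_right herm_self nx)
    moreover have "herm x (X *v v) = herm x v" unfolding herm_Proj[OF assms] Xx ..
    ultimately show ?thesis using d by simp
  qed
  then have "X = outer x" by (simp add: matrix_eq outer_vector)
  then show thesis using that nx by blast
qed

lemma outer_Proj_1:
  assumes "norm x = 1"
  shows "outer x \<in> Proj 1"
proof -
  have xx: "herm x x = 1" using assms by (simp add: herm_self)
  have "x \<noteq> 0" using assms by auto
  have idem: "outer x ** outer x = outer x"
    by (simp add: matrix_eq outer_vector herm_smult_right xx flip: matrix_vector_mul_assoc)
  have "range (\<lambda>v. outer x *v v) = vec.span {x}"
  proof
    show "range (\<lambda>v. outer x *v v) \<subseteq> vec.span {x}"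
      by (auto simp: outer_vector vec.span_singleton)
    have "c *s x = outer x *v (c *s x)" for c
      by (simp add: outer_vector herm_smult_right xx)
    then show "vec.span {x} \<subseteq> range (\<lambda>v. outer x *v v)"
      by (auto simp: vec.span_singleton)
  qed
  then have "vec.dim (columns (outer x)) = vec.dim {x}"
    unfolding range_mult_vec_eq_span by (metis vec.dim_span)
  then have "rank (outer x) = 1"
    using \<open>x \<noteq> 0\<close> by (simp add: dim_columns_self_adjoint conj_transpose_outer)
  then show ?thesis using idem by (simp add: Proj_def conj_transpose_outer)
qed

section \<open>Lebesgue measure under linear bijections\<close>

lemma nn_integral_lborel_shift:
  fixes f :: "'e::euclidean_space \<Rightarrow> ennreal"
  assumes [measurable]: "f \<in> borel_measurable borel"
  shows "(\<integral>\<^sup>+y. f (a + y) \<partial>lborel) = (\<integral>\<^sup>+y. f y \<partial>lborel)"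
proof -
  have "(\<integral>\<^sup>+y. f y \<partial>lborel) = (\<integral>\<^sup>+y. f y \<partial>distr lborel borel ((+) a))"
    by (simp only: lborel_distr_plus)
  also have "\<dots> = (\<integral>\<^sup>+y. f (a + y) \<partial>lborel)" by (rule nn_integral_distr) auto
  finally show ?thesis ..
qed

lemma nn_integral_lborel_reflect:
  fixes f :: "'e::euclidean_space \<Rightarrow> ennreal"
  assumes [measurable]: "f \<in> borel_measurable borel"
  shows "(\<integral>\<^sup>+y. f (a - y) \<partial>lborel) = (\<integral>\<^sup>+y. f y \<partial>lborel)"
proof -
  have "(\<integral>\<^sup>+y. f y \<partial>lborel) = (\<integral>\<^sup>+y. f y \<partial>density (distr lborel borel (\<lambda>x::'e. a + (-1) *\<^sub>R x)) (\<lambda>_. ennreal (\<bar>-1\<bar>^DIM('e))))"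
    using lborel_affine[of "-1" a] by simp
  also have "\<dots> = (\<integral>\<^sup>+y. f (a + (-1) *\<^sub>R y) \<partial>lborel)"
    by (simp add: density_1 nn_integral_distr)
  finally show ?thesis by simp
qed

text \<open>
  Integrate the indicator of \<open>{(x, y). x \<in> A \<and> x + y \<in> B}\<close> in both orders; translation invariance of
  the two measures evaluates the inner integrals.
\<close>

lemma translation_invariant_proportional:
  fixes \<mu> :: "'e::euclidean_space measure"
  assumes sets [measurable_cong]: "sets \<mu> = sets borel" and fin: "sigma_finite_measure \<mu>"
    and inv: "\<And>a. distr \<mu> borel ((+) a) = \<mu>"
    and A [measurable]: "A \<in> sets borel" and B [measurable]: "B \<in> sets borel"
  shows "emeasure \<mu> A * emeasure lborel B = emeasure lborel A * emeasure \<mu> B"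
proof -
  interpret \<mu>: sigma_finite_measure \<mu> by fact
  interpret P: pair_sigma_finite \<mu> lborel ..
  have inv': "(\<integral>\<^sup>+x. f (a + x) \<partial>\<mu>) = (\<integral>\<^sup>+x. f x \<partial>\<mu>)"
    if [measurable]: "f \<in> borel_measurable borel" for f :: "'e \<Rightarrow> ennreal" and a
    by (subst (2) inv[of a, symmetric], subst nn_integral_distr) auto
  have "emeasure \<mu> A * emeasure lborel B = (\<integral>\<^sup>+x. indicator A x * emeasure lborel B \<partial>\<mu>)"
    by (simp add: nn_integral_multc)
  also have "\<dots> = (\<integral>\<^sup>+x. \<integral>\<^sup>+y. indicator A x * indicator B (x + y) \<partial>lborel \<partial>\<mu>)"
  proof (rule nn_integral_cong)
    fix x
    have "(\<integral>\<^sup>+y. indicator B (x + y) \<partial>lborel) = emeasure lborel B"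
      by (subst nn_integral_lborel_shift) auto
    then show "indicator A x * emeasure lborel B = (\<integral>\<^sup>+y. indicator A x * indicator B (x + y) \<partial>lborel)"
      by (simp add: nn_integral_cmult)
  qed
  also have "\<dots> = (\<integral>\<^sup>+y. \<integral>\<^sup>+x. indicator A x * indicator B (x + y) \<partial>\<mu> \<partial>lborel)"
    by (rule P.Fubini'[symmetric]) measurable
  also have "\<dots> = (\<integral>\<^sup>+y. \<integral>\<^sup>+x. indicator A (x - y) * indicator B x \<partial>\<mu> \<partial>lborel)"
  proof (rule nn_integral_cong)
    fix y
    show "(\<integral>\<^sup>+x. indicator A x * indicator B (x + y) \<partial>\<mu>) = (\<integral>\<^sup>+x. indicator A (x - y) * indicator B x \<partial>\<mu>)"
      using inv'[of "\<lambda>x. indicator A (x - y) * indicator B x" y] by (simp add: add.commute)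
  qed
  also have "\<dots> = (\<integral>\<^sup>+x. \<integral>\<^sup>+y. indicator A (x - y) * indicator B x \<partial>lborel \<partial>\<mu>)"
    by (rule P.Fubini') measurable
  also have "\<dots> = (\<integral>\<^sup>+x. emeasure lborel A * indicator B x \<partial>\<mu>)"
  proof (rule nn_integral_cong)
    fix x
    have "(\<integral>\<^sup>+y. indicator A (x - y) \<partial>lborel) = emeasure lborel A"
      by (subst nn_integral_lborel_reflect) auto
    then show "(\<integral>\<^sup>+y. indicator A (x - y) * indicator B x \<partial>lborel) = emeasure lborel A * indicator B x"
      by (simp add: nn_integral_multc)
  qed
  also have "\<dots> = emeasure lborel A * emeasure \<mu> B"
    by (simp add: nn_integral_cmult)
  finally show ?thesis .
qed

text \<open>
  The image of Lebesgue measure under \<open>T\<close> is again translation invariant, and comparing the measures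
  of the unit ball gives the factor, which is the inverse of the absolute determinant of \<open>T\<close>.
\<close>

lemma lborel_linear_factor:
  fixes T S :: "'e::euclidean_space \<Rightarrow> 'e"
  assumes T: "linear T" and S: "linear S" and TS: "\<And>v. T (S v) = v" and ST: "\<And>v. S (T v) = v"
  obtains c where "c > 0" "\<And>A. A \<in> sets borel \<Longrightarrow> emeasure lborel (T -` A) = ennreal c * emeasure lborel A"
    "c = measure lborel (T -` ball 0 1) / measure lborel (ball (0::'e) 1)"
proof -
  have contT: "continuous_on UNIV T" and contS: "continuous_on UNIV S"
    using T S by (auto intro: linear_continuous_on linear_conv_bounded_linear[THEN iffD1])
  have [measurable]: "T \<in> borel_measurable borel" "S \<in> borel_measurable borel"
    using contT contS by (auto intro: borel_measurable_continuous_onI)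
  define \<mu> where "\<mu> = distr lborel borel T"
  have sets\<mu>: "sets \<mu> = sets borel" by (simp add: \<mu>_def)
  have em: "emeasure \<mu> A = emeasure lborel (T -` A)" if "A \<in> sets borel" for A
    using that by (simp add: \<mu>_def emeasure_distr)
  have fin: "sigma_finite_measure \<mu>"
  proof (standard, intro exI conjI ballI)
    let ?A = "range (\<lambda>n::nat. S -` ball 0 (real n))"
    show "countable ?A" by simp
    have op: "open (S -` ball 0 (real n))" for n using contS by (simp add: continuous_on_open_vimage)
    then show "?A \<subseteq> sets \<mu>" by (auto simp: sets\<mu>)
    show "\<Union>?A = space \<mu>"
      using reals_Archimedean2 by (fastforce simp: \<mu>_def)
    fix a assume "a \<in> ?A"
    then obtain n where a: "a = S -` ball 0 (real n)" by auto
    have "a \<in> sets borel" using op[of n] a by auto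
    moreover have "T -` a = ball (0::'e) (real n)" by (auto simp: a ST)
    ultimately have "emeasure \<mu> a = emeasure lborel (ball (0::'e) (real n))"
      using em by simp
    then show "emeasure \<mu> a \<noteq> \<infinity>" using emeasure_lborel_ball_finite[of "0::'e" "real n"] by auto
  qed
  have inv: "distr \<mu> borel ((+) a) = \<mu>" for a
  proof -
    have "distr \<mu> borel ((+) a) = distr lborel borel (T \<circ> ((+) (S a)))"
      unfolding \<mu>_def by (subst distr_distr) (auto simp: o_def linear_add[OF T] TS)
    also have "\<dots> = distr (distr lborel borel ((+) (S a))) borel T"
      by (subst distr_distr) auto
    finally show ?thesis by (simp only: lborel_distr_plus \<mu>_def)
  qed
  let ?B = "ball (0::'e) 1"
  have b: "emeasure lborel ?B = ennreal (measure lborel ?B)" "measure lborel ?B > 0"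
    using emeasure_lborel_ball_finite[of "0::'e" 1] content_ball_pos[of 1 "0::'e"]
    by (auto simp: emeasure_eq_ennreal_measure)
  have TB: "T -` ?B = S ` ?B"
  proof (intro equalityI subsetI)
    fix x assume "x \<in> T -` ?B"
    then show "x \<in> S ` ?B" using ST[of x] by (intro image_eqI[of _ _ "T x"]) auto
  qed (auto simp: TS)
  have opT: "open (T -` ?B)" using contT by (simp add: continuous_on_open_vimage)
  have "bounded (T -` ?B)" unfolding TB
    using S by (intro bounded_linear_image) (auto simp: linear_conv_bounded_linear)
  then have f: "emeasure lborel (T -` ?B) < \<infinity>" by (rule emeasure_bounded_finite)
  then have t: "emeasure lborel (T -` ?B) = ennreal (measure lborel (T -` ?B))"
    by (auto simp: emeasure_eq_ennreal_measure)
  have "0 \<in> T -` ?B" by (simp add: linear_0[OF T])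
  then obtain e where e: "e > 0" "ball 0 e \<subseteq> T -` ?B" using opT open_contains_ball by blast
  have "0 < measure lborel (ball (0::'e) e)" by (rule content_ball_pos) fact
  also have "\<dots> \<le> measure lborel (T -` ?B)"
    using e f opT by (intro measure_mono_fmeasurable) (auto simp: fmeasurable_def)
  finally have tpos: "measure lborel (T -` ?B) > 0" .
  show thesis
  proof (rule that[OF _ _ refl])
    show "0 < measure lborel (T -` ?B) / measure lborel ?B" using tpos b(2) by simp
    fix A :: "'e set" assume A: "A \<in> sets borel"
    have "emeasure lborel (T -` A) * ennreal (measure lborel ?B)
        = emeasure lborel A * ennreal (measure lborel (T -` ?B))"
      using translation_invariant_proportional[OF sets\<mu> fin inv A, of ?B] em[OF A] em[of ?B] b t
      by simp
    then have eq: "emeasure lborel (T -` A) * (ennreal (measure lborel ?B) * ennreal (1 / measure lborel ?B))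
        = emeasure lborel A * (ennreal (measure lborel (T -` ?B)) * ennreal (1 / measure lborel ?B))"
      by (simp only: mult.assoc[symmetric])
    have "ennreal (measure lborel ?B) * ennreal (1 / measure lborel ?B) = 1"
      using b(2) by (simp flip: ennreal_mult)
    moreover have "ennreal (measure lborel (T -` ?B)) * ennreal (1 / measure lborel ?B)
        = ennreal (measure lborel (T -` ?B) / measure lborel ?B)"
      using b(2) tpos by (simp flip: ennreal_mult)
    ultimately show "emeasure lborel (T -` A)
        = ennreal (measure lborel (T -` ?B) / measure lborel ?B) * emeasure lborel A"
      using eq by (simp only: mult_1_left mult_1_right mult.commute)
  qed
qed

section \<open>The joint volume of the two components of a vector\<close>

context
  fixes P :: "'a::real_or_complex^'n^'n" and k :: nat
  assumes P: "P \<in> Proj k" and n: "CARD('n) = 2 * k" and k: "k > 0"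
begin

text \<open>
  The bounds are for squared lengths, as these are the quantities whose ratio is needed later.
\<close>

definition box_vol :: "real \<Rightarrow> real \<Rightarrow> ennreal" where
  "box_vol a b = emeasure lborel {v. (norm (P *v v))\<^sup>2 \<le> a \<and> (norm (v - P *v v))\<^sup>2 \<le> b}"

lemma closed_box: "closed {v. (norm (P *v v))\<^sup>2 \<le> a \<and> (norm (v - P *v v))\<^sup>2 \<le> b}"
proof -
  have "continuous_on UNIV (\<lambda>v. P *v v)"
    by (intro linear_continuous_on bounded_linear_mult_vec)
  then show ?thesis
    by (intro closed_Collect_conj closed_Collect_le continuous_intros)
qed

lemma box_sets [measurable]: "{v. (norm (P *v v))\<^sup>2 \<le> a \<and> (norm (v - P *v v))\<^sup>2 \<le> b} \<in> sets borel"
  using closed_box by (rule borel_closed)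

lemma norm2_split: "(norm v)\<^sup>2 = (norm (P *v v))\<^sup>2 + (norm (v - P *v v))\<^sup>2"
  using norm_Proj_compl[OF P, of v] by simp

lemma box_vol_finite: "box_vol a b < \<infinity>"
proof -
  have "bounded {v. (norm (P *v v))\<^sup>2 \<le> a \<and> (norm (v - P *v v))\<^sup>2 \<le> b}"
  proof (rule boundedI[of _ "sqrt (a + b)"])
    fix v assume "v \<in> {v. (norm (P *v v))\<^sup>2 \<le> a \<and> (norm (v - P *v v))\<^sup>2 \<le> b}"
    then have "(norm v)\<^sup>2 \<le> a + b" using norm2_split[of v] by simp
    then show "norm v \<le> sqrt (a + b)" by (rule real_le_rsqrt)
  qed
  then show ?thesis unfolding box_vol_def by (rule emeasure_bounded_finite)
qed

lemma box_vol_swap: "box_vol a b = box_vol b a"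
proof -
  obtain J where J: "linear J" "\<And>v. norm (J v) = norm v" "\<And>v. J (J v) = v"
      "\<And>v. P *v (J v) = J (v - P *v v)"
    using obtain_swap[OF P n] by blast
  have PJ: "norm (P *v J v) = norm (v - P *v v)" for v
    unfolding J(4) J(2) ..
  have J': "norm (J v - P *v J v) = norm (P *v v)" for v
  proof -
    have "J v - P *v J v = J (P *v v)" unfolding J(4) by (simp add: linear_diff[OF J(1)])
    then show ?thesis by (simp add: J(2))
  qed
  have pre: "J -` {v. (norm (P *v v))\<^sup>2 \<le> a \<and> (norm (v - P *v v))\<^sup>2 \<le> b}
      = {v. (norm (P *v v))\<^sup>2 \<le> b \<and> (norm (v - P *v v))\<^sup>2 \<le> a}"
    by (auto simp: J' PJ)
  obtain c where c: "\<And>A. A \<in> sets borel \<Longrightarrow> emeasure lborel (J -` A) = ennreal c * emeasure lborel A"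
    "c = measure lborel (J -` ball 0 1) / measure lborel (ball (0::'a^'n) 1)"
    using lborel_linear_factor[OF J(1) J(1) J(3) J(3)] by metis
  have "J -` ball 0 1 = ball 0 1" using J(2) by auto
  then have "c = 1" using c(2) content_ball_pos[of 1 "0::'a^'n"] by simp
  then show ?thesis using c(1)[OF box_sets[of a b]] unfolding pre by (simp add: box_vol_def)
qed

lemma box_vol_scale_both:
  assumes "r > 0"
  shows "box_vol (r * a) (r * b) = ennreal (r powr (real DIM('a) * real k)) * box_vol a b"
proof -
  let ?D = "DIM('a) * (2 * k)"
  have sq: "sqrt r ^ ?D = r powr (real DIM('a) * real k)"
  proof -
    have "sqrt r ^ ?D = (sqrt r ^ 2) ^ (DIM('a) * k)" by (simp add: mult_ac flip: power_mult)
    also have "\<dots> = r powr real (DIM('a) * k)" using assms by (subst powr_realpow) auto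
    finally show ?thesis by simp
  qed
  let ?X = "{v. (norm (P *v v))\<^sup>2 \<le> r * a \<and> (norm (v - P *v v))\<^sup>2 \<le> r * b}"
  have pre: "(\<lambda>v. 0 + sqrt r *\<^sub>R v) -` ?X
      = {v. (norm (P *v v))\<^sup>2 \<le> a \<and> (norm (v - P *v v))\<^sup>2 \<le> b}"
    using assms by (auto simp: matrix_vector_scaleR power_mult_distrib simp flip: scaleR_diff_right)
  have "box_vol (r * a) (r * b)
      = emeasure (density (distr lborel borel (\<lambda>x::'a^'n. 0 + sqrt r *\<^sub>R x)) (\<lambda>_. \<bar>sqrt r\<bar>^DIM('a^'n))) ?X"
    unfolding box_vol_def using assms by (subst lborel_affine[of "sqrt r" 0]) auto
  also have "\<dots> = ennreal (\<bar>sqrt r\<bar>^DIM('a^'n)) * emeasure (distr lborel borel (\<lambda>x::'a^'n. 0 + sqrt r *\<^sub>R x)) ?X"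
    by (subst emeasure_density_const) auto
  also have "emeasure (distr lborel borel (\<lambda>x::'a^'n. 0 + sqrt r *\<^sub>R x)) ?X = box_vol a b"
    by (subst emeasure_distr) (auto simp: box_vol_def pre[simplified])
  also have "\<bar>sqrt r\<bar>^DIM('a^'n) = r powr (real DIM('a) * real k)"
    using assms sq by (simp add: n mult_ac)
  finally show ?thesis .
qed

lemma box_vol_scale:
  assumes "r > 0"
  obtains c where "c > 0" "\<And>a b. box_vol a b = ennreal c * box_vol (r * a) b"
proof -
  define T where "T = (\<lambda>s v. sqrt s *\<^sub>R (P *v v) + (v - P *v v))"
  have lin: "linear (T s)" for s
    unfolding T_def
    by (intro linear_compose_add linear_compose_sub linear_id[unfolded id_def] linear_mult_vec
        linear_compose_scale_right)
  have PT: "P *v T s v = sqrt s *\<^sub>R (P *v v)" for s v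
    using Proj_idem[OF P]
    by (simp add: T_def matrix_vector_right_distrib matrix_vector_mult_diff_distrib matrix_vector_scaleR)
  have QT: "T s v - P *v T s v = v - P *v v" for s v
    unfolding PT by (simp add: T_def)
  have QT': "T s v - sqrt s *\<^sub>R (P *v v) = v - P *v v" for s v
    by (simp add: T_def)
  have inv: "T s (T t v) = v" if "s * t = 1" for s t v
  proof -
    have "T s (T t v) = sqrt s *\<^sub>R (P *v T t v) + (T t v - P *v T t v)"
      by (rule fun_cong[OF fun_cong[OF T_def]])
    also have "\<dots> = (sqrt s * sqrt t) *\<^sub>R (P *v v) + (v - P *v v)" unfolding QT unfolding PT by simp
    also have "sqrt s * sqrt t = 1" using that by (simp flip: real_sqrt_mult)
    finally show ?thesis by simp
  qed
  have pre: "T r -` {v. (norm (P *v v))\<^sup>2 \<le> r * a \<and> (norm (v - P *v v))\<^sup>2 \<le> b}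
      = {v. (norm (P *v v))\<^sup>2 \<le> a \<and> (norm (v - P *v v))\<^sup>2 \<le> b}" for a b
    using assms by (auto simp: PT QT' power_mult_distrib)
  have 1: "r * (1 / r) = 1" "(1 / r) * r = 1" using assms by auto
  obtain c where c: "c > 0" "\<And>A. A \<in> sets borel \<Longrightarrow> emeasure lborel (T r -` A) = ennreal c * emeasure lborel A"
    using lborel_linear_factor[OF lin[of r] lin[of "1 / r"] inv[OF 1(1)] inv[OF 1(2)]] by metis
  show thesis
  proof (rule that[OF c(1)])
    fix a b
    show "box_vol a b = ennreal c * box_vol (r * a) b"
      using c(2)[OF box_sets[of "r * a" b]] unfolding pre box_vol_def .
  qed
qed

text \<open>
  Scaling one component by \<open>r\<close> and scaling the other one change volumes by the same factor, as the
  components can be exchanged; together they scale the whole space, which gives the square of it.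
\<close>

lemma box_vol_scale_left:
  assumes "r > 0"
  shows "box_vol (r * a) b = ennreal (r powr (real DIM('a) * real k / 2)) * box_vol a b"
proof -
  let ?q = "real DIM('a) * real k"
  obtain c where c: "c > 0" "\<And>a b. box_vol a b = ennreal c * box_vol (r * a) b"
    using box_vol_scale[OF assms] by blast
  have fin: "box_vol 1 1 = ennreal (enn2real (box_vol 1 1))"
    using box_vol_finite[of 1 1] by simp
  have pos: "box_vol 1 1 > 0"
  proof -
    have "ball 0 1 \<subseteq> {v. (norm (P *v v))\<^sup>2 \<le> 1 \<and> (norm (v - P *v v))\<^sup>2 \<le> 1}"
    proof
      fix v :: "'a^'n" assume "v \<in> ball 0 1"
      then have "(norm v)\<^sup>2 \<le> 1" by (simp add: power_le_one)
      then show "v \<in> {v. (norm (P *v v))\<^sup>2 \<le> 1 \<and> (norm (v - P *v v))\<^sup>2 \<le> 1}"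
        using norm2_split[of v] zero_le_power2[of "norm (P *v v)"] zero_le_power2[of "norm (v - P *v v)"]
        by (simp, linarith)
    qed
    then have "emeasure lborel (ball (0::'a^'n) 1) \<le> box_vol 1 1"
      unfolding box_vol_def by (rule emeasure_mono) simp
    moreover have "emeasure lborel (ball (0::'a^'n) 1) > 0"
      using content_ball_pos[of 1 "0::'a^'n"] emeasure_lborel_ball_finite[of "0::'a^'n" 1]
      by (metis Sigma_Algebra.measure_def enn2real_positive_iff zero_less_one)
    ultimately show ?thesis by simp
  qed
  define m where "m = enn2real (box_vol 1 1)"
  have m: "box_vol 1 1 = ennreal m" "m > 0" using fin pos box_vol_finite[of 1 1] by (auto simp: m_def enn2real_positive_iff)
  have "box_vol 1 1 = ennreal c * box_vol (r * 1) 1" by (rule c(2))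
  also have "box_vol (r * 1) 1 = box_vol 1 (r * 1)" by (simp add: box_vol_swap)
  also have "box_vol 1 (r * 1) = ennreal c * box_vol (r * 1) (r * 1)" by (rule c(2))
  also have "box_vol (r * 1) (r * 1) = ennreal (r powr ?q) * box_vol 1 1"
    by (rule box_vol_scale_both[OF assms])
  finally have "ennreal m = ennreal (c * (c * (r powr ?q * m)))"
    using m c(1) by (simp add: ennreal_mult)
  then have "m = c * (c * (r powr ?q * m))"
    using m c(1) by (subst (asm) ennreal_inj) auto
  then have "c * c * r powr ?q = 1" using m(2) by (simp add: mult_ac)
  also have "r powr ?q = (r powr (?q / 2)) * (r powr (?q / 2))"
    unfolding powr_add[symmetric] by (simp add: mult.commute)
  finally have "(c * r powr (?q / 2))\<^sup>2 = 1" by (simp add: power2_eq_square mult_ac)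
  then have "c * r powr (?q / 2) = 1 \<or> c * r powr (?q / 2) = - 1"
    by (simp only: power2_eq_1_iff)
  moreover have "c * r powr (?q / 2) > 0" using c(1) assms by simp
  ultimately have "c * r powr (?q / 2) = 1" by linarith
  then have cr: "r powr (?q / 2) * c = 1" by (simp only: mult.commute)
  have "ennreal (r powr (?q / 2)) * box_vol a b = ennreal (r powr (?q / 2) * c) * box_vol (r * a) b"
    unfolding c(2)[of a b] using c(1) by (simp add: ennreal_mult mult.assoc)
  then show ?thesis by (simp add: cr)
qed

text \<open>
  As a product of powers, this says that under Lebesgue measure the two squared lengths behave like
  independent quantities with densities proportional to \<open>t powr (q - 1)\<close>.
\<close>

lemma box_vol_eq:
  assumes "a \<ge> 0" "b \<ge> 0"
  shows "box_vol a b = ennreal (a powr (real DIM('a) * real k / 2) * b powr (real DIM('a) * real k / 2))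
    * box_vol 1 1"
proof -
  let ?q = "real DIM('a) * real k / 2"
  have q: "?q > 0" using k by simp
  have zero: "box_vol 0 b = 0" for b
  proof -
    have "box_vol (2 * 0) b = ennreal (2 powr ?q) * box_vol 0 b" by (rule box_vol_scale_left) simp
    moreover define z where "z = enn2real (box_vol 0 b)"
    then have "box_vol 0 b = ennreal z" "z \<ge> 0" using box_vol_finite[of 0 b] by auto
    ultimately have "ennreal z = ennreal (2 powr ?q * z)" by (simp add: ennreal_mult)
    then have "z = 2 powr ?q * z" using \<open>z \<ge> 0\<close> by (subst (asm) ennreal_inj) auto
    moreover have "2 powr ?q > 1" using q by simp
    ultimately have "z = 0" using k by simp
    then show ?thesis using \<open>box_vol 0 b = ennreal z\<close> by simp
  qed
  show ?thesis
  proof (cases "a = 0 \<or> b = 0")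
    case True
    then show ?thesis using zero box_vol_swap[of a b] by auto
  next
    case False
    then have ab: "a > 0" "b > 0" using assms by auto
    have "box_vol a b = ennreal (a powr ?q) * box_vol 1 b" using box_vol_scale_left[OF ab(1), of 1 b] by simp
    also have "box_vol 1 b = ennreal (b powr ?q) * box_vol 1 1"
      using box_vol_scale_left[OF ab(2), of 1 1] box_vol_swap[of 1 b] by simp
    finally show ?thesis by (simp add: ennreal_mult mult.assoc)
  qed
qed

lemma box_vol_neg: "a < 0 \<or> b < 0 \<Longrightarrow> box_vol a b = 0"
proof -
  assume "a < 0 \<or> b < 0"
  then have "{v. (norm (P *v v))\<^sup>2 \<le> a \<and> (norm (v - P *v v))\<^sup>2 \<le> b} = {}"
    using zero_le_power2 order_trans by (metis (no_types, lifting) Collect_empty_eq linorder_not_less)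
  then show ?thesis unfolding box_vol_def by (simp only: emeasure_empty)
qed

end

section \<open>The law of the squared length of a projected vector\<close>

definition pow_density :: "real \<Rightarrow> real \<Rightarrow> real" where
  "pow_density q t = indicator {0<..} t * (q * t powr (q - 1))"

lemma pow_density_measurable [measurable]: "pow_density q \<in> borel_measurable borel"
  unfolding pow_density_def by measurable

lemma pow_density_nonneg: "q > 0 \<Longrightarrow> pow_density q t \<ge> 0"
  by (simp add: pow_density_def)

lemma nn_integral_pow_density:
  assumes q: "q > 0"
  shows "(\<integral>\<^sup>+t. ennreal (pow_density q t) * indicator {..a} t \<partial>lborel) = (if a \<ge> 0 then ennreal (a powr q) else 0)"
proof (cases "a \<ge> 0")
  case True
  have "((\<lambda>t. t powr (q - 1)) has_integral (a powr (q - 1 + 1) / (q - 1 + 1))) {0..a}"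
    using q True by (intro has_integral_powr_from_0) auto
  then have "((\<lambda>t. q * t powr (q - 1)) has_integral (q * (a powr q / q))) {0..a}"
    by (intro has_integral_mult_right) simp
  then have "((\<lambda>t. q * t powr (q - 1)) has_integral (a powr q)) {0..a}" using q by simp
  then have "(\<integral>\<^sup>+t. ennreal (q * t powr (q - 1)) * indicator {0..a} t \<partial>lborel) = ennreal (a powr q)"
    using q by (intro nn_integral_has_integral_lebesgue') auto
  moreover have "ennreal (q * t powr (q - 1)) * indicator {0..a} t = ennreal (pow_density q t) * indicator {..a} t" for t
    by (auto simp: pow_density_def indicator_def)
  ultimately show ?thesis using True by simp
next
  case False
  then have "ennreal (pow_density q t) * indicator {..a} t = 0" for t
    by (auto simp: pow_density_def indicator_def)
  then show ?thesis using False by (simp only: nn_integral_const mult_zero_left if_False)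
qed

lemma measure_eq_on_lower_boxes:
  fixes M N :: "(real \<times> real) measure"
  assumes "sets M = sets borel" "sets N = sets borel"
    and eq: "\<And>a b. emeasure M ({..a} \<times> {..b}) = emeasure N ({..a} \<times> {..b})"
    and fin: "\<And>a b. emeasure M ({..a} \<times> {..b}) < \<infinity>"
  shows "M = N"
proof (rule measure_eqI_generator_eq[of "range (\<lambda>p::real \<times> real. {..p})" UNIV])
  have box: "{..p} = {..fst p} \<times> {..snd p}" for p :: "real \<times> real"
    by (cases p) (auto simp: less_eq_prod_def)
  show "Int_stable (range (\<lambda>p::real \<times> real. {..p}))"
  proof (rule Int_stableI_image)
    fix p p' :: "real \<times> real"
    have "{..p} \<inter> {..p'} = {..(min (fst p) (fst p'), min (snd p) (snd p'))}"
      unfolding box by auto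
    then show "\<exists>r\<in>UNIV. {..p} \<inter> {..p'} = {..r}" by blast
  qed
  show "emeasure M X = emeasure N X" if "X \<in> range (\<lambda>p::real \<times> real. {..p})" for X
    using that eq by (auto simp: box)
  have gen: "sets (borel :: (real \<times> real) measure) = sigma_sets UNIV (range (\<lambda>p. {..p}))"
    by (subst borel_eq_atMost) (rule sets_measure_of, simp)
  show "sets M = sigma_sets UNIV (range (\<lambda>p. {..p}))" "sets N = sigma_sets UNIV (range (\<lambda>p. {..p}))"
    using assms gen by auto
  show "range (\<lambda>n::nat. {..(real n, real n)}) \<subseteq> range (\<lambda>p::real \<times> real. {..p})" by auto
  show "(\<Union>n::nat. {..(real n, real n)}) = (UNIV :: (real \<times> real) set)"
  proof -
    have "\<exists>n. p \<le> (real n, real n)" for p :: "real \<times> real"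
    proof -
      obtain n where "max (fst p) (snd p) \<le> real n" using real_arch_simple by blast
      then show ?thesis by (intro exI[of _ n]) (cases p, auto simp: less_eq_prod_def)
    qed
    then show ?thesis by auto
  qed
  show "emeasure M {..(real n, real n)} \<noteq> \<infinity>" for n
    using fin[of "real n" "real n"] by (simp add: box)
qed auto

definition beta_density :: "real \<Rightarrow> real \<Rightarrow> real" where
  "beta_density q t = indicator {0<..<1} t * (t powr (q - 1) * (1 - t) powr (q - 1))"

lemma beta_density_measurable [measurable]: "beta_density q \<in> borel_measurable borel"
  unfolding beta_density_def by measurable

lemma beta_density_nonneg: "beta_density q t \<ge> 0"
  by (simp add: beta_density_def)

lemma nn_integral_beta_density:
  assumes "q > 0"
  shows "(\<integral>\<^sup>+t. beta_density q t \<partial>lborel) = ennreal (Beta q q)"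
proof -
  have "(\<integral>\<^sup>+t. ennreal (t powr (q - 1) * (1 - t) powr (q - 1)) * indicator {0..1} t \<partial>lborel) = ennreal (Beta q q)"
    using assms by (intro nn_integral_has_integral_lebesgue' has_integral_Beta_real) auto
  moreover have "ennreal (t powr (q - 1) * (1 - t) powr (q - 1)) * indicator {0..1} t = ennreal (beta_density q t)" for t
    by (auto simp: beta_density_def indicator_def)
  ultimately show ?thesis by simp
qed

text \<open>
  For two independent quantities with power densities, passing to their sum \<open>s\<close> and the proportion \<open>t\<close> of the first
  one in the sum separates the variables.
\<close>

lemma pow_density_ratio:
  assumes q: "q > 0" and [measurable]: "f \<in> borel_measurable borel" "g \<in> borel_measurable borel"
  shows "(\<integral>\<^sup>+a. \<integral>\<^sup>+b. ennreal (pow_density q a * pow_density q b) * (g (a + b) * f (a / (a + b))) \<partial>lborel \<partial>lborel)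
    = (\<integral>\<^sup>+s. g s * ennreal (indicator {0<..} s * (q\<^sup>2 * s powr (2 * q - 1))) \<partial>lborel)
      * (\<integral>\<^sup>+t. f t * ennreal (beta_density q t) \<partial>lborel)"
proof -
  let ?h = "\<lambda>a s. ennreal (pow_density q a * pow_density q (s - a)) * (g s * f (a / s))"
  have "(\<integral>\<^sup>+a. \<integral>\<^sup>+b. ennreal (pow_density q a * pow_density q b) * (g (a + b) * f (a / (a + b))) \<partial>lborel \<partial>lborel)
      = (\<integral>\<^sup>+a. \<integral>\<^sup>+s. ?h a s \<partial>lborel \<partial>lborel)"
  proof (rule nn_integral_cong)
    fix a :: real
    show "(\<integral>\<^sup>+b. ennreal (pow_density q a * pow_density q b) * (g (a + b) * f (a / (a + b))) \<partial>lborel)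
        = (\<integral>\<^sup>+s. ?h a s \<partial>lborel)"
      using nn_integral_lborel_shift[of "?h a" a] by simp
  qed
  also have "\<dots> = (\<integral>\<^sup>+s. \<integral>\<^sup>+a. ?h a s \<partial>lborel \<partial>lborel)"
    by (rule lborel_pair.Fubini'[symmetric]) measurable
  also have "\<dots> = (\<integral>\<^sup>+s. g s * ennreal (indicator {0<..} s * (q\<^sup>2 * s powr (2 * q - 1)))
      * (\<integral>\<^sup>+t. f t * ennreal (beta_density q t) \<partial>lborel) \<partial>lborel)"
  proof (rule nn_integral_cong)
    fix s :: real
    show "(\<integral>\<^sup>+a. ?h a s \<partial>lborel) = g s * ennreal (indicator {0<..} s * (q\<^sup>2 * s powr (2 * q - 1)))
      * (\<integral>\<^sup>+t. f t * ennreal (beta_density q t) \<partial>lborel)"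
    proof (cases "s > 0")
      case False
      then have "pow_density q a * pow_density q (s - a) = 0" for a
        by (auto simp: pow_density_def indicator_def)
      then have "(\<integral>\<^sup>+a. ?h a s \<partial>lborel) = 0" by (simp only: ennreal_0 mult_zero_left nn_integral_const)
      then show ?thesis using False by simp
    next
      case True
      have dens: "s * (pow_density q (s * t) * pow_density q (s - s * t))
          = q\<^sup>2 * s powr (2 * q - 1) * beta_density q t" for t
      proof (cases "0 < t \<and> t < 1")
        case t: True
        then have st: "s * t > 0" "s - s * t = s * (1 - t)" "s * (1 - t) > 0"
          using True by (auto simp: algebra_simps)
        have "s powr (2 * q - 1) = s powr (1 + (q - 1) + (q - 1))" by (simp add: algebra_simps)
        also have "\<dots> = s * s powr (q - 1) * s powr (q - 1)" unfolding powr_add using True by simp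
        finally show ?thesis
          using st t True by (simp add: pow_density_def beta_density_def powr_mult power2_eq_square)
      next
        case False
        then consider "s * t \<le> 0" | "s - s * t \<le> 0"
          using True by (force simp: mult_le_0_iff)
        then have "pow_density q (s * t) * pow_density q (s - s * t) = 0"
          by cases (auto simp: pow_density_def)
        then show ?thesis using False by (auto simp: beta_density_def)
      qed
      have "(\<integral>\<^sup>+a. ?h a s \<partial>lborel) = ennreal \<bar>s\<bar> * (\<integral>\<^sup>+t. ?h (0 + s * t) s \<partial>lborel)"
        using True by (intro nn_integral_real_affine) auto
      also have "\<dots> = (\<integral>\<^sup>+t. ennreal s * ?h (s * t) s \<partial>lborel)"
        using True by (simp add: nn_integral_cmult)
      also have "\<dots> = (\<integral>\<^sup>+t. (g s * ennreal (q\<^sup>2 * s powr (2 * q - 1))) * (f t * ennreal (beta_density q t)) \<partial>lborel)"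
      proof (rule nn_integral_cong)
        fix t
        have "ennreal s * ?h (s * t) s
            = ennreal (s * (pow_density q (s * t) * pow_density q (s - s * t))) * (g s * f t)"
          using True q by (simp add: ennreal_mult pow_density_nonneg mult.assoc)
        also have "\<dots> = (g s * ennreal (q\<^sup>2 * s powr (2 * q - 1))) * (f t * ennreal (beta_density q t))"
          unfolding dens by (simp add: ennreal_mult beta_density_nonneg mult_ac)
        finally show "ennreal s * ?h (s * t) s
            = (g s * ennreal (q\<^sup>2 * s powr (2 * q - 1))) * (f t * ennreal (beta_density q t))" .
      qed
      also have "\<dots> = (g s * ennreal (q\<^sup>2 * s powr (2 * q - 1))) * (\<integral>\<^sup>+t. f t * ennreal (beta_density q t) \<partial>lborel)"
        by (rule nn_integral_cmult) simp
      finally show ?thesis using True by simp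
    qed
  qed
  also have "\<dots> = (\<integral>\<^sup>+s. g s * ennreal (indicator {0<..} s * (q\<^sup>2 * s powr (2 * q - 1))) \<partial>lborel)
      * (\<integral>\<^sup>+t. f t * ennreal (beta_density q t) \<partial>lborel)"
    by (rule nn_integral_multc) simp
  finally show ?thesis .
qed

lemma mult_vec_measurable [measurable]:
  "(\<lambda>v. (P::'a::real_or_complex^'n^'m) *v v) \<in> borel_measurable borel"
  by (intro borel_measurable_continuous_onI linear_continuous_on bounded_linear_mult_vec)

text \<open>
  The two measures on the plane agree on the boxes whose volume is \<open>box_vol\<close>, and these boxes
  generate all Borel sets.
\<close>

lemma nn_integral_components:
  fixes P :: "'a::real_or_complex^'n^'n" and F :: "real \<times> real \<Rightarrow> ennreal"
  assumes P: "P \<in> Proj k" and n: "CARD('n) = 2 * k" and k: "k > 0"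
    and [measurable]: "F \<in> borel_measurable borel"
  defines "q \<equiv> real DIM('a) * real k / 2"
  shows "(\<integral>\<^sup>+v. F ((norm (P *v v))\<^sup>2, (norm (v - P *v v))\<^sup>2) \<partial>lborel)
    = box_vol P 1 1 * (\<integral>\<^sup>+a. \<integral>\<^sup>+b. ennreal (pow_density q a * pow_density q b) * F (a, b) \<partial>lborel \<partial>lborel)"
proof -
  have q: "q > 0" using k by (simp add: q_def)
  let ?g = "\<lambda>v. ((norm (P *v v))\<^sup>2, (norm (v - P *v v))\<^sup>2)"
  let ?m = "box_vol P 1 1"
  let ?w = "\<lambda>p. ?m * ennreal (pow_density q (fst p) * pow_density q (snd p))"
  have g [measurable]: "?g \<in> borel_measurable borel"
    unfolding borel_prod[symmetric] by measurable
  have w [measurable]: "?w \<in> borel_measurable borel"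
    unfolding borel_prod[symmetric] by measurable
  have int: "(\<integral>\<^sup>+p. ?w p * G p \<partial>lborel)
      = ?m * (\<integral>\<^sup>+a. \<integral>\<^sup>+b. ennreal (pow_density q a * pow_density q b) * G (a, b) \<partial>lborel \<partial>lborel)"
    if G: "G \<in> borel_measurable borel" for G :: "real \<times> real \<Rightarrow> ennreal"
  proof -
    have [measurable]: "G \<in> borel_measurable (borel \<Otimes>\<^sub>M borel)" using G by (simp add: borel_prod)
    have "(\<integral>\<^sup>+p. ?w p * G p \<partial>lborel)
        = ?m * (\<integral>\<^sup>+p. ennreal (pow_density q (fst p) * pow_density q (snd p)) * G p \<partial>(lborel \<Otimes>\<^sub>M lborel))"
      unfolding lborel_prod[symmetric] mult.assoc by (rule nn_integral_cmult) measurable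
    also have "(\<integral>\<^sup>+p. ennreal (pow_density q (fst p) * pow_density q (snd p)) * G p \<partial>(lborel \<Otimes>\<^sub>M lborel))
        = (\<integral>\<^sup>+a. \<integral>\<^sup>+b. ennreal (pow_density q a * pow_density q b) * G (a, b) \<partial>lborel \<partial>lborel)"
    proof -
      have "(\<lambda>p. ennreal (pow_density q (fst p) * pow_density q (snd p)) * G p)
          \<in> borel_measurable (lborel \<Otimes>\<^sub>M lborel)"
        by (subst measurable_cong_sets[OF sets_pair_measure_cong[OF sets_lborel sets_lborel] refl]) measurable
      from lborel.nn_integral_fst[OF this] show ?thesis by simp
    qed
    finally show ?thesis .
  qed
  have eq: "distr lborel borel ?g = density lborel ?w"
  proof (rule measure_eq_on_lower_boxes)
    fix a b :: real
    have box [measurable]: "{..a} \<times> {..b} \<in> sets (borel :: (real \<times> real) measure)"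
      unfolding borel_prod[symmetric] by measurable
    have 1: "emeasure (distr lborel borel ?g) ({..a} \<times> {..b}) = box_vol P a b"
      by (subst emeasure_distr) (auto simp: box_vol_def[OF P n k] intro!: arg_cong2[of _ _ _ _ emeasure])
    then show "emeasure (distr lborel borel ?g) ({..a} \<times> {..b}) < \<infinity>"
      using box_vol_finite[OF P n k] by simp
    have "emeasure (density lborel ?w) ({..a} \<times> {..b}) = (\<integral>\<^sup>+p. ?w p * indicator ({..a} \<times> {..b}) p \<partial>lborel)"
      by (rule emeasure_density) auto
    also have "\<dots> = ?m * (\<integral>\<^sup>+a'. \<integral>\<^sup>+b'. ennreal (pow_density q a' * pow_density q b') * indicator ({..a} \<times> {..b}) (a', b') \<partial>lborel \<partial>lborel)"
      by (rule int) auto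
    also have "(\<integral>\<^sup>+a'. \<integral>\<^sup>+b'. ennreal (pow_density q a' * pow_density q b') * indicator ({..a} \<times> {..b}) (a', b') \<partial>lborel \<partial>lborel)
        = (\<integral>\<^sup>+a'. \<integral>\<^sup>+b'. (ennreal (pow_density q a') * indicator {..a} a') * (ennreal (pow_density q b') * indicator {..b} b') \<partial>lborel \<partial>lborel)"
      by (intro nn_integral_cong)
        (simp add: ennreal_mult pow_density_nonneg q indicator_times mult_ac)
    also have "\<dots> = (\<integral>\<^sup>+a'. ennreal (pow_density q a') * indicator {..a} a' \<partial>lborel)
        * (\<integral>\<^sup>+b'. ennreal (pow_density q b') * indicator {..b} b' \<partial>lborel)"
      by (simp add: nn_integral_cmult nn_integral_multc)
    also have "\<dots> = (if a \<ge> 0 then ennreal (a powr q) else 0) * (if b \<ge> 0 then ennreal (b powr q) else 0)"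
      using nn_integral_pow_density[OF q] by simp
    also have "?m * \<dots> = box_vol P a b"
    proof (cases "a \<ge> 0 \<and> b \<ge> 0")
      case True
      then show ?thesis
        using box_vol_eq[OF P n k, of a b] by (simp add: q_def ennreal_mult mult.commute)
    next
      case False
      then show ?thesis using box_vol_neg[OF P n k, of a b] by auto
    qed
    finally show "emeasure (distr lborel borel ?g) ({..a} \<times> {..b}) = emeasure (density lborel ?w) ({..a} \<times> {..b})"
      using 1 by simp
  qed auto
  have "(\<integral>\<^sup>+v. F (?g v) \<partial>lborel) = (\<integral>\<^sup>+p. F p \<partial>distr lborel borel ?g)"
    by (rule nn_integral_distr[symmetric]) auto
  also have "\<dots> = (\<integral>\<^sup>+p. ?w p * F p \<partial>lborel)"
    unfolding eq by (rule nn_integral_density) auto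
  also have "\<dots> = ?m * (\<integral>\<^sup>+a. \<integral>\<^sup>+b. ennreal (pow_density q a * pow_density q b) * F (a, b) \<partial>lborel \<partial>lborel)"
    by (rule int) auto
  finally show ?thesis .
qed

text \<open>
  The indicator of the unit ball depends only on the sum of the two squared lengths, so the separation
  of sum and proportion gives the law up to a constant factor; the case \<open>f = 1\<close> determines the factor.
\<close>

lemma random_vector_beta:
  fixes P :: "'a::real_or_complex^'n^'n"
  assumes P: "P \<in> Proj k" and n: "CARD('n) = 2 * k" and k: "k > 0"
    and f [measurable]: "f \<in> borel_measurable borel"
  defines "q \<equiv> real DIM('a) * real k / 2"
  shows "(\<integral>\<^sup>+v. indicator (cball 0 1) v * f ((norm (P *v v))\<^sup>2 / (norm v)\<^sup>2) \<partial>lborel) * ennreal (Beta q q)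
    = emeasure lborel (cball (0::'a^'n) 1) * (\<integral>\<^sup>+t. f t * ennreal (beta_density q t) \<partial>lborel)"
proof -
  have q: "q > 0" using k by (simp add: q_def)
  let ?C = "box_vol P 1 1 * (\<integral>\<^sup>+s. indicator {..1} s * ennreal (indicator {0<..} s * (q\<^sup>2 * s powr (2 * q - 1))) \<partial>lborel)"
  have *: "(\<integral>\<^sup>+v. indicator (cball 0 1) v * h ((norm (P *v v))\<^sup>2 / (norm v)\<^sup>2) \<partial>lborel)
      = ?C * (\<integral>\<^sup>+t. h t * ennreal (beta_density q t) \<partial>lborel)"
    if [measurable]: "h \<in> borel_measurable borel" for h
  proof -
    let ?F = "\<lambda>(a, b). indicator {..1} (a + b :: real) * h (a / (a + b))"
    have [measurable]: "?F \<in> borel_measurable borel"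
      unfolding borel_prod[symmetric] by measurable
    have "indicator (cball 0 1) v * h ((norm (P *v v))\<^sup>2 / (norm v)\<^sup>2)
        = ?F ((norm (P *v v))\<^sup>2, (norm (v - P *v v))\<^sup>2)" for v
    proof -
      have "(norm v)\<^sup>2 \<le> 1 \<longleftrightarrow> norm v \<le> 1" by (simp add: power_le_one_iff)
      then show ?thesis
        using norm_Proj_compl[OF P, of v] by (auto simp: indicator_def)
    qed
    then have "(\<integral>\<^sup>+v. indicator (cball 0 1) v * h ((norm (P *v v))\<^sup>2 / (norm v)\<^sup>2) \<partial>lborel)
        = (\<integral>\<^sup>+v. ?F ((norm (P *v v))\<^sup>2, (norm (v - P *v v))\<^sup>2) \<partial>lborel)" by simp
    also have "\<dots> = box_vol P 1 1 * (\<integral>\<^sup>+a. \<integral>\<^sup>+b. ennreal (pow_density q a * pow_density q b) * ?F (a, b) \<partial>lborel \<partial>lborel)"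
      unfolding q_def by (rule nn_integral_components[OF P n k]) simp
    also have "(\<integral>\<^sup>+a. \<integral>\<^sup>+b. ennreal (pow_density q a * pow_density q b) * ?F (a, b) \<partial>lborel \<partial>lborel)
        = (\<integral>\<^sup>+s. indicator {..1} s * ennreal (indicator {0<..} s * (q\<^sup>2 * s powr (2 * q - 1))) \<partial>lborel)
      * (\<integral>\<^sup>+t. h t * ennreal (beta_density q t) \<partial>lborel)"
      using pow_density_ratio[OF q, of h "indicator {..1}"] by simp
    finally show ?thesis by (simp add: mult.assoc)
  qed
  have "emeasure lborel (cball (0::'a^'n) 1) = (\<integral>\<^sup>+v. indicator (cball (0::'a^'n) 1) v * 1 \<partial>lborel)"
    by simp
  also have "\<dots> = ?C * (\<integral>\<^sup>+t. 1 * ennreal (beta_density q t) \<partial>lborel)"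
    by (rule *) simp
  also have "(\<integral>\<^sup>+t. 1 * ennreal (beta_density q t) \<partial>lborel) = ennreal (Beta q q)"
    using nn_integral_beta_density[OF q] by simp
  finally have vol: "emeasure lborel (cball (0::'a^'n) 1) = ?C * ennreal (Beta q q)" .
  show ?thesis unfolding vol *[OF f] by (simp only: mult_ac)
qed

section \<open>Unitary invariance\<close>

lemma unitary_norm:
  assumes "unitary U"
  shows "norm (U *v x) = norm x"
proof -
  have "inner (U *v x) (U *v x) = inner (conj_transpose U *v (U *v x)) x"
    using inner_mult_right[of "U *v x" U x] by simp
  also have "conj_transpose U *v (U *v x) = x"
    using assms by (simp add: unitary_def matrix_vector_mul_assoc)
  finally show ?thesis by (simp add: norm_eq_sqrt_inner)
qed

lemma unitary_conj_transpose: "unitary U \<Longrightarrow> unitary (conj_transpose U)"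
  by (auto simp: unitary_def)

lemma unitary_cancel:
  assumes "unitary U"
  shows "conj_transpose U *v (U *v x) = x" "U *v (conj_transpose U *v x) = x"
  using assms by (auto simp: unitary_def matrix_vector_mul_assoc)

lemma inner_conjugated:
  "inner x ((U ** P ** conj_transpose U) *v y) = inner (conj_transpose U *v x) (P *v (conj_transpose U *v y))"
  using inner_mult_right[of x U "P *v (conj_transpose U *v y)"]
  by (simp add: matrix_vector_mul_assoc matrix_mul_assoc)

text \<open>
  The Householder reflection along \<open>x - c y\<close>, where the phase \<open>c\<close> makes \<open>herm x (c y)\<close> real.
\<close>

lemma obtain_householder:
  fixes x y :: "'a::real_or_complex^'n"
  assumes "norm x = 1" "norm y = 1"
  obtains U :: "'a^'n^'n" and c :: 'a where "unitary U" "norm c = 1" "U *v x = c *s y"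
    "\<And>z. herm x z = 0 \<Longrightarrow> herm y z = 0 \<Longrightarrow> U *v z = z"
proof -
  obtain c :: 'a where c: "norm c = 1" "herm (c *s y) x = of_real (norm (herm y x))"
    using obtain_phase by blast
  define r where "r = norm (herm y x)"
  define w where "w = c *s y"
  have nw: "norm w = 1" using c assms by (simp add: w_def norm_smult)
  have wx: "herm w x = of_real r" using c by (simp add: w_def r_def)
  show thesis
  proof (cases "x = w")
    case True
    show ?thesis by (rule that[of "mat 1" c]) (use c True in \<open>auto simp: unitary_def w_def\<close>)
  next
    case False
    define u where "u = x - w"
    define s where "s = (norm u)\<^sup>2"
    have s: "s > 0" using False by (simp add: s_def u_def)
    have "herm u u = herm x x - herm w x - (herm x w - herm w w)"
      by (simp add: u_def herm_diff_left herm_diff_right)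
    also have "herm x w = of_real r" using wx herm_commute[of x w] by simp
    finally have "(of_real s :: 'a) = of_real (2 - 2 * r)"
      using assms nw wx by (simp add: herm_self s_def)
    then have s': "s = 2 - 2 * r" using of_real_eq_iff by blast
    have ux: "herm u x = of_real (s / 2)"
      using assms wx by (simp add: u_def herm_diff_left herm_self s')
    define U where "U = mat 1 - (2 / s) *\<^sub>R outer u"
    have Uv: "U *v v = v - (2 / s) *\<^sub>R (herm u v *s u)" for v
      by (simp add: U_def matrix_vector_mult_diff_rdistrib scaleR_matrix_vector outer_vector)
    have adj: "conj_transpose U = U"
      by (simp add: U_def conj_transpose_diff conj_transpose_scaleR conj_transpose_outer)
    have huu: "herm u u = of_real s" by (simp add: herm_self s_def)
    have "herm u (U *v v) = - herm u v" for v
    proof -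
      have "herm u (U *v v) = herm u v - of_real (2 / s) * (herm u v * of_real s)"
        unfolding Uv scaleR_eq_smult by (simp add: herm_diff_right herm_smult_right huu)
      also have "of_real (2 / s) * (herm u v * of_real s) = herm u v * of_real (2 / s * s)"
        by (simp only: of_real_mult mult_ac)
      finally show ?thesis using s by simp
    qed
    then have "U *v (U *v v) = v" for v
      unfolding Uv[of "U *v v"] by (simp add: Uv)
    then have "U ** U = mat 1" by (simp add: matrix_eq flip: matrix_vector_mul_assoc)
    then have uni: "unitary U" by (simp add: unitary_def adj)
    have Ux: "U *v x = w"
    proof -
      have "(2 / s) *\<^sub>R (herm u x *s u) = of_real (2 / s * (s / 2)) *s u"
        unfolding ux scaleR_eq_smult by (simp only: vector_smult_assoc of_real_mult)
      then show ?thesis using s unfolding Uv by (simp add: u_def)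
    qed
    have fix_z: "U *v z = z" if "herm x z = 0" "herm y z = 0" for z
      using that by (simp add: Uv u_def w_def herm_diff_left herm_smult_left)
    show ?thesis by (rule that[OF uni c(1) _ fix_z]) (use Ux w_def in auto)
  qed
qed

lemma inner_phase:
  assumes "norm c = 1"
  shows "inner (c *s x) (P *v (c *s x)) = inner x (P *v (x::'a::real_or_complex^'n))"
proof -
  have "P *v (c *s x) = c *s (P *v x)" by (rule vector_scalar_commute)
  moreover have "herm (c *s x) (c *s (P *v x)) = herm x (P *v x)"
    using assms sconj_mult_self[of c]
    by (simp add: herm_smult_left herm_smult_right mult.assoc[symmetric] mult.commute[of c])
  ultimately show ?thesis by (simp flip: sre_herm)
qed

lemma continuous_inner_matrix:
  "continuous_on UNIV (\<lambda>P::'a::real_or_complex^'n^'n. inner x (P *v y))"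
proof -
  have "linear (\<lambda>P::'a^'n^'n. inner x (P *v y))"
    by (rule linearI) (simp_all add: matrix_vector_mult_add_rdistrib inner_add_right scaleR_matrix_vector)
  then show ?thesis by (intro linear_continuous_on) (simp add: linear_conv_bounded_linear)
qed

lemma inner_matrix_measurable [measurable]:
  "(\<lambda>P::'a::real_or_complex^'n^'n. inner x (P *v y)) \<in> borel_measurable borel"
  by (rule borel_measurable_continuous_onI[OF continuous_inner_matrix])

lemma conjugate_measurable [measurable]:
  "(\<lambda>P::'a::real_or_complex^'n^'n. U ** P ** conj_transpose U) \<in> borel_measurable borel"
proof -
  have "linear (\<lambda>P::'a^'n^'n. U ** P ** conj_transpose U)"
    by (rule linearI) (simp_all add: matrix_eq matrix_vector_mult_add_rdistrib
        matrix_vector_right_distrib scaleR_matrix_vector matrix_vector_scaleR flip: matrix_vector_mul_assoc)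
  then show ?thesis
    by (intro borel_measurable_continuous_onI linear_continuous_on) (simp add: linear_conv_bounded_linear)
qed

lemma conjugate_Proj:
  assumes U: "unitary U" and P: "P \<in> Proj k"
  shows "U ** P ** conj_transpose U \<in> Proj k"
proof -
  let ?A = "U ** P ** conj_transpose U"
  have adj: "conj_transpose ?A = ?A"
    by (simp add: conj_transpose_mult Proj_adjoint[OF P] matrix_mul_assoc)
  have idem: "?A ** ?A = ?A"
    using Proj_idem[OF P] unitary_cancel[OF U]
    by (simp add: matrix_eq flip: matrix_vector_mul_assoc)
  have range: "range (\<lambda>v. ?A *v v) = (\<lambda>v. U *v v) ` range (\<lambda>v. P *v v)"
  proof (intro equalityI subsetI)
    fix w assume "w \<in> (\<lambda>v. U *v v) ` range (\<lambda>v. P *v v)"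
    then obtain v where "w = U *v (P *v v)" by auto
    then have "w = ?A *v (U *v v)" using unitary_cancel[OF U] by (simp flip: matrix_vector_mul_assoc)
    then show "w \<in> range (\<lambda>v. ?A *v v)" by blast
  qed (auto simp flip: matrix_vector_mul_assoc)
  have "vec.dim (columns ?A) = vec.dim (columns P)"
  proof -
    have inj: "inj_on (\<lambda>v. U *v v) (vec.span (range (\<lambda>v. P *v v)))"
      by (rule inj_onI) (metis unitary_cancel(1)[OF U])
    have "vec.dim (columns ?A) = vec.dim (range (\<lambda>v. ?A *v v))"
      unfolding range_mult_vec_eq_span vec.dim_span ..
    also have "\<dots> = vec.dim (range (\<lambda>v. P *v v))"
      unfolding range by (rule vec.dim_image_eq[OF matrix_vector_mul_linear_gen inj])
    also have "\<dots> = vec.dim (columns P)"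
      unfolding range_mult_vec_eq_span vec.dim_span ..
    finally show ?thesis .
  qed
  then have "rank ?A = k"
    using dim_columns_self_adjoint[OF adj] dim_columns_self_adjoint[OF Proj_adjoint[OF P]] Proj_rank[OF P]
    by simp
  then show ?thesis using adj idem by (simp add: Proj_def)
qed

text \<open>
  Summing the squared lengths of the projections of a real orthonormal basis gives, by Parseval's
  identity for an orthonormal basis of the range, the real dimension of the range.
\<close>

lemma trace_Proj:
  assumes P: "(P::'a::real_or_complex^'n^'n) \<in> Proj k"
  shows "(\<Sum>i\<in>UNIV. inner (axis i 1) (P *v axis i 1)) = real k"
proof -
  let ?S = "range (\<lambda>v. P *v v)"
  have "subspace ?S" by (intro linear_subspace_image linear_mult_vec subspace_UNIV)
  then obtain B where B: "B \<subseteq> ?S" "pairwise orthogonal B" "\<And>x. x \<in> B \<Longrightarrow> norm x = 1"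
      "independent B" "card B = dim ?S" "span B = ?S"
    using orthonormal_basis_subspace by blast
  have finB: "finite B" using B(4) by (rule independent_imp_finite)
  have PB: "P *v b = b" if "b \<in> B" for b using that B(1) Proj_idem[OF P] by auto
  have pars: "(norm (P *v v))\<^sup>2 = (\<Sum>b\<in>B. (inner v b)\<^sup>2)" for v
  proof -
    have "(\<Sum>b\<in>B. inner (P *v v) b *\<^sub>R b) = P *v v"
      using B finB by (intro orthonormal_basis_expand) auto
    moreover have "inner (P *v v) b = inner v b" if "b \<in> B" for b
      using inner_Proj[OF P, of v b] PB[OF that] by simp
    ultimately have "P *v v = (\<Sum>b\<in>B. inner v b *\<^sub>R b)" by (metis (mono_tags, lifting) sum.cong)
    then have "inner v (P *v v) = (\<Sum>b\<in>B. inner v b * inner v b)" by (simp add: inner_sum_right)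
    then show ?thesis by (simp add: inner_Proj_self[OF P] power2_eq_square)
  qed
  have "(\<Sum>e\<in>Basis. (norm (P *v e))\<^sup>2) = (\<Sum>b\<in>B. \<Sum>e\<in>Basis. (inner e b)\<^sup>2)"
    unfolding pars by (rule sum.swap)
  also have "\<dots> = (\<Sum>b\<in>B. 1)"
  proof (rule sum.cong[OF refl])
    fix b assume "b \<in> B"
    then have "(norm b)\<^sup>2 = 1" using B by simp
    then show "(\<Sum>e\<in>Basis. (inner e b)\<^sup>2) = 1"
      by (subst (asm) power2_norm_eq_inner, subst (asm) euclidean_inner)
        (simp add: power2_eq_square inner_commute)
  qed
  also have "\<dots> = real (DIM('a) * k)" using B(5) dim_range_Proj[OF P] by simp
  also have "(\<Sum>e\<in>Basis. (norm (P *v e))\<^sup>2) = (\<Sum>i\<in>UNIV. \<Sum>u\<in>Basis. (norm (P *v axis i (u::'a)))\<^sup>2)"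
  proof -
    have inj: "inj_on (\<lambda>(i, u). axis i (u::'a)) ((UNIV::'n set) \<times> Basis)"
      using nonzero_Basis by (fastforce simp: inj_on_def axis_eq_axis)
    have bas: "(Basis :: ('a^'n) set) = (\<lambda>(i, u). axis i u) ` (UNIV \<times> Basis)"
      by (auto simp: Basis_vec_def)
    have "(\<Sum>e\<in>Basis. (norm (P *v e))\<^sup>2)
        = (\<Sum>p\<in>UNIV \<times> Basis. (norm (P *v (case p of (i, u) \<Rightarrow> axis i (u::'a))))\<^sup>2)"
      unfolding bas sum.reindex[OF inj] o_def ..
    then show ?thesis by (simp add: sum.cartesian_product case_prod_unfold)
  qed
  also have "\<dots> = (\<Sum>i\<in>UNIV. real DIM('a) * inner (axis i 1) (P *v axis i 1))"
  proof (rule sum.cong[OF refl])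
    fix i :: 'n
    have "(norm (P *v axis i u))\<^sup>2 = inner (axis i 1) (P *v axis i 1)" if "u \<in> Basis" for u :: 'a
    proof -
      have "axis i u = u *s axis i 1" by (simp add: vec_eq_iff axis_def)
      then show ?thesis using inner_Proj_self[OF P, of "axis i u"] inner_phase[of u "axis i 1" P] that
        by simp
    qed
    then show "(\<Sum>u\<in>Basis. (norm (P *v axis i (u::'a)))\<^sup>2) = real DIM('a) * inner (axis i 1) (P *v axis i 1)"
      by simp
  qed
  also have "\<dots> = real DIM('a) * (\<Sum>i\<in>UNIV. inner (axis i 1) (P *v axis i 1))"
    by (simp add: sum_distrib_left)
  finally show ?thesis by simp
qed

lemma norm_axis_1: "norm (axis i 1 :: 'a::real_or_complex^'n) = 1"
proof -
  have "(norm (axis i 1 :: 'a^'n))\<^sup>2 = 1"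
    by (simp add: power2_norm_eq_inner inner_axis_axis)
  then show ?thesis by (metis norm_ge_zero one_power2 power2_eq_imp_eq zero_le_one)
qed

lemma Beta_pos: "q > 0 \<Longrightarrow> Beta q q > (0::real)"
  by (simp add: Beta_def Gamma_real_pos)

lemma quadratic_form_measurable [measurable]:
  "(\<lambda>(P, v). inner v ((P::'a::real_or_complex^'n^'n) *v v)) \<in> borel_measurable (borel \<Otimes>\<^sub>M borel)"
proof -
  have "continuous_on UNIV (\<lambda>p::('a^'n^'n) \<times> ('a^'n). inner (snd p) (fst p *v snd p))"
    unfolding inner_vec_def matrix_vector_mult_def by (intro continuous_intros)
  then show ?thesis
    unfolding borel_prod case_prod_unfold by (rule borel_measurable_continuous_onI)
qed

section \<open>Uniformly distributed projections\<close>

text \<open>The mean of \<open>\<bar>T - 1/2\<bar>\<close> for a variable \<open>T\<close> with the symmetric beta law of parameter \<open>q\<close>.\<close>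

definition beta_dev :: "real \<Rightarrow> real" where
  "beta_dev q = 1 / (q * 4 powr q * Beta q q)"

lemma beta_dev_pos: "q > 0 \<Longrightarrow> beta_dev q > 0"
  by (simp add: beta_dev_def Beta_pos)

text \<open>
  Up to the factor \<open>- 1 / (2 q)\<close>, the power \<open>(t (1 - t)) powr q\<close> is an antiderivative of
  \<open>(t - 1/2) (t (1 - t)) powr (q - 1)\<close>; the two halves of the interval contribute equally.
\<close>

lemma nn_integral_beta_dev:
  assumes q: "q > 0"
  shows "(\<integral>\<^sup>+t. ennreal \<bar>t - 1/2\<bar> * ennreal (beta_density q t) \<partial>lborel) = ennreal (beta_dev q * Beta q q)"
proof -
  let ?G = "\<lambda>t::real. - ((t * (1 - t)) powr q) / (2 * q)"
  let ?g = "\<lambda>t::real. (t - 1/2) * (t powr (q - 1) * (1 - t) powr (q - 1))"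
  have cont: "continuous_on {0..1} ?G"
    using q by (intro continuous_intros continuous_on_powr') (auto simp: mult_le_0_iff)
  have deriv: "(?G has_vector_derivative ?g t) (at t)" if "t \<in> {0<..<1}" for t
  proof -
    have "t * (1 - t) > 0" using that by simp
    then have "((\<lambda>t. (t * (1 - t)) powr q) has_real_derivative q * (t * (1 - t)) powr (q - 1) * (1 - 2 * t)) (at t)"
      by (rule DERIV_chain2[OF has_real_derivative_powr]) (auto intro!: derivative_eq_intros)
    then have "(?G has_real_derivative - (q * (t * (1 - t)) powr (q - 1) * (1 - 2 * t)) / (2 * q)) (at t)"
      by (intro DERIV_cdivide DERIV_minus)
    also have "- (q * (t * (1 - t)) powr (q - 1) * (1 - 2 * t)) / (2 * q) = ?g t"
    proof -
      have "(t * (1 - t)) powr (q - 1) = t powr (q - 1) * (1 - t) powr (q - 1)"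
        using that by (simp add: powr_mult)
      then show ?thesis using q by (simp only:) (simp add: field_simps)
    qed
    finally show ?thesis by (simp add: has_real_derivative_iff_has_vector_derivative)
  qed
  have right: "(?g has_integral (?G 1 - ?G (1/2))) {1/2..1}"
    using deriv by (intro fundamental_theorem_of_calculus_interior continuous_on_subset[OF cont]) auto
  have left: "(?g has_integral (?G (1/2) - ?G 0)) {0..1/2}"
    using deriv by (intro fundamental_theorem_of_calculus_interior continuous_on_subset[OF cont]) auto
  have absg: "\<bar>?g t\<bar> = \<bar>t - 1/2\<bar> * (t powr (q - 1) * (1 - t) powr (q - 1))" for t
    by (simp add: abs_mult)
  have 1: "((\<lambda>t. \<bar>?g t\<bar>) has_integral (?G 1 - ?G (1/2))) {1/2..1}"
    using right by (rule has_integral_eq[rotated]) (simp add: absg)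
  have 2: "((\<lambda>t. \<bar>?g t\<bar>) has_integral - (?G (1/2) - ?G 0)) {0..1/2}"
    using has_integral_neg[OF left]
  proof (rule has_integral_eq[rotated])
    fix t :: real assume "t \<in> {0..1/2}"
    then have "\<bar>t - 1/2\<bar> = - (t - 1/2)" by simp
    then show "- ?g t = \<bar>?g t\<bar>" unfolding absg by (simp only: mult_minus_left)
  qed
  have val: "- (?G (1/2) - ?G 0) + (?G 1 - ?G (1/2)) = beta_dev q * Beta q q"
  proof -
    have "(1 / 4 :: real) powr q = 1 / 4 powr q" by (simp add: powr_divide)
    then show ?thesis using q Beta_pos[OF q] by (simp add: beta_dev_def field_simps)
  qed
  have "((\<lambda>t. \<bar>?g t\<bar>) has_integral (beta_dev q * Beta q q)) {0..1}"
    using has_integral_combine[OF _ _ 2 1] unfolding val by simp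
  then have "(\<integral>\<^sup>+t. ennreal \<bar>?g t\<bar> * indicator {0..1} t \<partial>lborel) = ennreal (beta_dev q * Beta q q)"
    by (intro nn_integral_has_integral_lebesgue') auto
  moreover have "ennreal \<bar>?g t\<bar> * indicator {0..1} t = ennreal \<bar>t - 1/2\<bar> * ennreal (beta_density q t)" for t
    by (auto simp: beta_density_def indicator_def abs_mult simp flip: ennreal_mult)
  ultimately show ?thesis by simp
qed

lemma beta_density_le:
  assumes "q \<ge> 1"
  shows "beta_density q t \<le> (1/4) powr (q - 1)"
proof (cases "t \<in> {0<..<1}")
  case True
  have "0 \<le> (t - 1/2)\<^sup>2" by simp
  then have "t * (1 - t) \<le> 1/4" by (simp add: power2_eq_square algebra_simps)
  then have "(t * (1 - t)) powr (q - 1) \<le> (1/4) powr (q - 1)"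
    using True assms by (intro powr_mono2) auto
  then show ?thesis using True by (simp add: beta_density_def powr_mult)
qed (simp add: beta_density_def)

locale uniform_Proj =
  fixes \<nu> :: "('a::real_or_complex^'n^'n) measure" and k :: nat
  assumes uniform: "uniform_on_Proj k \<nu>" and card_n: "CARD('n) = 2 * k" and k_pos: "k > 0"
begin

definition q :: real where "q = real DIM('a) * real k / 2"

lemma q_pos: "q > 0" using k_pos by (simp add: q_def)

sublocale prob_space \<nu>
  using uniform by (simp add: uniform_on_Proj_def)

lemma sets_\<nu>: "sets \<nu> = sets (proj_space k)"
  using uniform by (simp add: uniform_on_Proj_def)

lemma space_\<nu>: "space \<nu> = Proj k"
  using sets_eq_imp_space_eq[OF sets_\<nu>] by (simp add: proj_space_def space_restrict_space)

lemma measurable_\<nu>: "f \<in> borel \<rightarrow>\<^sub>M N \<Longrightarrow> f \<in> \<nu> \<rightarrow>\<^sub>M N"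
  unfolding measurable_cong_sets[OF sets_\<nu> refl] proj_space_def by (rule measurable_restrict_space1)

lemma measurable_conjugate:
  assumes "unitary U"
  shows "(\<lambda>P. U ** P ** conj_transpose U) \<in> \<nu> \<rightarrow>\<^sub>M proj_space k"
  unfolding proj_space_def
  by (rule measurable_restrict_space2) (auto simp: space_\<nu> conjugate_Proj[OF assms] measurable_\<nu>)

lemma distr_conjugate: "unitary U \<Longrightarrow> distr \<nu> (proj_space k) (\<lambda>P. U ** P ** conj_transpose U) = \<nu>"
  using uniform by (simp add: uniform_on_Proj_def)

lemma nn_integral_conjugate:
  assumes U: "unitary U" and g: "g \<in> borel_measurable borel"
  shows "(\<integral>\<^sup>+P. g (U ** P ** conj_transpose U) \<partial>\<nu>) = (\<integral>\<^sup>+P. g P \<partial>\<nu>)"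
proof -
  have "g \<in> borel_measurable (proj_space k)"
    using g unfolding proj_space_def by (rule measurable_restrict_space1)
  then have "g \<in> borel_measurable (distr \<nu> (proj_space k) (\<lambda>P. U ** P ** conj_transpose U))" by simp
  from nn_integral_distr[OF measurable_conjugate[OF U] this]
  show ?thesis by (simp add: distr_conjugate[OF U])
qed

lemma integral_conjugate:
  fixes g :: "'a^'n^'n \<Rightarrow> real"
  assumes U: "unitary U" and g: "g \<in> borel_measurable borel"
  shows "(LINT P|\<nu>. g (U ** P ** conj_transpose U)) = (LINT P|\<nu>. g P)"
proof -
  have "g \<in> borel_measurable (proj_space k)"
    using g unfolding proj_space_def by (rule measurable_restrict_space1)
  from integral_distr[OF measurable_conjugate[OF U] this]
  show ?thesis by (simp add: distr_conjugate[OF U])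
qed

lemma nn_integral_unit_vectors:
  assumes f [measurable]: "f \<in> borel_measurable borel" and "norm x = 1" "norm y = 1"
  shows "(\<integral>\<^sup>+P. f (inner x (P *v x)) \<partial>\<nu>) = (\<integral>\<^sup>+P. f (inner y (P *v y)) \<partial>\<nu>)"
proof -
  obtain U c where U: "unitary U" "norm c = 1" "U *v x = c *s y"
    using obtain_householder[OF assms(2,3)] by metis
  have "(\<integral>\<^sup>+P. f (inner y (P *v y)) \<partial>\<nu>) = (\<integral>\<^sup>+P. f (inner (U *v x) (P *v (U *v x))) \<partial>\<nu>)"
    by (simp add: U inner_phase)
  also have "\<dots> = (\<integral>\<^sup>+P. f (inner x ((conj_transpose U ** P ** conj_transpose (conj_transpose U)) *v x)) \<partial>\<nu>)"
    unfolding inner_conjugated by simp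
  also have "\<dots> = (\<integral>\<^sup>+P. f (inner x (P *v x)) \<partial>\<nu>)"
    by (rule nn_integral_conjugate[OF unitary_conj_transpose[OF U(1)]]) measurable
  finally show ?thesis ..
qed

text \<open>
  Since all unit vectors behave alike, the vector may be drawn at random; integrating over the
  vector first, with the projection fixed, reduces the claim to that for a fixed projection.
\<close>

theorem quadratic_form_beta:
  assumes f [measurable]: "f \<in> borel_measurable borel" and y: "norm y = 1"
  shows "(\<integral>\<^sup>+P. f (inner y (P *v y)) \<partial>\<nu>) * ennreal (Beta q q) = (\<integral>\<^sup>+t. f t * ennreal (beta_density q t) \<partial>lborel)"
proof -
  interpret pair_sigma_finite \<nu> "lborel :: ('a^'n) measure" ..
  have [measurable_cong]: "sets \<nu> = sets (restrict_space borel (Proj k))"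
    using sets_\<nu> by (simp add: proj_space_def)
  let ?I = "\<integral>\<^sup>+P. f (inner y (P *v y)) \<partial>\<nu>"
  let ?R = "\<integral>\<^sup>+t. f t * ennreal (beta_density q t) \<partial>lborel"
  let ?vol = "emeasure lborel (cball (0::'a^'n) 1)"
  let ?h = "\<lambda>(P::'a^'n^'n) (v::'a^'n). indicator (cball 0 1) v * f (inner v (P *v v) / (norm v)\<^sup>2)"
  have id: "(\<lambda>p. p) \<in> \<nu> \<Otimes>\<^sub>M lborel \<rightarrow>\<^sub>M (borel :: ('a^'n^'n) measure) \<Otimes>\<^sub>M (borel :: ('a^'n) measure)"
    by (intro measurable_pair measurable_compose[OF measurable_fst] measurable_compose[OF measurable_snd])
      (auto simp: comp_def intro!: measurable_compose[OF measurable_fst measurable_\<nu>] measurable_snd)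
  have h: "case_prod ?h \<in> borel_measurable (\<nu> \<Otimes>\<^sub>M lborel)"
  proof -
    have "case_prod ?h \<in> borel_measurable (borel \<Otimes>\<^sub>M borel)"
    proof -
      have 1: "(\<lambda>p. inner (snd p) ((fst p :: 'a^'n^'n) *v snd p)) \<in> borel_measurable (borel \<Otimes>\<^sub>M borel)"
        using quadratic_form_measurable by (simp add: case_prod_unfold)
      have 2: "(\<lambda>p::('a^'n^'n) \<times> ('a^'n). (norm (snd p))\<^sup>2) \<in> borel_measurable (borel \<Otimes>\<^sub>M borel)"
        by measurable
      have 3: "(indicator (cball 0 1) :: 'a^'n \<Rightarrow> ennreal) \<in> borel_measurable borel"
        by (intro borel_measurable_indicator borel_closed closed_cball)
      show ?thesis unfolding case_prod_unfold
        by (intro borel_measurable_times_ennreal measurable_compose[OF measurable_snd 3]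
            measurable_compose[OF borel_measurable_divide[OF 1 2] f])
    qed
    from measurable_compose[OF id this] show ?thesis by simp
  qed
  have "?vol * ?I = (\<integral>\<^sup>+v. indicator (cball (0::'a^'n) 1) v * ?I \<partial>lborel)"
    by (subst nn_integral_multc) (auto intro!: borel_measurable_indicator borel_closed)
  also have "\<dots> = (\<integral>\<^sup>+v. \<integral>\<^sup>+P. ?h P v \<partial>\<nu> \<partial>lborel)"
  proof (rule nn_integral_cong_AE)
    have "AE v in lborel. v \<noteq> (0::'a^'n)" by (rule AE_lborel_singleton)
    then show "AE v in lborel. indicator (cball (0::'a^'n) 1) v * ?I = (\<integral>\<^sup>+P. ?h P v \<partial>\<nu>)"
    proof eventually_elim
      case (elim v)
      let ?w = "(1 / norm v) *\<^sub>R v"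
      have w: "norm ?w = 1" using elim by simp
      have "inner ?w (P *v ?w) = inner v (P *v v) / (norm v)\<^sup>2" for P :: "'a^'n^'n"
        by (simp add: matrix_vector_scaleR power2_eq_square)
      then have "?I = (\<integral>\<^sup>+P. f (inner v (P *v v) / (norm v)\<^sup>2) \<partial>\<nu>)"
        using nn_integral_unit_vectors[OF f y w] by simp
      moreover have "(\<lambda>P. f (inner v (P *v v) / (norm v)\<^sup>2)) \<in> borel_measurable \<nu>"
        by (intro measurable_\<nu>) measurable
      ultimately show ?case by (simp add: nn_integral_cmult)
    qed
  qed
  also have "\<dots> = (\<integral>\<^sup>+P. \<integral>\<^sup>+v. ?h P v \<partial>lborel \<partial>\<nu>)"
    using h by (rule Fubini')
  finally have "?vol * ?I * ennreal (Beta q q) = (\<integral>\<^sup>+P. (\<integral>\<^sup>+v. ?h P v \<partial>lborel) * ennreal (Beta q q) \<partial>\<nu>)"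
    using lborel.borel_measurable_nn_integral_fst[OF h] by (simp add: nn_integral_multc)
  also have "\<dots> = (\<integral>\<^sup>+P. ?vol * ?R \<partial>\<nu>)"
  proof (rule nn_integral_cong)
    fix P assume "P \<in> space \<nu>"
    then have P: "P \<in> Proj k" by (simp add: space_\<nu>)
    show "(\<integral>\<^sup>+v. ?h P v \<partial>lborel) * ennreal (Beta q q) = ?vol * ?R"
      using random_vector_beta[OF P card_n k_pos f] by (simp add: inner_Proj_self[OF P] q_def)
  qed
  also have "\<dots> = ?vol * ?R" by (simp add: emeasure_space_1)
  finally have "?vol * (?I * ennreal (Beta q q)) = ?vol * ?R" by (simp only: mult.assoc)
  moreover have "?vol \<noteq> 0" "?vol \<noteq> \<top>"
    using content_cball_pos[of 1 "0::'a^'n"] emeasure_lborel_cball_finite[of "0::'a^'n" 1]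
    by (auto simp: Sigma_Algebra.measure_def)
  ultimately show ?thesis by (simp add: ennreal_mult_cancel_left)
qed

lemma quadratic_form_bounds:
  assumes "P \<in> Proj k" "norm y = 1"
  shows "0 \<le> inner y (P *v y)" "inner y (P *v y) \<le> 1"
  using norm_Proj_le[OF assms(1), of y] assms
  by (auto simp: inner_Proj_self power_le_one)

lemma AE_quadratic_form_neq:
  assumes "norm y = 1"
  shows "AE P in \<nu>. inner y (P *v y) \<noteq> c"
proof -
  have m: "(\<lambda>P. indicator {c} (inner y (P *v y)) :: ennreal) \<in> borel_measurable \<nu>"
    by (intro measurable_\<nu>) measurable
  have "AE t in lborel. t \<noteq> (c::real)" by (rule AE_lborel_singleton)
  then have "(\<integral>\<^sup>+t. indicator {c} t * ennreal (beta_density q t) \<partial>lborel) = 0"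
  proof (subst nn_integral_0_iff_AE)
    show "AE t in lborel. indicator {c} t * ennreal (beta_density q t) = 0"
      using \<open>AE t in lborel. t \<noteq> c\<close> by eventually_elim simp
  qed measurable
  then have "(\<integral>\<^sup>+P. indicator {c} (inner y (P *v y)) \<partial>\<nu>) * ennreal (Beta q q) = 0"
    using quadratic_form_beta[OF _ assms, of "indicator {c}"] by simp
  then have "(\<integral>\<^sup>+P. indicator {c} (inner y (P *v y)) \<partial>\<nu>) = 0"
    using Beta_pos[OF q_pos] by simp
  then have "AE P in \<nu>. indicator {c} (inner y (P *v y)) = (0::ennreal)"
    using nn_integral_0_iff_AE[OF m] by simp
  then show ?thesis by eventually_elim (auto simp: indicator_def split: if_splits)
qed

text \<open>
  For \<open>q \<ge> 1\<close> the normalized beta density is largest at \<open>1/2\<close>, where its value is \<open>4 q beta_dev q\<close>.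
\<close>

lemma prob_near_half:
  assumes "q \<ge> 1" "norm y = 1" "\<eta> \<ge> 0"
  shows "prob {P \<in> space \<nu>. \<bar>inner y (P *v y) - 1/2\<bar> \<le> \<eta>} \<le> 8 * q * beta_dev q * \<eta>"
proof -
  let ?A = "{P \<in> space \<nu>. \<bar>inner y (P *v y) - 1/2\<bar> \<le> \<eta>}"
  have "(\<lambda>P. \<bar>inner y (P *v y) - 1/2\<bar>) \<in> borel_measurable \<nu>"
    by (intro measurable_\<nu>) measurable
  then have A: "?A \<in> sets \<nu>" by measurable
  have "emeasure \<nu> ?A = (\<integral>\<^sup>+P. indicator {1/2 - \<eta>..1/2 + \<eta>} (inner y (P *v y)) \<partial>\<nu>)"
    unfolding nn_integral_indicator[OF A, symmetric]
    by (intro nn_integral_cong) (auto simp: indicator_def abs_le_iff)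
  then have "emeasure \<nu> ?A * ennreal (Beta q q)
      = (\<integral>\<^sup>+t. indicator {1/2 - \<eta>..1/2 + \<eta>} t * ennreal (beta_density q t) \<partial>lborel)"
    using quadratic_form_beta[OF _ assms(2), of "indicator {1/2 - \<eta>..1/2 + \<eta>}"] by simp
  also have "\<dots> \<le> (\<integral>\<^sup>+t. indicator {1/2 - \<eta>..1/2 + \<eta>} t * ennreal ((1/4) powr (q - 1)) \<partial>lborel)"
    using beta_density_le[OF assms(1)] by (intro nn_integral_mono mult_left_mono ennreal_leI) auto
  also have "\<dots> = ennreal (2 * \<eta> * (1/4) powr (q - 1))"
    using assms(3) by (simp add: nn_integral_multc ennreal_mult)
  finally have "prob ?A * Beta q q \<le> 2 * \<eta> * (1/4) powr (q - 1)"
    using assms(3) Beta_pos[OF q_pos] by (simp add: emeasure_eq_measure flip: ennreal_mult)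
  also have "\<dots> = 8 * q * beta_dev q * \<eta> * Beta q q"
    using Beta_pos[OF q_pos] q_pos
    by (simp add: beta_dev_def powr_diff powr_divide field_simps)
  finally show ?thesis using Beta_pos[OF q_pos] by simp
qed

lemma integrable_bounded:
  fixes g :: "'a^'n^'n \<Rightarrow> real"
  assumes "g \<in> borel_measurable borel" "\<And>P. P \<in> Proj k \<Longrightarrow> \<bar>g P\<bar> \<le> b"
  shows "integrable \<nu> g"
  using assms measurable_\<nu>[OF assms(1)]
  by (intro integrable_const_bound[of _ b] AE_I2) (auto simp: space_\<nu>)

lemma expectation_dev:
  assumes "norm y = 1"
  shows "expectation (\<lambda>P. \<bar>inner y (P *v y) - 1/2\<bar>) = beta_dev q"
proof -
  have "integrable \<nu> (\<lambda>P. \<bar>inner y (P *v y) - 1/2\<bar>)"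
  proof (rule integrable_bounded)
    show "\<bar>\<bar>inner y (P *v y) - 1/2\<bar>\<bar> \<le> 1" if "P \<in> Proj k" for P
      using quadratic_form_bounds[OF that assms] by linarith
  qed measurable
  then have "ennreal (expectation (\<lambda>P. \<bar>inner y (P *v y) - 1/2\<bar>)) * ennreal (Beta q q)
      = ennreal (beta_dev q * Beta q q)"
    using quadratic_form_beta[OF _ assms, of "\<lambda>t. ennreal \<bar>t - 1/2\<bar>"] nn_integral_beta_dev[OF q_pos]
    by (simp add: nn_integral_eq_integral)
  then have "expectation (\<lambda>P. \<bar>inner y (P *v y) - 1/2\<bar>) * Beta q q = beta_dev q * Beta q q"
    using Beta_pos[OF q_pos] beta_dev_pos[OF q_pos]
    by (simp flip: ennreal_mult add: integral_nonneg_AE)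
  then show ?thesis using Beta_pos[OF q_pos] by simp
qed

lemma beta_dev_le: "beta_dev q \<le> 1/2"
proof -
  let ?y = "axis undefined 1 :: 'a^'n"
  have y: "norm ?y = 1" by (rule norm_axis_1)
  have "expectation (\<lambda>P. \<bar>inner ?y (P *v ?y) - 1/2\<bar>) \<le> expectation (\<lambda>_. 1/2)"
  proof (rule integral_mono)
    show "integrable \<nu> (\<lambda>P. \<bar>inner ?y (P *v ?y) - 1/2\<bar>)"
    proof (rule integrable_bounded)
      show "\<bar>\<bar>inner ?y (P *v ?y) - 1/2\<bar>\<bar> \<le> 1" if "P \<in> Proj k" for P
        using quadratic_form_bounds[OF that y] by linarith
    qed measurable
    show "\<bar>inner ?y (P *v ?y) - 1/2\<bar> \<le> 1/2" if "P \<in> space \<nu>" for P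
      using quadratic_form_bounds[of P, OF _ y] that unfolding space_\<nu> by linarith
  qed simp
  then show ?thesis unfolding expectation_dev[OF y] by (simp add: prob_space)
qed

end

section \<open>The mean response\<close>

text \<open>
  The value at \<open>v\<close> of the projection that enters the averaged matrix for a measurement of the line
  spanned by \<open>x\<close>.
\<close>

definition response :: "'a::real_or_complex^'n \<Rightarrow> 'a^'n^'n \<Rightarrow> 'a^'n \<Rightarrow> 'a^'n" where
  "response x P v = (if inner x (P *v x) \<ge> 1/2 then P *v v else v - P *v v)"

lemma response_add: "response x P (u + v) = response x P u + response x P v"
  by (simp add: response_def matrix_vector_right_distrib)

lemma response_measurable [measurable]:
  "(\<lambda>P::'a::real_or_complex^'n^'n. inner u (response x P v)) \<in> borel_measurable borel"
proof -
  have "(\<lambda>P::'a^'n^'n. if inner x (P *v x) \<ge> 1/2 then inner u (P *v v) else inner u v - inner u (P *v v))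
      \<in> borel_measurable borel" by measurable
  moreover have "inner u (response x P v)
      = (if inner x (P *v x) \<ge> 1/2 then inner u (P *v v) else inner u v - inner u (P *v v))" for P
    by (simp add: response_def inner_diff_right)
  ultimately show ?thesis by simp
qed

lemma response_symmetric:
  assumes "P \<in> Proj k"
  shows "inner u (response x P v) = inner v (response x P u)"
  using inner_Proj[OF assms, of u v]
  by (simp add: response_def inner_diff_right inner_diff_left inner_commute)

lemma norm_response_le:
  assumes "P \<in> Proj k"
  shows "norm (response x P v) \<le> norm v"
proof -
  have "(norm (v - P *v v))\<^sup>2 \<le> (norm v)\<^sup>2" using norm_Proj_compl[OF assms, of v] by simp
  then have "norm (v - P *v v) \<le> norm v" by (rule power2_le_imp_le) simp
  then show ?thesis using norm_Proj_le[OF assms] by (simp add: response_def)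
qed

lemma response_diag:
  assumes "P \<in> Proj k" "norm y = 1"
  shows "inner y (response x P y) = (if inner x (P *v x) \<ge> 1/2 then inner y (P *v y) else 1 - inner y (P *v y))"
  using assms by (simp add: response_def inner_diff_right flip: power2_norm_eq_inner)

lemma response_diag_bounds:
  assumes "P \<in> Proj k" "norm y = 1"
  shows "0 \<le> inner y (response x P y)" "inner y (response x P y) \<le> 1"
proof -
  have "(norm (P *v y))\<^sup>2 \<le> 1" using norm_Proj_le[OF assms(1), of y] assms(2) by (simp add: power_le_one)
  then show "0 \<le> inner y (response x P y)" "inner y (response x P y) \<le> 1"
    unfolding response_diag[OF assms] inner_Proj_self[OF assms(1)] by auto
qed

context uniform_Proj
begin

lemma integrable_response: "integrable \<nu> (\<lambda>P. inner u (response x P v))"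
proof (rule integrable_bounded)
  fix P :: "'a^'n^'n" assume P: "P \<in> Proj k"
  have "\<bar>inner u (response x P v)\<bar> \<le> norm u * norm (response x P v)" by (rule Cauchy_Schwarz_ineq2)
  also have "\<dots> \<le> norm u * norm v" using norm_response_le[OF P] by (intro mult_left_mono) auto
  finally show "\<bar>inner u (response x P v)\<bar> \<le> norm u * norm v" .
qed measurable

lemma expectation_response_unitary:
  assumes U: "unitary U"
  shows "expectation (\<lambda>P. inner (U *v u) (response (U *v x) P (U *v v)))
    = expectation (\<lambda>P. inner u (response x P v))"
proof -
  let ?V = "conj_transpose U"
  have uv: "inner (U *v u) (U *v v) = inner u v"
    using inner_mult_right[of "U *v u" U v] unitary_cancel[OF U] by simp
  have conj: "inner a ((?V ** P ** U) *v b) = inner (U *v a) (P *v (U *v b))" for a b P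
    using inner_conjugated[of a ?V P b] by simp
  have "inner (U *v u) (response (U *v x) P (U *v v)) = inner u (response x (?V ** P ** U) v)" for P
    by (simp add: response_def conj inner_diff_right uv)
  then have "expectation (\<lambda>P. inner (U *v u) (response (U *v x) P (U *v v)))
      = expectation (\<lambda>P. inner u (response x (?V ** P ** conj_transpose ?V) v))" by simp
  also have "\<dots> = expectation (\<lambda>P. inner u (response x P v))"
    by (rule integral_conjugate[OF unitary_conj_transpose[OF U]]) measurable
  finally show ?thesis .
qed

lemma response_phase:
  fixes x v :: "'a^'n"
  assumes "norm c = 1"
  shows "response (c *s x) P v = response x P v"
    "inner (c *s v) (response x P (c *s v)) = inner v (response x P v)"
proof -
  show "response (c *s x) P v = response x P v" by (simp add: response_def inner_phase[OF assms])
  have "inner (c *s v) (c *s v) = inner v v"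
    using assms by (simp add: norm_smult flip: power2_norm_eq_inner)
  then show "inner (c *s v) (response x P (c *s v)) = inner v (response x P v)"
    by (simp add: response_def inner_phase[OF assms] inner_diff_right)
qed

lemma expectation_response_same:
  assumes x: "norm x = 1"
  shows "expectation (\<lambda>P. inner x (response x P x)) = 1/2 + beta_dev q"
proof -
  have int: "integrable \<nu> (\<lambda>P. \<bar>inner x (P *v x) - 1/2\<bar>)"
  proof (rule integrable_bounded)
    show "\<bar>\<bar>inner x (P *v x) - 1/2\<bar>\<bar> \<le> 1" if "P \<in> Proj k" for P
      using quadratic_form_bounds[OF that x] by linarith
  qed measurable
  have "expectation (\<lambda>P. inner x (response x P x)) = expectation (\<lambda>P. 1/2 + \<bar>inner x (P *v x) - 1/2\<bar>)"
    by (intro Bochner_Integration.integral_cong refl) (auto simp: response_diag[OF _ x] space_\<nu>)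
  also have "\<dots> = 1/2 + beta_dev q"
    using int by (simp add: expectation_dev[OF x] prob_space)
  finally show ?thesis .
qed

text \<open>
  The unitary group acts transitively on orthonormal pairs up to phases, so there is one common
  value for all orthogonal directions; the trace then determines it.
\<close>

lemma expectation_response_orthonormal:
  assumes "norm x = 1" "norm z = 1" "herm x z = 0" "norm x' = 1" "norm z' = 1" "herm x' z' = 0"
  shows "expectation (\<lambda>P. inner z (response x P z)) = expectation (\<lambda>P. inner z' (response x' P z'))"
proof -
  obtain U c where U: "unitary U" "norm c = 1" "U *v x = c *s x'"
    using obtain_householder[OF assms(1,4)] by metis
  let ?w = "U *v z"
  have hU: "herm (U *v a) (U *v b) = herm a b" for a b
    using herm_mult_right[of "U *v a" U b] unitary_cancel[OF U(1)] by simp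
  have w: "norm ?w = 1" by (simp add: unitary_norm[OF U(1)] assms)
  have "sconj c * herm x' ?w = 0"
    using hU[of x z] assms(3) unfolding U(3) by (simp add: herm_smult_left)
  moreover have "sconj c \<noteq> 0" using U(2) by (metis norm_sconj norm_zero zero_neq_one)
  ultimately have xw: "herm x' ?w = 0" by simp
  obtain V d where V: "unitary V" "norm d = 1" "V *v ?w = d *s z'"
      "\<And>y. herm ?w y = 0 \<Longrightarrow> herm z' y = 0 \<Longrightarrow> V *v y = y"
    using obtain_householder[OF w assms(5)] by metis
  have "V *v x' = x'"
  proof (rule V(4))
    show "herm ?w x' = 0" using xw herm_commute[of ?w x'] by simp
    show "herm z' x' = 0" using assms(6) herm_commute[of z' x'] by simp
  qed
  then have "expectation (\<lambda>P. inner ?w (response x' P ?w)) = expectation (\<lambda>P. inner z' (response x' P z'))"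
    using expectation_response_unitary[OF V(1), of ?w x' ?w] by (simp add: V(3) response_phase[OF V(2)])
  moreover have "expectation (\<lambda>P. inner z (response x P z)) = expectation (\<lambda>P. inner ?w (response x' P ?w))"
    using expectation_response_unitary[OF U(1), of z x z] by (simp add: U(3) response_phase[OF U(2)])
  ultimately show ?thesis by simp
qed

lemma expectation_response_orthogonal:
  assumes x: "norm x = 1" and z: "norm z = 1" and xz: "herm x z = 0"
  shows "expectation (\<lambda>P. inner z (response x P z)) = 1/2 - beta_dev q / (2 * real k - 1)"
proof -
  let ?e = "\<lambda>i::'n. axis i 1 :: 'a^'n"
  fix i0 :: 'n
  define \<rho> where "\<rho> = expectation (\<lambda>P. inner z (response x P z))"
  have e: "norm (?e i) = 1" for i by (rule norm_axis_1)
  have he: "herm (?e i) (?e j) = 0" if "i \<noteq> j" for i j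
    using that by (auto simp: herm_def axis_def intro!: sum.neutral)
  have other: "expectation (\<lambda>P. inner (?e i) (response (?e i0) P (?e i))) = \<rho>" if "i \<noteq> i0" for i
    unfolding \<rho>_def by (rule expectation_response_orthonormal) (use that he e x z xz in auto)
  have "real k = expectation (\<lambda>P. \<Sum>i\<in>UNIV. inner (?e i) (response (?e i0) P (?e i)))"
  proof -
    have "(\<Sum>i\<in>UNIV. inner (?e i) (response (?e i0) P (?e i))) = real k" if "P \<in> Proj k" for P
    proof -
      have 1: "inner (?e i) (?e i) = 1" for i using e[of i] by (simp add: norm_eq_sqrt_inner)
      show ?thesis
        using trace_Proj[OF that]
        by (cases "1/2 \<le> inner (?e i0) (P *v ?e i0)")
          (simp_all add: response_def inner_diff_right sum_subtractf 1 card_n)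
    qed
    then have "expectation (\<lambda>P. \<Sum>i\<in>UNIV. inner (?e i) (response (?e i0) P (?e i))) = expectation (\<lambda>_. real k)"
      by (intro Bochner_Integration.integral_cong refl) (auto simp: space_\<nu>)
    then show ?thesis by (simp add: prob_space)
  qed
  also have "\<dots> = (\<Sum>i\<in>UNIV. expectation (\<lambda>P. inner (?e i) (response (?e i0) P (?e i))))"
    by (rule Bochner_Integration.integral_sum) (rule integrable_response)
  also have "\<dots> = expectation (\<lambda>P. inner (?e i0) (response (?e i0) P (?e i0)))
      + (\<Sum>i\<in>UNIV - {i0}. expectation (\<lambda>P. inner (?e i) (response (?e i0) P (?e i))))"
    by (rule sum.remove) auto
  also have "(\<Sum>i\<in>UNIV - {i0}. expectation (\<lambda>P. inner (?e i) (response (?e i0) P (?e i)))) = (\<Sum>i\<in>UNIV - {i0}. \<rho>)"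
    by (rule sum.cong) (use other in auto)
  also have "\<dots> = (2 * real k - 1) * \<rho>"
    using k_pos by (simp add: card_n of_nat_diff)
  finally have "real k = 1/2 + beta_dev q + (2 * real k - 1) * \<rho>"
    by (simp add: expectation_response_same[OF e])
  moreover have "2 * real k - 1 > 0" using k_pos by simp
  ultimately show ?thesis unfolding \<rho>_def[symmetric] by (simp add: field_simps)
qed

text \<open>
  Reflecting along \<open>x\<close> shows that the cross terms between the component along \<open>x\<close> and the
  orthogonal component have mean zero.
\<close>

theorem expectation_response:
  assumes x: "norm x = 1" and y: "norm y = 1"
  shows "expectation (\<lambda>P. inner y (response x P y))
    = 1/2 - beta_dev q / (2 * real k - 1) + (beta_dev q + beta_dev q / (2 * real k - 1)) * (norm (herm x y))\<^sup>2"
proof -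
  define c where "c = herm x y"
  define a where "a = c *s x"
  define b where "b = y - a"
  have xx: "herm x x = 1" using x by (simp add: herm_self)
  have xb: "herm x b = 0" by (simp add: b_def a_def herm_diff_right herm_smult_right xx c_def)
  define U where "U = mat 1 - 2 *\<^sub>R outer x"
  have Uv: "U *v v = v - 2 *\<^sub>R (herm x v *s x)" for v
    by (simp add: U_def matrix_vector_mult_diff_rdistrib scaleR_matrix_vector outer_vector)
  have adj: "conj_transpose U = U"
    by (simp add: U_def conj_transpose_diff conj_transpose_scaleR conj_transpose_outer)
  have Ua: "U *v (d *s x) = - (d *s x)" for d
    unfolding Uv by (simp add: herm_smult_right xx scaleR_2)
  have Ub: "U *v v = v" if "herm x v = 0" for v using that by (simp add: Uv)
  have "U *v (U *v v) = v" for v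
  proof -
    define w r where "w = herm x v *s x" and "r = v - w"
    have v: "v = w + r" by (simp add: r_def)
    have 0: "herm x r = 0" by (simp add: r_def w_def herm_diff_right herm_smult_right xx)
    have Uw: "U *v w = - w" unfolding w_def by (rule Ua)
    have "U *v v = - w + r"
      unfolding v matrix_vector_right_distrib Uw Ub[OF 0] ..
    then have "U *v (U *v v) = U *v (- w) + U *v r" by (simp only: matrix_vector_right_distrib)
    also have "U *v (- w) = w" using linear_neg[OF linear_mult_vec, of U w] Uw by simp
    finally show ?thesis unfolding Ub[OF 0] v[symmetric] .
  qed
  then have "U ** U = mat 1" by (simp add: matrix_eq flip: matrix_vector_mul_assoc)
  then have U: "unitary U" by (simp add: unitary_def adj)
  have cross: "expectation (\<lambda>P. inner a (response x P b)) = 0"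
  proof -
    have "U *v x = - x" using Ua[of 1] by simp
    moreover have "response (- x) P v = response x P v" for P and v :: "'a^'n"
      using response_phase(1)[of "-1" x P v] by simp
    ultimately have "expectation (\<lambda>P. inner (- a) (response x P b)) = expectation (\<lambda>P. inner a (response x P b))"
      using expectation_response_unitary[OF U, of a x b] Ua[of c] Ub[OF xb] by (simp add: a_def)
    then show ?thesis by simp
  qed
  have na: "norm a = norm c" by (simp add: a_def norm_smult x)
  have nb: "(norm b)\<^sup>2 = 1 - (norm c)\<^sup>2"
  proof -
    have "herm a b = 0" by (simp add: a_def herm_smult_left xb)
    then have "inner a b = 0" by (simp flip: sre_herm)
    then have "(norm (a + b))\<^sup>2 = (norm a)\<^sup>2 + (norm b)\<^sup>2"
      by (simp add: power2_norm_eq_inner inner_add_left inner_add_right inner_commute)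
    then show ?thesis using y na by (simp add: b_def)
  qed
  have scale: "inner (r *\<^sub>R w) (response x P (r *\<^sub>R w)) = r\<^sup>2 * inner w (response x P w)" for r P w
    by (simp add: response_def matrix_vector_scaleR power2_eq_square inner_diff_right algebra_simps)
  have diag_a: "expectation (\<lambda>P. inner a (response x P a)) = (norm c)\<^sup>2 * (1/2 + beta_dev q)"
  proof (cases "c = 0")
    case True
    then show ?thesis by (simp add: a_def)
  next
    case False
    define d where "d = (1 / norm c) *\<^sub>R c"
    have d: "norm d = 1" using False by (simp add: d_def)
    have a: "a = norm c *\<^sub>R (d *s x)" using False by (simp add: a_def d_def vec_eq_iff)
    have "inner a (response x P a) = (norm c)\<^sup>2 * inner x (response x P x)" for P
      unfolding a scale response_phase(2)[OF d] ..
    then show ?thesis by (simp add: expectation_response_same[OF x])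
  qed
  have diag_b: "expectation (\<lambda>P. inner b (response x P b)) = (norm b)\<^sup>2 * (1/2 - beta_dev q / (2 * real k - 1))"
  proof (cases "b = 0")
    case True
    then show ?thesis by simp
  next
    case False
    let ?z = "(1 / norm b) *\<^sub>R b"
    have z: "norm ?z = 1" using False by simp
    have "herm x ?z = 0" unfolding scaleR_eq_smult herm_smult_right xb by simp
    note e = expectation_response_orthogonal[OF x z this]
    have b: "b = norm b *\<^sub>R ?z" using False by simp
    have "inner b (response x P b) = (norm b)\<^sup>2 * inner ?z (response x P ?z)" for P
      by (subst (1 2) b) (rule scale)
    then have "expectation (\<lambda>P. inner b (response x P b)) = (norm b)\<^sup>2 * expectation (\<lambda>P. inner ?z (response x P ?z))"
      by (simp only: integral_mult_right_zero)
    then show ?thesis unfolding e .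
  qed
  have "y = a + b" by (simp add: b_def)
  have "inner y (response x P y) = inner a (response x P a) + 2 * inner a (response x P b) + inner b (response x P b)"
    if "P \<in> Proj k" for P
    using response_symmetric[OF that, of b x a] unfolding \<open>y = a + b\<close>
    by (simp add: response_add inner_add_left inner_add_right)
  then have "expectation (\<lambda>P. inner y (response x P y))
      = expectation (\<lambda>P. inner a (response x P a) + 2 * inner a (response x P b) + inner b (response x P b))"
    by (intro Bochner_Integration.integral_cong refl) (auto simp: space_\<nu>)
  also have "\<dots> = expectation (\<lambda>P. inner a (response x P a)) + 2 * expectation (\<lambda>P. inner a (response x P b))
      + expectation (\<lambda>P. inner b (response x P b))"
    by (simp add: integrable_response)
  also have "\<dots> = (norm c)\<^sup>2 * (1/2 + beta_dev q) + (1 - (norm c)\<^sup>2) * (1/2 - beta_dev q / (2 * real k - 1))"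
    by (simp add: cross diag_a diag_b nb)
  also have "\<dots> = 1/2 - beta_dev q / (2 * real k - 1) + (beta_dev q + beta_dev q / (2 * real k - 1)) * (norm c)\<^sup>2"
  proof -
    have "u * (1/2 + \<beta>) + (1 - u) * (1/2 - r) = 1/2 - r + (\<beta> + r) * u" for u \<beta> r :: real
      by (simp add: field_simps)
    then show ?thesis .
  qed
  finally show ?thesis by (simp only: c_def)
qed

end

section \<open>From a uniform estimate to the principal eigenprojection\<close>

text \<open>
  Since \<open>2 P - I\<close> is an isometry, the polarized difference of the two values gains a factor 2 over the
  bound that uses only the norm of \<open>P\<close>.
\<close>

lemma abs_quadratic_form_diff_le:
  assumes P: "P \<in> Proj k" and "norm y = 1" "norm y' = 1"
  shows "\<bar>inner y (P *v y) - inner y' (P *v y')\<bar> \<le> norm (y - y')"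
proof -
  let ?S = "\<lambda>v. 2 *\<^sub>R (P *v v) - v"
  have S: "norm (?S v) = norm v" for v
  proof -
    have "(norm (?S v))\<^sup>2 = 4 * (norm (P *v v))\<^sup>2 - 4 * inner v (P *v v) + (norm v)\<^sup>2"
      by (simp add: power2_norm_eq_inner inner_diff_left inner_diff_right inner_commute)
    then have "(norm (?S v))\<^sup>2 = (norm v)\<^sup>2" by (simp add: inner_Proj_self[OF P])
    then show ?thesis by simp
  qed
  have "inner y y = 1" "inner y' y' = 1" using assms by (simp_all flip: power2_norm_eq_inner)
  then have eq: "2 * (inner y (P *v y) - inner y' (P *v y')) = inner (y + y') (?S (y - y'))"
    using inner_Proj[OF P, of y y']
    by (simp add: matrix_vector_mult_diff_distrib inner_add_left inner_diff_right algebra_simps inner_commute)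
  have "\<bar>inner (y + y') (?S (y - y'))\<bar> \<le> norm (y + y') * norm (?S (y - y'))"
    by (rule Cauchy_Schwarz_ineq2)
  also have "norm (y + y') \<le> 2" using norm_triangle_ineq[of y y'] assms by simp
  then have "norm (y + y') * norm (?S (y - y')) \<le> 2 * norm (y - y')"
    unfolding S by (intro mult_right_mono) auto
  finally show ?thesis unfolding eq[symmetric] by (simp add: abs_mult)
qed

text \<open>
  The difference is \<open>Y (I - X) - (I - Y) X\<close>, and its two terms have orthogonal ranges. By the rank one
  property, \<open>Y\<close> shrinks every vector orthogonal to \<open>x\<close>, and \<open>I - Y\<close> every multiple of \<open>x\<close>, at least by
  the factor on the right, the sine of the angle.
\<close>

lemma op_norm_outer_diff:
  fixes x y :: "'a::real_or_complex^'n"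
  assumes x: "norm x = 1" and y: "norm y = 1"
  shows "op_norm (outer y - outer x) \<le> sqrt (1 - (norm (herm x y))\<^sup>2)"
proof -
  let ?X = "outer x" and ?Y = "outer y"
  have PX: "?X \<in> Proj 1" and PY: "?Y \<in> Proj 1" using outer_Proj_1 x y by auto
  define c where "c = norm (herm x y)"
  have c': "norm (herm y x) = c" unfolding c_def by (metis herm_commute norm_sconj)
  have c1: "c \<le> 1" using norm_herm_le[of x y] x y by (simp add: c_def)
  then have s: "0 \<le> 1 - c\<^sup>2" by (simp add: c_def power_le_one)
  have comp: "(norm (x - ?Y *v x))\<^sup>2 = 1 - c\<^sup>2" "(norm (y - ?X *v y))\<^sup>2 = 1 - c\<^sup>2"
    unfolding norm_Proj_compl[OF PX] norm_Proj_compl[OF PY]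
    by (simp_all add: outer_vector norm_smult x y c' flip: c_def)
  have "norm ((?Y - ?X) *v v) \<le> sqrt (1 - c\<^sup>2) * norm v" for v
  proof (rule power2_le_imp_le)
    define u where "u = v - ?X *v v"
    define w where "w = ?X *v v"
    have "(?Y - ?X) *v v = ?Y *v u - (w - ?Y *v w)"
      by (simp add: u_def w_def matrix_vector_mult_diff_rdistrib matrix_vector_mult_diff_distrib)
    moreover have "inner (?Y *v u) (w - ?Y *v w) = 0"
      using inner_Proj[OF PY, of "?Y *v u" w]
      by (simp add: inner_diff_right inner_Proj[OF PY] Proj_idem[OF PY])
    ultimately have sq: "(norm ((?Y - ?X) *v v))\<^sup>2 = (norm (?Y *v u))\<^sup>2 + (norm (w - ?Y *v w))\<^sup>2"
      by (simp add: power2_norm_eq_inner inner_diff_left inner_diff_right inner_commute)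
    have "w - ?Y *v w = herm x v *s (x - ?Y *v x)"
      unfolding w_def outer_vector[of x] vector_ssub_ldistrib vector_scalar_commute ..
    moreover have "norm w = norm (herm x v)" by (simp add: w_def outer_vector norm_smult x)
    ultimately have 1: "(norm (w - ?Y *v w))\<^sup>2 = (norm w)\<^sup>2 * (1 - c\<^sup>2)"
      by (simp only: norm_smult power_mult_distrib comp)
    have "herm y u = herm (y - ?X *v y) u"
    proof -
      have "?X *v u = 0" using Proj_idem[OF PX] by (simp add: u_def matrix_vector_mult_diff_distrib)
      then have "herm (?X *v y) u = 0" using herm_Proj[OF PX, of y u] by (simp add: herm_def)
      then show ?thesis by (simp add: herm_diff_left)
    qed
    then have "norm (?Y *v u) \<le> norm (y - ?X *v y) * norm u"
      using norm_herm_le[of "y - ?X *v y" u] by (simp add: outer_vector[of y] norm_smult y)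
    then have "(norm (?Y *v u))\<^sup>2 \<le> (norm (y - ?X *v y) * norm u)\<^sup>2"
      by (rule power_mono) simp
    then have 2: "(norm (?Y *v u))\<^sup>2 \<le> (1 - c\<^sup>2) * (norm u)\<^sup>2"
      by (simp add: power_mult_distrib comp)
    have "(norm v)\<^sup>2 = (norm w)\<^sup>2 + (norm u)\<^sup>2"
      using norm_Proj_compl[OF PX, of v] by (simp add: u_def w_def)
    then have "(norm ((?Y - ?X) *v v))\<^sup>2 \<le> (1 - c\<^sup>2) * (norm v)\<^sup>2"
      using sq 1 2 by (simp add: algebra_simps)
    then show "(norm ((?Y - ?X) *v v))\<^sup>2 \<le> (sqrt (1 - c\<^sup>2) * norm v)\<^sup>2"
      using s by (simp add: power_mult_distrib)
  qed (use s in simp)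
  then show ?thesis unfolding op_norm_def c_def[symmetric] by (intro onorm_bound) (use s in simp)
qed

text \<open>
  A self-adjoint form that is small on unit vectors varies little between close lines: after
  aligning the phases, \<open>y + x\<close> and \<open>y - x\<close> are orthogonal, with product of lengths twice the sine
  of the angle.
\<close>

lemma quadratic_form_diff_bound:
  fixes A :: "'a::real_or_complex^'n^'n"
  assumes adj: "conj_transpose A = A" and bound: "\<And>v. norm v = 1 \<Longrightarrow> \<bar>inner v (A *v v)\<bar> \<le> \<alpha>"
    and x: "norm x = 1" and y: "norm y = 1"
  shows "\<bar>inner y (A *v y) - inner x (A *v x)\<bar> \<le> 2 * \<alpha> * sqrt (1 - (norm (herm x y))\<^sup>2)"
proof -
  have sym: "inner u (A *v v) = inner v (A *v u)" for u v
    using inner_mult_right[of u A v] adj by (simp add: inner_commute)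
  have quad: "\<bar>inner v (A *v v)\<bar> \<le> \<alpha> * (norm v)\<^sup>2" for v
  proof (cases "v = 0")
    case False
    have "\<bar>inner ((1 / norm v) *\<^sub>R v) (A *v ((1 / norm v) *\<^sub>R v))\<bar> \<le> \<alpha>"
      using False by (intro bound) simp
    then have "\<bar>inner v (A *v v)\<bar> / (norm v)\<^sup>2 \<le> \<alpha>"
      by (simp add: matrix_vector_scaleR power2_eq_square abs_mult)
    then show ?thesis using False by (simp add: pos_divide_le_eq)
  qed simp
  have \<alpha>: "0 \<le> \<alpha>" using bound[OF x] by linarith
  have bil: "\<bar>inner u (A *v v)\<bar> \<le> \<alpha>" if "norm u = 1" "norm v = 1" for u v
  proof -
    have "4 * inner u (A *v v) = inner (u + v) (A *v (u + v)) - inner (u - v) (A *v (u - v))"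
      using sym[of v u]
      by (simp add: matrix_vector_right_distrib matrix_vector_mult_diff_distrib inner_add_left
          inner_add_right inner_diff_left inner_diff_right)
    moreover have "(norm (u + v))\<^sup>2 + (norm (u - v))\<^sup>2 = 4"
      using that by (simp add: power2_norm_eq_inner norm_eq_1 inner_add_left inner_add_right
          inner_diff_left inner_diff_right)
    then have "\<alpha> * (norm (u + v))\<^sup>2 + \<alpha> * (norm (u - v))\<^sup>2 = 4 * \<alpha>"
      by (simp add: distrib_left[symmetric] mult.commute)
    ultimately show ?thesis using quad[of "u + v"] quad[of "u - v"] by linarith
  qed
  have bil': "\<bar>inner u (A *v v)\<bar> \<le> \<alpha> * (norm u * norm v)" for u v
  proof (cases "u = 0 \<or> v = 0")
    case True
    then show ?thesis by auto
  next
    case False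
    have "\<bar>inner ((1 / norm u) *\<^sub>R u) (A *v ((1 / norm v) *\<^sub>R v))\<bar> \<le> \<alpha>"
      using False by (intro bil) auto
    then have "\<bar>inner u (A *v v)\<bar> / (norm u * norm v) \<le> \<alpha>"
      by (simp add: matrix_vector_scaleR abs_mult mult.commute)
    then show ?thesis using False by (simp add: pos_divide_le_eq)
  qed
  obtain c :: 'a where c: "norm c = 1" "herm (c *s y) x = of_real (norm (herm y x))"
    using obtain_phase by blast
  define z where "z = c *s y"
  have z: "norm z = 1" using c y by (simp add: z_def norm_smult)
  have nh: "norm (herm y x) = norm (herm x y)" by (metis herm_commute norm_sconj)
  have "inner z x = sre (of_real (norm (herm x y)) :: 'a)" unfolding sre_herm[symmetric] z_def c(2) nh ..
  then have zx: "inner z x = norm (herm x y)" by (simp add: sre_inner of_real_def)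
  have "inner y (A *v y) - inner x (A *v x) = inner (z + x) (A *v (z - x))"
    using sym[of z x] inner_phase[OF c(1), of y A]
    by (simp add: z_def matrix_vector_mult_diff_distrib inner_add_left inner_diff_right)
  then have "\<bar>inner y (A *v y) - inner x (A *v x)\<bar> \<le> \<alpha> * (norm (z + x) * norm (z - x))"
    using bil' by simp
  also have "norm (z + x) * norm (z - x) = 2 * sqrt (1 - (norm (herm x y))\<^sup>2)"
  proof -
    have "(norm (z + x))\<^sup>2 = 2 + 2 * norm (herm x y)" "(norm (z - x))\<^sup>2 = 2 - 2 * norm (herm x y)"
      using z x zx by (simp_all add: power2_norm_eq_inner inner_add_left inner_add_right
          inner_diff_left inner_diff_right inner_commute norm_eq_1)
    then have "(norm (z + x) * norm (z - x))\<^sup>2 = (2 + 2 * norm (herm x y)) * (2 - 2 * norm (herm x y))"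
      by (simp only: power_mult_distrib)
    also have "\<dots> = 4 * (1 - (norm (herm x y))\<^sup>2)"
      by (simp add: algebra_simps power2_eq_square)
    finally have sq: "(norm (z + x) * norm (z - x))\<^sup>2 = 4 * (1 - (norm (herm x y))\<^sup>2)" .
    have "norm (z + x) * norm (z - x) = sqrt (4 * (1 - (norm (herm x y))\<^sup>2))"
      using real_sqrt_unique[OF sq] by simp
    then show ?thesis by (simp only: real_sqrt_mult real_sqrt_four)
  qed
  finally show ?thesis by (simp add: mult_ac)
qed

lemma PEP_feasible_outer:
  assumes "norm x = 1"
  shows "PEP_feasible (outer x)"
proof -
  have "trace (outer x) = trace (mat 1 ** outer x)" by simp
  then have "sre (trace (outer x)) = 1"
    using assms by (simp only: sre_trace_mult_outer) (simp add: norm_eq_1)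
  moreover have "0 \<le> inner v (outer x *v v)" for v
    using inner_Proj_self[OF outer_Proj_1[OF assms], of v] by simp
  ultimately show ?thesis by (simp add: PEP_feasible_def pos_semidef_def conj_transpose_outer)
qed

text \<open>
  If the averages of the responses are uniformly close to a matrix \<open>\<mu> I + \<Delta> X\<close>, then every
  maximizer lies close to \<open>X\<close>: as the maximizer beats \<open>X\<close>, the loss \<open>\<Delta> s\<^sup>2\<close> of the ideal objective,
  for an angle with sine \<open>s\<close>, is at most the gain \<open>2 (\<epsilon>' + \<tau>) s\<close> from the perturbation.
\<close>

theorem PEP_solution_close:
  fixes Ps :: "nat \<Rightarrow> 'a::real_or_complex^'n^'n"
  assumes m: "m \<ge> 1" and Ps: "\<And>j. j < m \<Longrightarrow> Ps j \<in> Proj k" and \<Delta>: "\<Delta> > 0"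
    and close: "\<And>x y. norm x = 1 \<Longrightarrow> norm y = 1 \<Longrightarrow>
      \<bar>(\<Sum>j<m. inner y (response x (Ps j) y)) / real m - (\<mu> + \<Delta> * (norm (herm x y))\<^sup>2)\<bar> \<le> \<epsilon>'"
    and X: "X \<in> Proj 1" and ham: "hamming_dist m (\<Phi> Ps X) b \<le> \<tau>"
    and sol: "PEP_solution m Ps b Y"
  shows "op_norm (Y - X) \<le> 2 * (\<epsilon>' + \<tau>) / \<Delta>"
proof -
  obtain x where x: "norm x = 1" "X = outer x" using X by (rule Proj_1_outer)
  have "Y \<in> Proj 1" using sol by (simp add: PEP_solution_def)
  then obtain y where y: "norm y = 1" "Y = outer y" by (rule Proj_1_outer)
  let ?Q = "Q_mat m Ps b"
  define s where "s = sqrt (1 - (norm (herm x y))\<^sup>2)"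
  have norm1: "norm (herm x y) \<le> 1" using norm_herm_le[of x y] x y by simp
  then have s2: "s\<^sup>2 = 1 - (norm (herm x y))\<^sup>2" "s \<ge> 0"
    by (simp_all add: s_def power_le_one)
  have op: "op_norm (Y - X) \<le> s" using op_norm_outer_diff[OF x(1) y(1)] by (simp add: x y s_def)
  define A where "A = ?Q - (\<mu> *\<^sub>R mat 1 + \<Delta> *\<^sub>R outer x)"
  let ?r = "\<lambda>j v. if b j then Ps j *v v else v - Ps j *v v"
  have Qv: "?Q *v v = (1 / real m) *\<^sub>R (\<Sum>j<m. ?r j v)" for v
    unfolding Q_mat_def scaleR_matrix_vector sum_matrix_vector
    by (intro arg_cong[of _ _ "\<lambda>u. _ *\<^sub>R u"] sum.cong) (auto simp: matrix_vector_mult_diff_rdistrib)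
  have Av: "inner v (A *v v) = (\<Sum>j<m. inner v (?r j v)) / real m - (\<mu> + \<Delta> * (norm (herm x v))\<^sup>2)"
    if v: "norm v = 1" for v
  proof -
    have "inner v (outer x *v v) = (norm (herm x v))\<^sup>2"
      using inner_Proj_self[OF outer_Proj_1[OF x(1)], of v] x by (simp add: outer_vector norm_smult)
    moreover have "inner v v = 1" using v by (simp add: norm_eq_1)
    ultimately show ?thesis
      by (simp add: A_def matrix_vector_mult_diff_rdistrib matrix_vector_mult_add_rdistrib
          scaleR_matrix_vector Qv inner_diff_right inner_add_right inner_sum_right)
  qed
  have adj: "conj_transpose A = A"
  proof -
    have "conj_transpose ?Q = ?Q"
      unfolding Q_mat_def conj_transpose_scaleR conj_transpose_sum
      by (intro arg_cong[of _ _ "\<lambda>u. _ *\<^sub>R u"] sum.cong)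
        (auto simp: conj_transpose_diff Proj_adjoint[OF Ps])
    then show ?thesis
      by (simp add: A_def conj_transpose_diff conj_transpose_add conj_transpose_scaleR conj_transpose_outer)
  qed
  have bound: "\<bar>inner v (A *v v)\<bar> \<le> \<epsilon>' + \<tau>" if v: "norm v = 1" for v
  proof -
    let ?B = "{j. j < m \<and> \<Phi> Ps X j \<noteq> b j}"
    have resp: "response x (Ps j) v = (if \<Phi> Ps X j then Ps j *v v else v - Ps j *v v)" for j
      by (simp add: response_def \<Phi>_def \<phi>_def x sre_trace_mult_outer)
    have "\<bar>inner v (?r j v) - inner v (response x (Ps j) v)\<bar> \<le> (if j \<in> ?B then 1 else 0)" if "j < m" for j
    proof -
      have "0 \<le> inner v (Ps j *v v)" "inner v (Ps j *v v) \<le> 1"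
        using norm_Proj_le[OF Ps[OF that], of v] v
        by (auto simp: inner_Proj_self[OF Ps[OF that]] power_le_one)
      moreover have "inner v v = 1" using v by (simp add: norm_eq_1)
      ultimately show ?thesis using that by (auto simp: resp inner_diff_right abs_le_iff)
    qed
    then have "(\<Sum>j<m. \<bar>inner v (?r j v) - inner v (response x (Ps j) v)\<bar>) \<le> (\<Sum>j<m. if j \<in> ?B then 1 else 0)"
      by (intro sum_mono) auto
    also have "\<dots> = real (card ?B)" by (simp add: sum.If_cases Int_def conj_commute)
    also have "\<dots> \<le> \<tau> * real m" using ham m by (simp add: hamming_dist_def pos_divide_le_eq)
    finally have "\<bar>\<Sum>j<m. inner v (?r j v) - inner v (response x (Ps j) v)\<bar> \<le> \<tau> * real m"
      using sum_abs[of "\<lambda>j. inner v (?r j v) - inner v (response x (Ps j) v)" "{..<m}"] by linarith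
    then have "\<bar>(\<Sum>j<m. inner v (?r j v)) / real m - (\<Sum>j<m. inner v (response x (Ps j) v)) / real m\<bar> \<le> \<tau>"
      using m by (simp add: sum_subtractf pos_divide_le_eq flip: diff_divide_distrib)
    then show ?thesis using close[OF x(1) v] unfolding Av[OF v] by linarith
  qed
  have "inner x (?Q *v x) \<le> inner y (?Q *v y)"
  proof -
    have "sre (trace (?Q ** outer x)) \<le> sre (trace (?Q ** outer y))"
      using sol PEP_feasible_outer[OF x(1)] by (simp add: PEP_solution_def PEP_maximizer_def y)
    then show ?thesis by (simp add: sre_trace_mult_outer)
  qed
  moreover have "inner v (?Q *v v) = inner v (A *v v) + \<mu> + \<Delta> * (norm (herm x v))\<^sup>2" if v: "norm v = 1" for v
    unfolding Av[OF v] Qv by (simp add: inner_sum_right)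
  note this[OF x(1)] this[OF y(1)]
  moreover have "norm (herm x x) = 1" using x by (simp add: herm_self)
  ultimately have "\<Delta> * s\<^sup>2 \<le> inner y (A *v y) - inner x (A *v x)"
    by (simp add: s2 algebra_simps)
  also have "\<dots> \<le> 2 * (\<epsilon>' + \<tau>) * s"
    using quadratic_form_diff_bound[OF adj bound x(1) y(1)] by (simp add: s_def)
  finally have "\<Delta> * s * s \<le> 2 * (\<epsilon>' + \<tau>) * s" by (simp add: power2_eq_square)
  moreover have "0 \<le> \<epsilon>' + \<tau>" using bound[OF x(1)] by linarith
  ultimately have "\<Delta> * s \<le> 2 * (\<epsilon>' + \<tau>)"
    using s2(2) by (cases "s = 0") auto
  then have "s \<le> 2 * (\<epsilon>' + \<tau>) / \<Delta>" using \<Delta> by (simp add: pos_le_divide_eq mult.commute)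
  then show ?thesis using op by linarith
qed

section \<open>Nets of the unit sphere\<close>

text \<open>
  The balls of radius \<open>\<eta> / 2\<close> around the points are disjoint and lie in the ball of radius \<open>1 + \<eta> / 2\<close>.
\<close>

lemma card_separated_le:
  fixes N :: "'e::euclidean_space set"
  assumes \<eta>: "\<eta> > 0" and fin: "finite N" and unit: "\<And>y. y \<in> N \<Longrightarrow> norm y = 1"
    and sep: "\<And>y z. y \<in> N \<Longrightarrow> z \<in> N \<Longrightarrow> y \<noteq> z \<Longrightarrow> norm (y - z) > \<eta>"
  shows "real (card N) \<le> (1 + 2 / \<eta>) ^ DIM('e)"
proof -
  let ?V = "measure lborel (ball (0::'e) 1)"
  have V: "?V > 0" by (rule content_ball_pos) simp
  have vol: "measure lborel (ball (c::'e) r) = r ^ DIM('e) * ?V" if "r > 0" for c r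
    using content_ball_conv_unit_ball[of r c] that by (simp add: mult.commute)
  have disj: "disjoint_family_on (\<lambda>y. ball y (\<eta> / 2)) N"
    unfolding disjoint_family_on_def
  proof (intro ballI impI)
    fix y z assume yz: "y \<in> N" "z \<in> N" "y \<noteq> z"
    show "ball y (\<eta> / 2) \<inter> ball z (\<eta> / 2) = {}"
      using sep[OF yz] by (intro disjoint_ballI) (simp add: dist_norm)
  qed
  have "real (card N) * ((\<eta> / 2) ^ DIM('e) * ?V) = (\<Sum>y\<in>N. measure lborel (ball y (\<eta> / 2)))"
  proof -
    have "measure lborel (ball y (\<eta> / 2)) = (\<eta> / 2) ^ DIM('e) * ?V" for y :: 'e
      by (rule vol) (use \<eta> in simp)
    then show ?thesis by (simp only: sum_constant)
  qed
  also have "\<dots> = measure lborel (\<Union>y\<in>N. ball y (\<eta> / 2))"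
  proof (rule measure_finite_Union[symmetric, OF fin _ disj])
    show "emeasure lborel (ball y (\<eta> / 2)) \<noteq> \<infinity>" for y :: 'e
      by (rule less_imp_neq[OF emeasure_lborel_ball_finite])
  qed auto
  also have "\<dots> \<le> measure lborel (ball (0::'e) (1 + \<eta> / 2))"
  proof (rule measure_mono_fmeasurable)
    show "(\<Union>y\<in>N. ball y (\<eta> / 2)) \<subseteq> ball 0 (1 + \<eta> / 2)"
    proof
      fix v assume "v \<in> (\<Union>y\<in>N. ball y (\<eta> / 2))"
      then obtain y where "y \<in> N" "norm (y - v) < \<eta> / 2" by (auto simp: dist_norm)
      then show "v \<in> ball 0 (1 + \<eta> / 2)"
        using unit[of y] norm_triangle_ineq[of "v - y" y] by (simp add: norm_minus_commute)
    qed
    show "(\<Union>y\<in>N. ball y (\<eta> / 2)) \<in> sets lborel" by (simp add: borel_open open_UN)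
    show "ball (0::'e) (1 + \<eta> / 2) \<in> fmeasurable lborel"
      by (rule fmeasurableI) (simp, rule emeasure_lborel_ball_finite)
  qed
  also have "\<dots> = (1 + \<eta> / 2) ^ DIM('e) * ?V" using \<eta> by (intro vol) simp
  finally have "real (card N) * (\<eta> / 2) ^ DIM('e) \<le> (1 + \<eta> / 2) ^ DIM('e)"
    using V by (simp add: mult.assoc[symmetric])
  then have "real (card N) \<le> (1 + \<eta> / 2) ^ DIM('e) / (\<eta> / 2) ^ DIM('e)"
    using \<eta> by (simp add: pos_le_divide_eq)
  also have "\<dots> = ((1 + \<eta> / 2) / (\<eta> / 2)) ^ DIM('e)" by (simp only: power_divide)
  also have "(1 + \<eta> / 2) / (\<eta> / 2) = 1 + 2 / \<eta>" using \<eta> by (simp add: field_simps)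
  finally show ?thesis .
qed

text \<open>
  A separated subset of the largest possible size leaves no point of the sphere uncovered.
\<close>

lemma obtain_sphere_net:
  assumes \<eta>: "\<eta> > 0"
  obtains N :: "'e::euclidean_space set" where "finite N" "\<And>y. y \<in> N \<Longrightarrow> norm y = 1"
    "\<And>x. norm x = 1 \<Longrightarrow> \<exists>y\<in>N. norm (x - y) \<le> \<eta>" "real (card N) \<le> (1 + 2 / \<eta>) ^ DIM('e)"
proof -
  define S where "S = {N :: 'e set. finite N \<and> (\<forall>y\<in>N. norm y = 1)
    \<and> (\<forall>y\<in>N. \<forall>z\<in>N. y \<noteq> z \<longrightarrow> norm (y - z) > \<eta>)}"
  have bound: "real (card N) \<le> (1 + 2 / \<eta>) ^ DIM('e)" if "N \<in> S" for N
  proof (rule card_separated_le[OF \<eta>])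
    show "finite N" "\<And>y. y \<in> N \<Longrightarrow> norm y = 1"
      "\<And>y z. y \<in> N \<Longrightarrow> z \<in> N \<Longrightarrow> y \<noteq> z \<Longrightarrow> norm (y - z) > \<eta>"
      using that unfolding S_def by blast+
  qed
  have "{} \<in> S" by (simp add: S_def)
  moreover have "\<forall>N. N \<in> S \<longrightarrow> card N < Suc (nat \<lfloor>(1 + 2 / \<eta>) ^ DIM('e)\<rfloor>)"
    using bound by (auto intro: le_nat_floor simp: less_Suc_eq_le)
  ultimately obtain N where N: "N \<in> S" "\<And>N'. N' \<in> S \<Longrightarrow> card N' \<le> card N"
    using ex_has_greatest_nat[of "\<lambda>N. N \<in> S" "{}" card "Suc (nat \<lfloor>(1 + 2 / \<eta>) ^ DIM('e)\<rfloor>)"] by blast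
  show thesis
  proof (rule that)
    show "finite N" "\<And>y. y \<in> N \<Longrightarrow> norm y = 1" using N(1) by (auto simp: S_def)
    show "real (card N) \<le> (1 + 2 / \<eta>) ^ DIM('e)" by (rule bound[OF N(1)])
    fix x :: 'e assume x: "norm x = 1"
    show "\<exists>y\<in>N. norm (x - y) \<le> \<eta>"
    proof (rule ccontr)
      assume "\<not> ?thesis"
      then have far: "\<And>y. y \<in> N \<Longrightarrow> norm (x - y) > \<eta>" by (auto simp: not_le)
      then have "x \<notin> N" using \<eta> by force
      moreover have "insert x N \<in> S"
        using N(1) x far by (auto simp: S_def norm_minus_commute)
      ultimately show False using N(2)[of "insert x N"] N(1) by (simp add: S_def)
    qed
  qed
qed

section \<open>Independent uniformly distributed projections\<close>

locale random_Projs = prob_space M for M :: "'w measure" +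
  fixes P :: "nat \<Rightarrow> 'w \<Rightarrow> 'a::real_or_complex^'n^'n" and m n :: nat
  assumes m_pos: "m \<ge> 1" and n_pos: "n \<ge> 1" and card_n: "CARD('n) = 2 * n"
    and uniform: "\<And>j. j < m \<Longrightarrow> uniform_on_Proj n (distr M (proj_space n) (P j))"
    and indep: "indep_vars (\<lambda>_. proj_space n) P {..<m}"
begin

definition q :: real where "q = real DIM('a) * real n / 2"

lemma q_pos: "q > 0" using n_pos by (simp add: q_def)

definition gap :: real where "gap = beta_dev q + beta_dev q / (2 * real n - 1)"

definition mean :: "'a^'n \<Rightarrow> 'a^'n \<Rightarrow> real" where
  "mean x y = 1/2 - beta_dev q / (2 * real n - 1) + gap * (norm (herm x y))\<^sup>2"

lemma random_variable_P: "j < m \<Longrightarrow> random_variable (proj_space n) (P j)"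
  using indep by (auto simp: indep_vars_def)

lemma P_Proj: "j < m \<Longrightarrow> \<omega> \<in> space M \<Longrightarrow> P j \<omega> \<in> Proj n"
  using measurable_space[OF random_variable_P] by (auto simp: proj_space_def space_restrict_space)

lemma uniform_Proj_P:
  assumes "j < m"
  shows "uniform_Proj (distr M (proj_space n) (P j)) n"
  using uniform[OF assms] card_n n_pos by unfold_locales auto

lemma measurable_proj_space: "g \<in> borel \<rightarrow>\<^sub>M N \<Longrightarrow> g \<in> proj_space n \<rightarrow>\<^sub>M N"
  unfolding proj_space_def by (rule measurable_restrict_space1)

lemma random_variable_comp:
  assumes "g \<in> borel \<rightarrow>\<^sub>M N" "j < m"
  shows "random_variable N (\<lambda>\<omega>. g (P j \<omega>))"
  using measurable_compose[OF random_variable_P[OF assms(2)] measurable_proj_space[OF assms(1)]] .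

lemma expectation_comp:
  fixes g :: "'a^'n^'n \<Rightarrow> real"
  assumes "g \<in> borel_measurable borel" "j < m"
  shows "expectation (\<lambda>\<omega>. g (P j \<omega>)) = (LINT A|distr M (proj_space n) (P j). g A)"
  by (rule integral_distr[OF random_variable_P[OF assms(2)] measurable_proj_space[OF assms(1)], symmetric])

lemma expectation_response_P:
  assumes "j < m" "norm x = 1" "norm y = 1"
  shows "expectation (\<lambda>\<omega>. inner y (response x (P j \<omega>) y)) = mean x y"
proof -
  interpret U: uniform_Proj "distr M (proj_space n) (P j)" n
    by (rule uniform_Proj_P[OF assms(1)])
  have "U.q = q" by (simp add: U.q_def q_def)
  then show ?thesis
    using U.expectation_response[OF assms(2,3)]
    by (subst expectation_comp[OF response_measurable assms(1)]) (simp add: mean_def gap_def)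
qed

lemma beta_dev_le: "beta_dev q \<le> 1/2"
proof -
  interpret U: uniform_Proj "distr M (proj_space n) (P 0)" n
    using m_pos by (intro uniform_Proj_P) simp
  show ?thesis using U.beta_dev_le by (simp add: U.q_def q_def)
qed

lemma gap_bounds: "gap > 0" "gap \<le> 1"
proof -
  have b: "beta_dev q > 0" by (rule beta_dev_pos[OF q_pos])
  have n: "2 * real n - 1 \<ge> 1" using n_pos by simp
  show "gap > 0" using b n by (simp add: gap_def add_pos_nonneg)
  have "beta_dev q / (2 * real n - 1) \<le> beta_dev q / 1"
    using b n by (intro divide_left_mono) auto
  then show "gap \<le> 1" using beta_dev_le by (simp add: gap_def)
qed

lemma hoeffding_P:
  fixes g :: "'a^'n^'n \<Rightarrow> real"
  assumes g: "g \<in> borel_measurable borel" and g01: "\<And>A. A \<in> Proj n \<Longrightarrow> 0 \<le> g A \<and> g A \<le> 1" and t: "t \<ge> 0"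
  shows "prob {\<omega> \<in> space M. \<bar>(\<Sum>j<m. g (P j \<omega>)) - (\<Sum>j<m. expectation (\<lambda>\<omega>. g (P j \<omega>)))\<bar> \<ge> real m * t}
      \<le> 2 * exp (- 2 * real m * t\<^sup>2)" (is ?A)
    and "prob {\<omega> \<in> space M. (\<Sum>j<m. g (P j \<omega>)) \<ge> (\<Sum>j<m. expectation (\<lambda>\<omega>. g (P j \<omega>))) + real m * t}
      \<le> exp (- 2 * real m * t\<^sup>2)" (is ?B)
proof -
  interpret H: Hoeffding_ineq M "{..<m}" "\<lambda>j \<omega>. g (P j \<omega>)" "\<lambda>_. 0" "\<lambda>_. 1" "\<Sum>j<m. expectation (\<lambda>\<omega>. g (P j \<omega>))"
  proof unfold_locales
    show "indep_vars (\<lambda>_. borel) (\<lambda>j \<omega>. g (P j \<omega>)) {..<m}"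
      by (rule indep_vars_compose2[OF indep]) (rule measurable_proj_space[OF g])
    show "AE \<omega> in M. g (P j \<omega>) \<in> {0..1}" if "j \<in> {..<m}" for j
      using g01[OF P_Proj] that by (intro AE_I2) auto
  qed auto
  have e: "- 2 * (real m * t)\<^sup>2 / (\<Sum>j<m. (1 - 0)\<^sup>2) = - 2 * real m * t\<^sup>2"
    using m_pos by (simp add: power2_eq_square)
  have p: "(\<Sum>j<m. (1 - 0 :: real)\<^sup>2) > 0" using m_pos by simp
  have t': "real m * t \<ge> 0" using t by simp
  show ?A using H.Hoeffding_ineq_abs_ge[OF t' p] unfolding e .
  show ?B using H.Hoeffding_ineq_ge[OF t' p] unfolding e .
qed

text \<open>
  Moving \<open>y\<close> by \<open>\<eta>\<close> changes each response by at most \<open>\<eta>\<close>. Moving \<open>x\<close> by \<open>\<eta>\<close> changes only those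
  responses whose measurement is within \<open>\<eta>\<close> of the threshold, and there are few of these.
\<close>

lemma response_net_step:
  assumes A: "A \<in> Proj n" and x: "norm x = 1" "norm x' = 1" "norm (x - x') \<le> \<eta>"
    and y: "norm y = 1" "norm y' = 1" "norm (y - y') \<le> \<eta>'"
  shows "\<bar>inner y (response x A y) - inner y' (response x' A y')\<bar>
    \<le> \<eta>' + indicator {B. \<bar>inner x' (B *v x') - 1/2\<bar> \<le> \<eta>} A"
proof -
  let ?t = "\<lambda>v. inner v (A *v v)"
  have dy: "\<bar>?t y - ?t y'\<bar> \<le> \<eta>'" and dx: "\<bar>?t x - ?t x'\<bar> \<le> \<eta>"
    using abs_quadratic_form_diff_le[OF A y(1,2)] abs_quadratic_form_diff_le[OF A x(1,2)] x y by auto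
  show ?thesis
  proof (cases "(?t x \<ge> 1/2) = (?t x' \<ge> 1/2)")
    case True
    then have "\<bar>inner y (response x A y) - inner y' (response x' A y')\<bar> = \<bar>?t y - ?t y'\<bar>"
      unfolding response_diag[OF A y(1)] response_diag[OF A y(2)] by auto
    then show ?thesis using dy by (auto simp: indicator_def)
  next
    case False
    then have "\<bar>?t x' - 1/2\<bar> \<le> \<eta>" using dx by linarith
    moreover have "\<bar>inner y (response x A y) - inner y' (response x' A y')\<bar> \<le> 1"
      using response_diag_bounds[OF A y(1), of x] response_diag_bounds[OF A y(2), of x'] by linarith
    moreover have "0 \<le> \<eta>'" using y(3) norm_ge_zero order_trans by blast
    ultimately show ?thesis by simp
  qed
qed

lemma mean_net_step:
  assumes x: "norm x = 1" "norm x' = 1" "norm (x - x') \<le> \<eta>"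
    and y: "norm y = 1" "norm y' = 1" "norm (y - y') \<le> \<eta>'"
  shows "\<bar>mean x y - mean x' y'\<bar> \<le> \<eta> + \<eta>'"
proof -
  have h: "(norm (herm u v))\<^sup>2 = inner v (outer u *v v)" if "norm u = 1" for u v :: "'a^'n"
    using inner_Proj_self[OF outer_Proj_1[OF that], of v] that by (simp add: outer_vector norm_smult)
  have c: "norm (herm u v) = norm (herm v u)" for u v :: "'a^'n"
    by (metis herm_commute norm_sconj)
  have "\<bar>(norm (herm x y))\<^sup>2 - (norm (herm x y'))\<^sup>2\<bar> \<le> norm (y - y')"
    unfolding h[OF x(1)] by (rule abs_quadratic_form_diff_le[OF outer_Proj_1[OF x(1)] y(1,2)])
  moreover have "\<bar>(norm (herm x y'))\<^sup>2 - (norm (herm x' y'))\<^sup>2\<bar> \<le> norm (x - x')"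
    unfolding c[of _ y'] h[OF y(2)] by (rule abs_quadratic_form_diff_le[OF outer_Proj_1[OF y(2)] x(1,2)])
  ultimately have *: "\<bar>(norm (herm x y))\<^sup>2 - (norm (herm x' y'))\<^sup>2\<bar> \<le> \<eta> + \<eta>'"
    using x(3) y(3) by linarith
  have "\<bar>mean x y - mean x' y'\<bar> = gap * \<bar>(norm (herm x y))\<^sup>2 - (norm (herm x' y'))\<^sup>2\<bar>"
    using gap_bounds by (simp add: mean_def abs_mult flip: right_diff_distrib)
  also have "\<dots> \<le> 1 * (\<eta> + \<eta>')"
    using gap_bounds * by (intro mult_mono) auto
  finally show ?thesis by simp
qed

text \<open>
  The widths \<open>\<epsilon> / (5 q)\<close> and \<open>\<epsilon>\<close> of the nets keep the total error within \<open>4 \<epsilon>\<close>, as the measurement of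
  a fixed vector is within \<open>\<eta>\<close> of the threshold with probability at most \<open>8 q (1/2) \<eta>\<close>.
\<close>

theorem uniform_estimate:
  assumes q1: "q \<ge> 1" and \<epsilon>: "\<epsilon> > 0"
  obtains E where "E \<in> sets M"
    "prob E \<ge> 1 - 4 * ((1 + 10 * q / \<epsilon>) * (1 + 2 / \<epsilon>)) ^ DIM('a^'n) * exp (- real m * \<epsilon>\<^sup>2 / 2)"
    "\<And>\<omega> x y. \<omega> \<in> E \<Longrightarrow> norm x = 1 \<Longrightarrow> norm y = 1 \<Longrightarrow>
      \<bar>(\<Sum>j<m. inner y (response x (P j \<omega>) y)) / real m - mean x y\<bar> \<le> 4 * \<epsilon>"
proof -
  let ?L = "DIM('a^'n)"
  define \<eta> where "\<eta> = \<epsilon> / (5 * q)"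
  have \<eta>: "\<eta> > 0" using \<epsilon> q1 by (simp add: \<eta>_def)
  define p where "p = 8 * q * beta_dev q * \<eta>"
  have p: "p \<le> 4 / 5 * \<epsilon>"
  proof -
    have "p = 8 / 5 * beta_dev q * \<epsilon>" using q1 by (simp add: p_def \<eta>_def)
    also have "\<dots> \<le> 8 / 5 * (1 / 2) * \<epsilon>" using beta_dev_le \<epsilon> by (intro mult_right_mono mult_left_mono) auto
    finally show ?thesis by simp
  qed
  obtain X :: "('a^'n) set" where X: "finite X" "\<And>y. y \<in> X \<Longrightarrow> norm y = 1"
      "\<And>x. norm x = 1 \<Longrightarrow> \<exists>y\<in>X. norm (x - y) \<le> \<eta>" "real (card X) \<le> (1 + 2 / \<eta>) ^ ?L"
    using obtain_sphere_net[OF \<eta>] by blast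
  obtain Y :: "('a^'n) set" where Y: "finite Y" "\<And>y. y \<in> Y \<Longrightarrow> norm y = 1"
      "\<And>x. norm x = 1 \<Longrightarrow> \<exists>y\<in>Y. norm (x - y) \<le> \<epsilon>" "real (card Y) \<le> (1 + 2 / \<epsilon>) ^ ?L"
    using obtain_sphere_net[OF \<epsilon>] by blast
  let ?g = "\<lambda>x y A. inner y (response x A y)"
  define near where "near = (\<lambda>x. {B::'a^'n^'n. \<bar>inner x (B *v x) - 1/2\<bar> \<le> \<eta>})"
  have near_sets: "near x \<in> sets borel" for x
  proof -
    have "{B \<in> space borel. \<bar>inner x ((B::'a^'n^'n) *v x) - 1/2\<bar> \<le> \<eta>} \<in> sets borel" by measurable
    then show ?thesis by (simp add: near_def)
  qed
  have ind_meas: "(indicator (near x) :: 'a^'n^'n \<Rightarrow> real) \<in> borel_measurable borel" for x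
    using near_sets by (rule borel_measurable_indicator)
  define F where "F = (\<lambda>x y. {\<omega> \<in> space M. \<bar>(\<Sum>j<m. ?g x y (P j \<omega>)) - (\<Sum>j<m. expectation (\<lambda>\<omega>. ?g x y (P j \<omega>)))\<bar> \<ge> real m * (\<epsilon>/2)})"
  define H where "H = (\<lambda>x. {\<omega> \<in> space M. (\<Sum>j<m. indicator (near x) (P j \<omega>)) \<ge> (\<Sum>j<m. expectation (\<lambda>\<omega>. indicator (near x) (P j \<omega>))) + real m * (\<epsilon>/2)})"
  have mF [measurable]: "F x y \<in> sets M" for x y
  proof -
    have [measurable]: "(\<lambda>\<omega>. \<Sum>j<m. ?g x y (P j \<omega>)) \<in> borel_measurable M"
      by (intro borel_measurable_sum random_variable_comp[OF response_measurable]) auto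
    show ?thesis unfolding F_def by measurable
  qed
  have mH [measurable]: "H x \<in> sets M" for x
  proof -
    have [measurable]: "(\<lambda>\<omega>. \<Sum>j<m. indicator (near x) (P j \<omega>) :: real) \<in> borel_measurable M"
      by (intro borel_measurable_sum random_variable_comp[OF ind_meas]) auto
    show ?thesis unfolding H_def by measurable
  qed
  define r where "r = exp (- real m * \<epsilon>\<^sup>2 / 2)"
  have r: "r > 0" "exp (- 2 * real m * (\<epsilon>/2)\<^sup>2) = r"
    by (simp_all add: r_def power2_eq_square)
  have pF: "prob (F x y) \<le> 2 * r" if "norm y = 1" for x y
    using hoeffding_P(1)[OF response_measurable, of y x y "\<epsilon>/2"] response_diag_bounds[OF _ that] \<epsilon>
    unfolding F_def r(2) by auto
  have pH: "prob (H x) \<le> r" for x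
    using hoeffding_P(2)[OF ind_meas, of x "\<epsilon>/2"] \<epsilon> unfolding H_def r(2) by (auto simp: indicator_def)
  define bad where "bad = (\<Union>x\<in>X. \<Union>y\<in>Y. F x y) \<union> (\<Union>x\<in>X. H x)"
  have bad: "bad \<in> sets M" unfolding bad_def using X(1) Y(1) by (intro sets.Un sets.finite_UN) auto
  have "X \<noteq> {}" "Y \<noteq> {}" using X(3)[of "axis undefined 1"] Y(3)[of "axis undefined 1"] by (auto simp: norm_axis_1)
  then have cards: "1 \<le> real (card X)" "1 \<le> real (card Y)"
    using X(1) Y(1) by (simp_all add: Suc_le_eq card_gt_0_iff)
  have "prob bad \<le> prob (\<Union>x\<in>X. \<Union>y\<in>Y. F x y) + prob (\<Union>x\<in>X. H x)"
    unfolding bad_def using X(1) Y(1) by (intro measure_Un_le sets.finite_UN) auto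
  also have "prob (\<Union>x\<in>X. \<Union>y\<in>Y. F x y) \<le> (\<Sum>x\<in>X. prob (\<Union>y\<in>Y. F x y))"
    using X(1) Y(1) by (intro finite_measure_subadditive_finite) auto
  also have "\<dots> \<le> (\<Sum>x\<in>X. \<Sum>y\<in>Y. prob (F x y))"
    using Y(1) by (intro sum_mono finite_measure_subadditive_finite) auto
  also have "\<dots> \<le> (\<Sum>x\<in>X. \<Sum>y\<in>Y. 2 * r)" using pF Y(2) by (intro sum_mono) auto
  also have "\<dots> = 2 * r * real (card X) * real (card Y)" by simp
  also have "prob (\<Union>x\<in>X. H x) \<le> (\<Sum>x\<in>X. prob (H x))"
    using X(1) by (intro finite_measure_subadditive_finite) auto
  also have "\<dots> \<le> (\<Sum>x\<in>X. r)" using pH by (intro sum_mono)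
  also have "\<dots> = r * real (card X) * 1" by simp
  also have "\<dots> \<le> 2 * r * real (card X) * real (card Y)"
    using r(1) cards by (intro mult_mono) auto
  finally have "prob bad \<le> 4 * r * (real (card X) * real (card Y))" by simp
  also have "\<dots> \<le> 4 * r * ((1 + 2 / \<eta>) ^ ?L * (1 + 2 / \<epsilon>) ^ ?L)"
    using r(1) X(4) Y(4) by (intro mult_left_mono mult_mono) (use cards \<eta> in auto)
  also have "(1 + 2 / \<eta>) ^ ?L * (1 + 2 / \<epsilon>) ^ ?L = ((1 + 10 * q / \<epsilon>) * (1 + 2 / \<epsilon>)) ^ ?L"
    by (simp add: \<eta>_def power_mult_distrib)
  finally have pbad: "prob bad \<le> 4 * ((1 + 10 * q / \<epsilon>) * (1 + 2 / \<epsilon>)) ^ ?L * r" by (simp only: mult_ac)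
  show thesis
  proof (rule that[of "space M - bad"])
    show "space M - bad \<in> sets M" using bad by auto
    show "prob (space M - bad) \<ge> 1 - 4 * ((1 + 10 * q / \<epsilon>) * (1 + 2 / \<epsilon>)) ^ ?L * exp (- real m * \<epsilon>\<^sup>2 / 2)"
      using pbad prob_compl[OF bad] unfolding r_def by simp
    fix \<omega> and x y :: "'a^'n"
    assume \<omega>: "\<omega> \<in> space M - bad" and x: "norm x = 1" and y: "norm y = 1"
    obtain x' where x': "x' \<in> X" "norm (x - x') \<le> \<eta>" using X(3)[OF x] by blast
    obtain y' where y': "y' \<in> Y" "norm (y - y') \<le> \<epsilon>" using Y(3)[OF y] by blast
    note nx' = X(2)[OF x'(1)] and ny' = Y(2)[OF y'(1)]
    have rm: "real m > 0" using m_pos by simp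
    have sumE: "(\<Sum>j<m. expectation (\<lambda>\<omega>. ?g x' y' (P j \<omega>))) = real m * mean x' y'"
      by (simp add: expectation_response_P nx' ny')
    have "\<omega> \<notin> F x' y'" using \<omega> x' y' by (auto simp: bad_def)
    then have 1: "\<bar>(\<Sum>j<m. ?g x' y' (P j \<omega>)) - real m * mean x' y'\<bar> < real m * (\<epsilon>/2)"
      using \<omega> unfolding F_def sumE by auto
    have "\<omega> \<notin> H x'" using \<omega> x' by (auto simp: bad_def)
    then have "(\<Sum>j<m. indicator (near x') (P j \<omega>)) < (\<Sum>j<m. expectation (\<lambda>\<omega>. indicator (near x') (P j \<omega>))) + real m * (\<epsilon>/2)"
      using \<omega> by (auto simp: H_def)
    also have "(\<Sum>j<m. expectation (\<lambda>\<omega>. indicator (near x') (P j \<omega>))) \<le> (\<Sum>j<m. p)"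
    proof (rule sum_mono)
      fix j assume j: "j \<in> {..<m}"
      interpret U: uniform_Proj "distr M (proj_space n) (P j)" n
        using j by (intro uniform_Proj_P) simp
      have Uq: "U.q = q" by (simp add: U.q_def q_def)
      have "expectation (\<lambda>\<omega>. indicator (near x') (P j \<omega>))
          = U.expectation (indicator (near x') :: 'a^'n^'n \<Rightarrow> real)"
        using expectation_comp[OF ind_meas, of j x'] j by simp
      also have "\<dots> = U.prob (near x' \<inter> space (distr M (proj_space n) (P j)))" by simp
      also have "near x' \<inter> space (distr M (proj_space n) (P j))
          = {B \<in> space (distr M (proj_space n) (P j)). \<bar>inner x' (B *v x') - 1/2\<bar> \<le> \<eta>}"
        by (auto simp: near_def)
      also have "U.prob \<dots> \<le> p"
        using U.prob_near_half[OF _ nx', of \<eta>] \<eta> q1 unfolding Uq p_def by simp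
      finally show "expectation (\<lambda>\<omega>. indicator (near x') (P j \<omega>)) \<le> p" .
    qed
    finally have 2: "(\<Sum>j<m. indicator (near x') (P j \<omega>)) \<le> real m * (p + \<epsilon>/2)"
      by (simp add: algebra_simps)
    have "\<bar>(\<Sum>j<m. ?g x y (P j \<omega>)) - (\<Sum>j<m. ?g x' y' (P j \<omega>))\<bar>
        \<le> (\<Sum>j<m. \<bar>?g x y (P j \<omega>) - ?g x' y' (P j \<omega>)\<bar>)"
      unfolding sum_subtractf[symmetric] by (rule sum_abs)
    also have "\<dots> \<le> (\<Sum>j<m. \<epsilon> + indicator (near x') (P j \<omega>))"
    proof (rule sum_mono)
      fix j assume "j \<in> {..<m}"
      then have "P j \<omega> \<in> Proj n" using \<omega> P_Proj by auto
      then show "\<bar>?g x y (P j \<omega>) - ?g x' y' (P j \<omega>)\<bar> \<le> \<epsilon> + indicator (near x') (P j \<omega>)"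
        unfolding near_def by (rule response_net_step) (use x y x' y' nx' ny' in auto)
    qed
    also have "\<dots> \<le> real m * (\<epsilon> + p + \<epsilon>/2)" using 2 by (simp add: sum.distrib algebra_simps)
    finally have "\<bar>(\<Sum>j<m. ?g x y (P j \<omega>)) - real m * mean x' y'\<bar> \<le> real m * (\<epsilon> + p + \<epsilon>/2) + real m * (\<epsilon>/2)"
      using 1 by linarith
    also have "\<dots> = real m * (2 * \<epsilon> + p)" by (simp add: algebra_simps)
    finally have "\<bar>(\<Sum>j<m. ?g x y (P j \<omega>)) / real m - mean x' y'\<bar> \<le> 2 * \<epsilon> + p"
      using rm by (simp add: abs_le_iff field_simps)
    moreover have "\<bar>mean x y - mean x' y'\<bar> \<le> \<eta> + \<epsilon>"
      by (rule mean_net_step) (use x y x' y' nx' ny' in auto)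
    moreover have "\<eta> \<le> \<epsilon> / 5" using q1 \<epsilon> by (simp add: \<eta>_def divide_le_eq)
    ultimately show "\<bar>(\<Sum>j<m. inner y (response x (P j \<omega>) y)) / real m - mean x y\<bar> \<le> 4 * \<epsilon>"
      using p by linarith
  qed
qed

end

section \<open>A maximal inequality for sign sums\<close>

text \<open>
  This is Hoeffding's lemma for a random sign.
\<close>

lemma cosh_le_exp: "cosh (l::real) \<le> exp (l\<^sup>2 / 2)"
proof -
  have pos: "cosh l \<le> exp (l\<^sup>2 / 2)" if "l > 0" for l :: real
  proof -
    let ?M = "measure_pmf (pmf_of_set {-1, 1::real})"
    have E: "measure_pmf.expectation (pmf_of_set {-1, 1::real}) (\<lambda>x. x) = 0"
      by (simp add: integral_pmf_of_set)
    interpret interval_bounded_random_variable ?M "\<lambda>x. x" "-1" 1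
      by unfold_locales (auto simp: AE_measure_pmf_iff)
    have "(\<integral>\<^sup>+x. ennreal (exp (l * x)) \<partial>?M) \<le> ennreal (exp (l\<^sup>2 * (1 - (-1))\<^sup>2 / 8))"
      using that E by (rule Hoeffdings_lemma_nn_integral_0)
    moreover have "(\<integral>\<^sup>+x. ennreal (exp (l * x)) \<partial>?M) = ennreal (cosh l)"
    proof -
      have "(\<integral>\<^sup>+x. ennreal (exp (l * x)) \<partial>?M) = (ennreal (exp (- l)) + ennreal (exp l)) / 2"
        by (subst nn_integral_pmf_of_set) auto
      also have "\<dots> = ennreal ((exp (- l) + exp l) / 2)"
        by (simp add: divide_ennreal[symmetric] ennreal_plus[symmetric] del: ennreal_plus)
      finally show ?thesis by (simp add: cosh_field_def add.commute)
    qed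
    ultimately show ?thesis by simp
  qed
  consider "l > 0" | "l = 0" | "- l > 0" by linarith
  then show ?thesis
  proof cases
    case 3
    then show ?thesis using pos[of "- l"] by simp
  qed (use pos in auto)
qed

definition sign_of :: "'i set \<Rightarrow> 'i \<Rightarrow> real" where
  "sign_of S j = (if j \<in> S then 1 else - 1)"

text \<open>
  The largest prefix sum of the signs of a list, the empty sum included; read from the end of the
  list it is a random walk on the natural numbers with a barrier at 0.
\<close>

fun walk_max :: "'i list \<Rightarrow> 'i set \<Rightarrow> nat" where
  "walk_max [] S = 0"
| "walk_max (j # js) S = (if j \<in> S then Suc (walk_max js S) else walk_max js S - 1)"

lemma prefix_sum_le_walk_max:
  fixes c :: "'i \<Rightarrow> real"
  assumes "sorted (map c js)" "distinct js"
  shows "(\<Sum>j | j \<in> set js \<and> c j \<le> s. sign_of S j) \<le> real (walk_max js S)"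
  using assms
proof (induction js)
  case (Cons j js)
  show ?case
  proof (cases "c j \<le> s")
    case True
    have "{i. i \<in> set (j # js) \<and> c i \<le> s} = insert j {i. i \<in> set js \<and> c i \<le> s}"
      using True by auto
    then have "(\<Sum>i | i \<in> set (j # js) \<and> c i \<le> s. sign_of S i)
        = sign_of S j + (\<Sum>i | i \<in> set js \<and> c i \<le> s. sign_of S i)"
      using Cons.prems by simp
    also have "\<dots> \<le> sign_of S j + real (walk_max js S)" using Cons by simp
    also have "\<dots> \<le> real (walk_max (j # js) S)"
      by (cases "walk_max js S") (auto simp: sign_of_def)
    finally show ?thesis .
  next
    case False
    then have "{i. i \<in> set (j # js) \<and> c i \<le> s} = {}" using Cons.prems by fastforce
    then show ?thesis by (simp only: sum.empty of_nat_0_le_iff)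
  qed
qed simp

lemma walk_max_cong: "S \<inter> set js = S' \<inter> set js \<Longrightarrow> walk_max js S = walk_max js S'"
proof (induction js)
  case (Cons j js)
  have "j \<in> S \<longleftrightarrow> j \<in> S'" "S \<inter> set js = S' \<inter> set js" using Cons.prems by auto
  then show ?case using Cons.IH by simp
qed simp

text \<open>
  For the barrier at 0, the function \<open>exp (l k) + exp (- l (k + 1))\<close> takes the same value at \<open>0\<close> and
  \<open>-1\<close>; hence it is multiplied by \<open>cosh l\<close> on average in each step, also at the barrier.
\<close>

lemma sum_walk_max:
  fixes l :: real
  assumes "distinct js"
  shows "(\<Sum>S\<in>Pow (set js). exp (l * real (walk_max js S)) + exp (- l * (real (walk_max js S) + 1)))
    = (2 * cosh l) ^ length js * (1 + exp (- l))"
  using assms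
proof (induction js)
  case (Cons j js)
  let ?f = "\<lambda>k::nat. exp (l * real k) + exp (- l * (real k + 1))"
  have step: "?f (Suc k) + ?f (k - 1) = 2 * cosh l * ?f k" for k
  proof -
    have Ee: "exp l * exp (- l) = 1" by (simp flip: exp_add)
    have c: "2 * cosh l = exp l + exp (- l)" by (simp add: cosh_field_def)
    have up: "?f (Suc k) = exp (l * real k) * exp l + exp (- l * (real k + 1)) * exp (- l)"
      by (simp add: algebra_simps flip: exp_add)
    show ?thesis
    proof (cases k)
      case 0
      then show ?thesis unfolding up c using Ee by (simp add: algebra_simps)
    next
      case (Suc i)
      have "?f (k - 1) = exp (l * real k) * exp (- l) + exp (- l * (real k + 1)) * exp l"
        by (simp add: Suc algebra_simps flip: exp_add)
      then show ?thesis unfolding up c by (simp add: algebra_simps)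
    qed
  qed
  have "Pow (set (j # js)) = Pow (set js) \<union> insert j ` Pow (set js)" by (simp add: Pow_insert)
  moreover have "Pow (set js) \<inter> insert j ` Pow (set js) = {}" using Cons.prems by auto
  moreover have "inj_on (insert j) (Pow (set js))"
    using Cons.prems by (intro inj_onI) (metis Pow_iff distinct.simps(2) insert_ident subsetD)
  ultimately have "(\<Sum>S\<in>Pow (set (j # js)). ?f (walk_max (j # js) S))
      = (\<Sum>S\<in>Pow (set js). ?f (walk_max (j # js) S)) + (\<Sum>S\<in>Pow (set js). ?f (walk_max (j # js) (insert j S)))"
    by (simp add: sum.union_disjoint sum.reindex)
  also have "(\<Sum>S\<in>Pow (set js). ?f (walk_max (j # js) S)) = (\<Sum>S\<in>Pow (set js). ?f (walk_max js S - 1))"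
  proof (rule sum.cong[OF refl])
    fix S assume "S \<in> Pow (set js)"
    then have "j \<notin> S" using Cons.prems by auto
    then show "?f (walk_max (j # js) S) = ?f (walk_max js S - 1)" by simp
  qed
  also have "(\<Sum>S\<in>Pow (set js). ?f (walk_max (j # js) (insert j S))) = (\<Sum>S\<in>Pow (set js). ?f (Suc (walk_max js S)))"
  proof (rule sum.cong[OF refl])
    fix S
    have "walk_max js (insert j S) = walk_max js S"
      using Cons.prems by (intro walk_max_cong) auto
    then show "?f (walk_max (j # js) (insert j S)) = ?f (Suc (walk_max js S))" by simp
  qed
  also have "(\<Sum>S\<in>Pow (set js). ?f (walk_max js S - 1)) + (\<Sum>S\<in>Pow (set js). ?f (Suc (walk_max js S)))
      = (\<Sum>S\<in>Pow (set js). 2 * cosh l * ?f (walk_max js S))"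
    unfolding sum.distrib[symmetric]
  proof (rule sum.cong[OF refl])
    fix S
    show "?f (walk_max js S - 1) + ?f (Suc (walk_max js S)) = 2 * cosh l * ?f (walk_max js S)"
      using step[of "walk_max js S"] by (simp only: add.commute)
  qed
  also have "\<dots> = 2 * cosh l * (\<Sum>S\<in>Pow (set js). ?f (walk_max js S))"
    by (simp only: sum_distrib_left)
  finally show ?case using Cons by simp
qed simp

text \<open>
  A sum over an interval is a difference of two prefix sums. The largest prefix sum for \<open>S\<close> bounds the
  one, and that for the complement of \<open>S\<close>, which reverses all signs, bounds the negative of the other.
\<close>

lemma sum_exp_interval_le:
  fixes c :: "'i \<Rightarrow> real" and l :: real
  assumes J: "finite J" and l: "l \<ge> 0"
  obtains W where "\<And>S a b. S \<subseteq> J \<Longrightarrow> a \<le> b \<Longrightarrow> exp (l * \<bar>\<Sum>j\<in>J. sign_of S j * indicator {a<..b} (c j)\<bar>) \<le> W S"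
    "(\<Sum>S\<in>Pow J. W S) \<le> 2 * (2 * exp (2 * l\<^sup>2)) ^ card J"
proof -
  obtain js where js: "sorted (map c js)" "distinct js" "set js = J"
  proof -
    let ?xs = "SOME xs. set xs = J \<and> distinct xs"
    have xs: "set ?xs = J \<and> distinct ?xs"
      using finite_distinct_list[OF J] by (rule someI_ex)
    show thesis by (rule that[of "sort_key c ?xs"]) (use xs in auto)
  qed
  let ?u = "\<lambda>S. real (walk_max js S)"
  define W where "W = (\<lambda>S. (exp (2 * l * ?u S) + exp (2 * l * ?u (J - S))) / 2)"
  show thesis
  proof (rule that[of W])
    fix S a b assume S: "S \<subseteq> J" and ab: "a \<le> (b::real)"
    let ?p = "\<lambda>S s. \<Sum>j | j \<in> set js \<and> c j \<le> s. sign_of S j"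
    have neg: "?p (J - S) s = - ?p S s" for s
      unfolding sum_negf[symmetric] by (rule sum.cong) (auto simp: sign_of_def js)
    have p: "\<bar>?p S b - ?p S a\<bar> \<le> ?u S + ?u (J - S)"
      using prefix_sum_le_walk_max[OF js(1,2), where S=S and s=a] prefix_sum_le_walk_max[OF js(1,2), where S=S and s=b]
        prefix_sum_le_walk_max[OF js(1,2), where S="J - S" and s=a]
        prefix_sum_le_walk_max[OF js(1,2), where S="J - S" and s=b]
      unfolding neg by linarith
    have "(\<Sum>j\<in>J. sign_of S j * indicator {a<..b} (c j)) = (\<Sum>j | j \<in> J \<and> a < c j \<and> c j \<le> b. sign_of S j)"
      using J by (intro sum.mono_neutral_cong_right) (auto simp: indicator_def)
    also have "{j. j \<in> J \<and> a < c j \<and> c j \<le> b} = {j. j \<in> set js \<and> c j \<le> b} - {j. j \<in> set js \<and> c j \<le> a}"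
      using js(3) by auto
    also have "sum (sign_of S) \<dots> = ?p S b - ?p S a" using ab by (intro sum_diff) auto
    finally have "\<bar>\<Sum>j\<in>J. sign_of S j * indicator {a<..b} (c j)\<bar> \<le> ?u S + ?u (J - S)" using p by simp
    then have "exp (l * \<bar>\<Sum>j\<in>J. sign_of S j * indicator {a<..b} (c j)\<bar>) \<le> exp (l * (?u S + ?u (J - S)))"
      using l by (simp add: mult_left_mono)
    also have "\<dots> = exp (l * ?u S) * exp (l * ?u (J - S))" by (simp add: distrib_left exp_add)
    also have "\<dots> \<le> ((exp (l * ?u S))\<^sup>2 + (exp (l * ?u (J - S)))\<^sup>2) / 2"
      using sum_squares_bound[of "exp (l * ?u S)" "exp (l * ?u (J - S))"] by simp
    also have "\<dots> = W S"
    proof -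
      have "(exp (l * v))\<^sup>2 = exp (2 * l * v)" for v by (simp add: mult.assoc flip: exp_double)
      then show ?thesis by (simp only: W_def)
    qed
    finally show "exp (l * \<bar>\<Sum>j\<in>J. sign_of S j * indicator {a<..b} (c j)\<bar>) \<le> W S" .
  next
    have compl: "(\<Sum>S\<in>Pow J. exp (2 * l * ?u (J - S))) = (\<Sum>S\<in>Pow J. exp (2 * l * ?u S))"
      by (rule sum.reindex_bij_witness[of _ "\<lambda>S. J - S" "\<lambda>S. J - S"]) (auto simp: double_diff)
    have "(\<Sum>S\<in>Pow J. W S) = (\<Sum>S\<in>Pow J. exp (2 * l * ?u S))"
      unfolding W_def sum_divide_distrib[symmetric] sum.distrib compl by simp
    also have "\<dots> \<le> (\<Sum>S\<in>Pow (set js). exp (2 * l * ?u S) + exp (- (2 * l) * (?u S + 1)))"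
      unfolding js(3) by (intro sum_mono) simp
    also have "\<dots> = (2 * cosh (2 * l)) ^ length js * (1 + exp (- (2 * l)))"
      by (rule sum_walk_max[OF js(2)])
    also have "\<dots> \<le> (2 * exp (2 * l\<^sup>2)) ^ length js * 2"
    proof -
      have 1: "2 * cosh (2 * l) \<le> 2 * exp (2 * l\<^sup>2)"
        using cosh_le_exp[of "2 * l"] by (simp add: power_mult_distrib)
      have 2: "1 + exp (- (2 * l)) \<le> 2" using l by simp
      show ?thesis by (rule mult_mono[OF power_mono[OF 1] 2]) auto
    qed
    also have "length js = card J" using js by (metis distinct_card)
    finally show "(\<Sum>S\<in>Pow J. W S) \<le> 2 * (2 * exp (2 * l\<^sup>2)) ^ card J" by (simp add: mult.commute)
  qed
qed

section \<open>Symmetrization\<close>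

text \<open>
  Centring a bounded variable costs no more than doubling it with a random sign: by convexity
  \<open>b + h - e\<close> is the midpoint of \<open>b + 2 h\<close> and \<open>b - 2 e\<close>, and Jensen's inequality replaces \<open>e\<close> by the
  variable.
\<close>

lemma (in prob_space) exp_abs_symmetrize:
  fixes h :: "'a \<Rightarrow> real"
  assumes h [measurable]: "h \<in> borel_measurable M" and h01: "\<And>y. 0 \<le> h y \<and> h y \<le> 1" and t: "t \<ge> 0"
  shows "exp (t * \<bar>b - 2 * expectation h\<bar>) \<le> expectation (\<lambda>y. exp (t * \<bar>b - 2 * h y\<bar>))"
proof -
  define r where "r = (if b - 2 * expectation h \<ge> 0 then t else - t)"
  let ?u = "\<lambda>y. r * (b - 2 * h y)"
  define u0 where "u0 = r * (b - 2 * expectation h)"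
  have int_h: "integrable M h"
    using h01 by (intro integrable_const_bound[of _ 1]) auto
  have u0: "expectation ?u = u0" using int_h by (simp add: u0_def prob_space)
  have "exp (t * \<bar>b - 2 * h y\<bar>) \<le> exp (t * (\<bar>b\<bar> + 2))" for y
    using t h01[of y] by (auto intro!: mult_left_mono)
  then have int: "integrable M (\<lambda>y. exp (t * \<bar>b - 2 * h y\<bar>))"
    by (intro integrable_const_bound[of _ "exp (t * (\<bar>b\<bar> + 2))"]) auto
  have "exp (t * \<bar>b - 2 * expectation h\<bar>) = exp u0 * (1 + (expectation ?u - u0))"
  proof -
    have "u0 = t * \<bar>b - 2 * expectation h\<bar>"
      by (cases "b - 2 * expectation h \<ge> 0") (simp_all add: u0_def r_def algebra_simps)
    then show ?thesis unfolding u0 by simp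
  qed
  also have "\<dots> = expectation (\<lambda>y. exp u0 * (1 + (?u y - u0)))"
    using int_h by (simp add: prob_space)
  also have "\<dots> \<le> expectation (\<lambda>y. exp (t * \<bar>b - 2 * h y\<bar>))"
  proof (rule integral_mono[OF _ int])
    show "integrable M (\<lambda>y. exp u0 * (1 + (?u y - u0)))" using int_h by simp
    fix y
    have "exp u0 * (1 + (?u y - u0)) \<le> exp u0 * exp (?u y - u0)"
      using exp_ge_add_one_self by (intro mult_left_mono) auto
    also have "\<dots> = exp (?u y)" by (simp flip: exp_add)
    also have "?u y \<le> t * \<bar>b - 2 * h y\<bar>"
    proof -
      have "b - 2 * h y \<le> \<bar>b - 2 * h y\<bar>" "- (b - 2 * h y) \<le> \<bar>b - 2 * h y\<bar>" by simp_all
      then have "t * (b - 2 * h y) \<le> t * \<bar>b - 2 * h y\<bar>" "t * - (b - 2 * h y) \<le> t * \<bar>b - 2 * h y\<bar>"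
        using t by (intro mult_left_mono; simp)+
      then show ?thesis unfolding r_def by (auto simp only: mult_minus_left mult_minus_right split: if_split)
    qed
    then have "exp (?u y) \<le> exp (t * \<bar>b - 2 * h y\<bar>)" by simp
    finally show "exp u0 * (1 + (?u y - u0)) \<le> exp (t * \<bar>b - 2 * h y\<bar>)" .
  qed
  finally show ?thesis .
qed

text \<open>
  As a supremum of convex functions of \<open>a\<close> this is convex, which is what symmetrization exploits.
\<close>

definition exp_sup :: "real \<Rightarrow> 's set \<Rightarrow> ('s \<Rightarrow> real) \<Rightarrow> ennreal" where
  "exp_sup t T a = (SUP s\<in>T. ennreal (exp (t * \<bar>a s\<bar>)))"

lemma exp_sup_measurable:
  assumes "countable T" "\<And>s. s \<in> T \<Longrightarrow> (\<lambda>x. f x s) \<in> borel_measurable M"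
  shows "(\<lambda>x. exp_sup t T (f x)) \<in> borel_measurable M"
  unfolding exp_sup_def using assms by (intro borel_measurable_SUP) auto

lemma (in prob_space) exp_sup_symmetrize:
  fixes h :: "'s \<Rightarrow> 'a \<Rightarrow> real"
  assumes T: "countable T" and h: "\<And>s. s \<in> T \<Longrightarrow> h s \<in> borel_measurable M"
    and h01: "\<And>s y. s \<in> T \<Longrightarrow> 0 \<le> h s y \<and> h s y \<le> 1" and t: "t \<ge> 0"
  shows "(\<integral>\<^sup>+y. exp_sup t T (\<lambda>s. b s + (h s y - expectation (h s))) \<partial>M)
    \<le> (\<integral>\<^sup>+y. ennreal (1/2) * (exp_sup t T (\<lambda>s. b s + 2 * h s y) + exp_sup t T (\<lambda>s. b s - 2 * h s y)) \<partial>M)"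
proof -
  let ?neg = "\<integral>\<^sup>+y. exp_sup t T (\<lambda>s. b s - 2 * h s y) \<partial>M"
  have m1: "(\<lambda>y. exp_sup t T (\<lambda>s. b s + 2 * h s y)) \<in> borel_measurable M"
    and m2: "(\<lambda>y. exp_sup t T (\<lambda>s. b s - 2 * h s y)) \<in> borel_measurable M"
    using h by (auto intro!: exp_sup_measurable[OF T])
  have neg: "ennreal (exp (t * \<bar>b s - 2 * expectation (h s)\<bar>)) \<le> ?neg" if s: "s \<in> T" for s
  proof -
    have [measurable]: "h s \<in> borel_measurable M" using h[OF s] .
    have "exp (t * \<bar>b s - 2 * h s y\<bar>) \<le> exp (t * (\<bar>b s\<bar> + 2))" for y
      using t h01[OF s, of y] by (auto intro!: mult_left_mono)
    then have "integrable M (\<lambda>y. exp (t * \<bar>b s - 2 * h s y\<bar>))"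
      by (intro integrable_const_bound[of _ "exp (t * (\<bar>b s\<bar> + 2))"]) auto
    then have "ennreal (expectation (\<lambda>y. exp (t * \<bar>b s - 2 * h s y\<bar>))) = (\<integral>\<^sup>+y. ennreal (exp (t * \<bar>b s - 2 * h s y\<bar>)) \<partial>M)"
      by (intro nn_integral_eq_integral[symmetric]) auto
    also have "\<dots> \<le> ?neg"
      unfolding exp_sup_def using s by (intro nn_integral_mono SUP_upper)
    finally show ?thesis
      using exp_abs_symmetrize[OF h[OF s] h01[OF s] t, of "b s"] by (meson ennreal_leI order_trans)
  qed
  have "exp_sup t T (\<lambda>s. b s + (h s y - expectation (h s)))
      \<le> ennreal (1/2) * (exp_sup t T (\<lambda>s. b s + 2 * h s y) + ?neg)" for y
    unfolding exp_sup_def[of t T "\<lambda>s. b s + (h s y - expectation (h s))"]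
  proof (rule SUP_least)
    fix s assume s: "s \<in> T"
    let ?a = "b s + 2 * h s y" and ?c = "b s - 2 * expectation (h s)"
    have "\<bar>b s + (h s y - expectation (h s))\<bar> \<le> \<bar>?a\<bar> / 2 + \<bar>?c\<bar> / 2"
    proof -
      have "\<bar>u + (v - w)\<bar> \<le> \<bar>u + 2 * v\<bar> / 2 + \<bar>u - 2 * w\<bar> / 2" for u v w :: real
      proof -
        have "u + (v - w) = (u + 2 * v) / 2 + (u - 2 * w) / 2" by (simp add: field_simps)
        then show ?thesis using abs_triangle_ineq[of "(u + 2 * v) / 2" "(u - 2 * w) / 2"] by simp
      qed
      then show ?thesis .
    qed
    then have "exp (t * \<bar>b s + (h s y - expectation (h s))\<bar>) \<le> exp (t * (\<bar>?a\<bar> / 2 + \<bar>?c\<bar> / 2))"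
      using t by (simp add: mult_left_mono)
    also have "\<dots> = exp (t * \<bar>?a\<bar> / 2) * exp (t * \<bar>?c\<bar> / 2)"
      by (simp add: distrib_left flip: exp_add)
    also have "\<dots> \<le> ((exp (t * \<bar>?a\<bar> / 2))\<^sup>2 + (exp (t * \<bar>?c\<bar> / 2))\<^sup>2) / 2"
      using sum_squares_bound[of "exp (t * \<bar>?a\<bar> / 2)" "exp (t * \<bar>?c\<bar> / 2)"] by simp
    also have "\<dots> = 1/2 * (exp (t * \<bar>?a\<bar>) + exp (t * \<bar>?c\<bar>))"
      by (simp add: power2_eq_square flip: exp_add)
    finally have le: "exp (t * \<bar>b s + (h s y - expectation (h s))\<bar>) \<le> 1/2 * (exp (t * \<bar>?a\<bar>) + exp (t * \<bar>?c\<bar>))" .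
    have "ennreal (exp (t * \<bar>b s + (h s y - expectation (h s))\<bar>))
        \<le> ennreal (1/2) * (ennreal (exp (t * \<bar>?a\<bar>)) + ennreal (exp (t * \<bar>?c\<bar>)))"
    proof -
      have "ennreal (exp (t * \<bar>b s + (h s y - expectation (h s))\<bar>))
          \<le> ennreal (1/2 * (exp (t * \<bar>?a\<bar>) + exp (t * \<bar>?c\<bar>)))" using le by (rule ennreal_leI)
      also have "\<dots> = ennreal (1/2) * ennreal (exp (t * \<bar>?a\<bar>) + exp (t * \<bar>?c\<bar>))"
        by (rule ennreal_mult) auto
      also have "ennreal (exp (t * \<bar>?a\<bar>) + exp (t * \<bar>?c\<bar>)) = ennreal (exp (t * \<bar>?a\<bar>)) + ennreal (exp (t * \<bar>?c\<bar>))"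
        by (rule ennreal_plus) auto
      finally show ?thesis .
    qed
    also have "\<dots> \<le> ennreal (1/2) * (exp_sup t T (\<lambda>s. b s + 2 * h s y) + ?neg)"
      using neg[OF s] s unfolding exp_sup_def[of t T "\<lambda>s. b s + 2 * h s y"]
      by (intro mult_left_mono add_mono SUP_upper) auto
    finally show "ennreal (exp (t * \<bar>b s + (h s y - expectation (h s))\<bar>))
        \<le> ennreal (1/2) * (exp_sup t T (\<lambda>s. b s + 2 * h s y) + ?neg)" .
  qed
  then have "(\<integral>\<^sup>+y. exp_sup t T (\<lambda>s. b s + (h s y - expectation (h s))) \<partial>M)
      \<le> (\<integral>\<^sup>+y. ennreal (1/2) * (exp_sup t T (\<lambda>s. b s + 2 * h s y) + ?neg) \<partial>M)"
    by (intro nn_integral_mono)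
  also have "\<dots> = ennreal (1/2) * ((\<integral>\<^sup>+y. exp_sup t T (\<lambda>s. b s + 2 * h s y) \<partial>M) + ?neg)"
    using m1 by (simp add: nn_integral_cmult nn_integral_add emeasure_space_1)
  also have "\<dots> = (\<integral>\<^sup>+y. ennreal (1/2) * (exp_sup t T (\<lambda>s. b s + 2 * h s y) + exp_sup t T (\<lambda>s. b s - 2 * h s y)) \<partial>M)"
    using m1 m2 by (simp add: nn_integral_cmult nn_integral_add)
  finally show ?thesis .
qed

text \<open>
  The coordinates are treated one at a time, with the others absorbed into the offset \<open>b\<close>. The average
  over all random signs is a sum over the sets \<open>S\<close> of coordinates with a positive sign.
\<close>

lemma product_symmetrize:
  fixes h :: "'s \<Rightarrow> 'b \<Rightarrow> real" and N :: "'i \<Rightarrow> 'b measure"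
  assumes J: "finite J" and N: "\<And>j. prob_space (N j)" and T: "countable T"
    and h: "\<And>s j. s \<in> T \<Longrightarrow> h s \<in> borel_measurable (N j)"
    and h01: "\<And>s y. s \<in> T \<Longrightarrow> 0 \<le> h s y \<and> h s y \<le> 1" and t: "t \<ge> 0"
  shows "(\<integral>\<^sup>+x. exp_sup t T (\<lambda>s. b s + (\<Sum>j\<in>J. h s (x j) - (LINT y|N j. h s y))) \<partial>Pi\<^sub>M J N)
    \<le> ennreal ((1/2) ^ card J) * (\<Sum>S\<in>Pow J. \<integral>\<^sup>+x. exp_sup t T (\<lambda>s. b s + 2 * (\<Sum>j\<in>J. sign_of S j * h s (x j))) \<partial>Pi\<^sub>M J N)"
  using J
proof (induction J arbitrary: b rule: finite_induct)
  case empty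
  show ?case by simp
next
  case (insert i J)
  interpret product_sigma_finite N
    by (simp add: product_sigma_finite_def prob_space_imp_sigma_finite N)
  interpret Ni: prob_space "N i" by (rule N)
  let ?e = "\<lambda>s j. LINT y|N j. h s y"
  have comp: "(\<lambda>x. h s (x j)) \<in> borel_measurable (Pi\<^sub>M J' N)" if "s \<in> T" "j \<in> J'" for s j J'
    using measurable_compose[OF measurable_component_singleton[OF that(2)] h[OF that(1)]] .
  let ?F = "\<lambda>x. exp_sup t T (\<lambda>s. b s + (\<Sum>j\<in>insert i J. h s (x j) - ?e s j))"
  let ?G = "\<lambda>r x. exp_sup t T (\<lambda>s. (b s + r * (2 * h s (x i))) + (\<Sum>j\<in>J. h s (x j) - ?e s j))"
  have mF: "?F \<in> borel_measurable (Pi\<^sub>M (insert i J) N)"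
    by (intro exp_sup_measurable[OF T] borel_measurable_add borel_measurable_const borel_measurable_sum
        borel_measurable_diff comp) auto
  have mG: "?G r \<in> borel_measurable (Pi\<^sub>M (insert i J) N)" for r
    by (intro exp_sup_measurable[OF T] borel_measurable_add borel_measurable_const borel_measurable_sum
        borel_measurable_diff borel_measurable_times comp) auto
  have sumJ: "(\<Sum>j\<in>J. h s ((x(i := y)) j) - ?e s j) = (\<Sum>j\<in>J. h s (x j) - ?e s j)" for s x y
    using insert.hyps by (intro sum.cong) auto
  have bnd: "(\<integral>\<^sup>+x. ?G r x \<partial>Pi\<^sub>M (insert i J) N) \<le> ennreal ((1/2) ^ card J) *
      (\<Sum>S\<in>Pow J. \<integral>\<^sup>+x. exp_sup t T (\<lambda>s. b s + 2 * (r * h s (x i) + (\<Sum>j\<in>J. sign_of S j * h s (x j)))) \<partial>Pi\<^sub>M (insert i J) N)"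
    (is "_ \<le> _ * (\<Sum>S\<in>Pow J. integral\<^sup>N _ (?H r S))") for r
  proof -
    have mH: "?H r S \<in> borel_measurable (Pi\<^sub>M (insert i J) N)" for S
      by (intro exp_sup_measurable[OF T] borel_measurable_add borel_measurable_const borel_measurable_sum
          borel_measurable_times comp) auto
    have sumS: "(\<Sum>j\<in>J. sign_of S j * h s ((x(i := y)) j)) = (\<Sum>j\<in>J. sign_of S j * h s (x j))" for s x y S
      using insert.hyps by (intro sum.cong) auto
    have "(\<integral>\<^sup>+x. ?G r x \<partial>Pi\<^sub>M (insert i J) N) = (\<integral>\<^sup>+y. \<integral>\<^sup>+x. ?G r (x(i := y)) \<partial>Pi\<^sub>M J N \<partial>N i)"
      by (rule product_nn_integral_insert_rev[OF insert.hyps(1,2) mG])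
    also have "\<dots> \<le> (\<integral>\<^sup>+y. ennreal ((1/2) ^ card J) * (\<Sum>S\<in>Pow J. \<integral>\<^sup>+x. ?H r S (x(i := y)) \<partial>Pi\<^sub>M J N) \<partial>N i)"
    proof (rule nn_integral_mono)
      fix y
      show "(\<integral>\<^sup>+x. ?G r (x(i := y)) \<partial>Pi\<^sub>M J N)
          \<le> ennreal ((1/2) ^ card J) * (\<Sum>S\<in>Pow J. \<integral>\<^sup>+x. ?H r S (x(i := y)) \<partial>Pi\<^sub>M J N)"
      proof -
        have "?G r (x(i := y)) = exp_sup t T (\<lambda>s. (b s + r * (2 * h s y)) + (\<Sum>j\<in>J. h s (x j) - ?e s j))" for x
          by (simp only: sumJ fun_upd_same)
        moreover have "?H r S (x(i := y))
            = exp_sup t T (\<lambda>s. (b s + r * (2 * h s y)) + 2 * (\<Sum>j\<in>J. sign_of S j * h s (x j)))" for x S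
          unfolding sumS fun_upd_same by (simp add: algebra_simps)
        ultimately show ?thesis using insert.IH[of "\<lambda>s. b s + r * (2 * h s y)"] by simp
      qed
    qed
    also have "\<dots> = ennreal ((1/2) ^ card J) * (\<Sum>S\<in>Pow J. \<integral>\<^sup>+y. \<integral>\<^sup>+x. ?H r S (x(i := y)) \<partial>Pi\<^sub>M J N \<partial>N i)"
    proof -
      have "(\<lambda>y. \<integral>\<^sup>+x. ?H r S (x(i := y)) \<partial>Pi\<^sub>M J N) \<in> borel_measurable (N i)" for S
      proof -
        have "(\<lambda>p. ?H r S ((snd p)(i := fst p))) \<in> borel_measurable (N i \<Otimes>\<^sub>M Pi\<^sub>M J N)"
          by (rule measurable_compose[OF _ mH]) measurable
        then show ?thesis
          by (intro sigma_finite_measure.borel_measurable_nn_integral[OF sigma_finite[OF insert.hyps(1)]])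
            (simp add: case_prod_unfold)
      qed
      then show ?thesis by (simp only: nn_integral_cmult nn_integral_sum borel_measurable_sum)
    qed
    also have "(\<Sum>S\<in>Pow J. \<integral>\<^sup>+y. \<integral>\<^sup>+x. ?H r S (x(i := y)) \<partial>Pi\<^sub>M J N \<partial>N i) = (\<Sum>S\<in>Pow J. \<integral>\<^sup>+x. ?H r S x \<partial>Pi\<^sub>M (insert i J) N)"
      by (intro sum.cong refl product_nn_integral_insert_rev[OF insert.hyps(1,2) mH, symmetric])
    finally show ?thesis .
  qed
  have "(\<integral>\<^sup>+x. ?F x \<partial>Pi\<^sub>M (insert i J) N) = (\<integral>\<^sup>+x. \<integral>\<^sup>+y. ?F (x(i := y)) \<partial>N i \<partial>Pi\<^sub>M J N)"
    by (rule product_nn_integral_insert[OF insert.hyps(1,2) mF])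
  also have "\<dots> \<le> (\<integral>\<^sup>+x. \<integral>\<^sup>+y. ennreal (1/2) * (?G 1 (x(i := y)) + ?G (-1) (x(i := y))) \<partial>N i \<partial>Pi\<^sub>M J N)"
  proof (rule nn_integral_mono)
    fix x
    let ?b = "\<lambda>s. b s + (\<Sum>j\<in>J. h s (x j) - ?e s j)"
    have "?F (x(i := y)) = exp_sup t T (\<lambda>s. ?b s + (h s y - ?e s i))" for y
      unfolding sum.insert[OF insert.hyps(1,2)] sumJ fun_upd_same by (simp add: algebra_simps)
    moreover have "?G 1 (x(i := y)) = exp_sup t T (\<lambda>s. ?b s + 2 * h s y)"
      "?G (-1) (x(i := y)) = exp_sup t T (\<lambda>s. ?b s - 2 * h s y)" for y
      unfolding sumJ fun_upd_same by (simp_all add: algebra_simps)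
    ultimately show "(\<integral>\<^sup>+y. ?F (x(i := y)) \<partial>N i) \<le> (\<integral>\<^sup>+y. ennreal (1/2) * (?G 1 (x(i := y)) + ?G (-1) (x(i := y))) \<partial>N i)"
      using Ni.exp_sup_symmetrize[OF T h h01 t, where b = ?b] by simp
  qed
  also have "\<dots> = (\<integral>\<^sup>+x. ennreal (1/2) * (?G 1 x + ?G (-1) x) \<partial>Pi\<^sub>M (insert i J) N)"
    by (rule product_nn_integral_insert[OF insert.hyps(1,2), symmetric])
      (intro borel_measurable_times_ennreal borel_measurable_add borel_measurable_const mG)
  also have "\<dots> = ennreal (1/2) * ((\<integral>\<^sup>+x. ?G 1 x \<partial>Pi\<^sub>M (insert i J) N) + (\<integral>\<^sup>+x. ?G (-1) x \<partial>Pi\<^sub>M (insert i J) N))"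
    using mG by (simp only: nn_integral_cmult nn_integral_add borel_measurable_add)
  also have "\<dots> \<le> ennreal (1/2) *
      (ennreal ((1/2) ^ card J) * (\<Sum>S\<in>Pow J. integral\<^sup>N (Pi\<^sub>M (insert i J) N) (?H 1 S))
      + ennreal ((1/2) ^ card J) * (\<Sum>S\<in>Pow J. integral\<^sup>N (Pi\<^sub>M (insert i J) N) (?H (-1) S)))"
    by (intro mult_left_mono add_mono bnd) auto
  finally have main: "(\<integral>\<^sup>+x. ?F x \<partial>Pi\<^sub>M (insert i J) N) \<le> \<dots>" .
  let ?K = "\<lambda>S x. exp_sup t T (\<lambda>s. b s + 2 * (\<Sum>j\<in>insert i J. sign_of S j * h s (x j)))"
  have K1: "?K (Set.insert i S) x = ?H 1 S x" and K2: "?K S x = ?H (-1) S x" if "S \<in> Pow J" for S x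
  proof -
    have "i \<notin> S" using that insert.hyps by auto
    moreover have "(\<Sum>j\<in>J. sign_of (Set.insert i S) j * h s (x j)) = (\<Sum>j\<in>J. sign_of S j * h s (x j))" for s
      using insert.hyps by (intro sum.cong) (auto simp: sign_of_def)
    ultimately show "?K (Set.insert i S) x = ?H 1 S x" "?K S x = ?H (-1) S x"
      using insert.hyps by (simp_all add: sign_of_def)
  qed
  have "Pow (Set.insert i J) = Pow J \<union> Set.insert i ` Pow J" by (simp add: Pow_insert)
  moreover have "Pow J \<inter> Set.insert i ` Pow J = {}" using insert.hyps by auto
  moreover have "inj_on (Set.insert i) (Pow J)"
    using insert.hyps by (intro inj_onI) (metis Pow_iff insert_ident subsetD)
  ultimately have "(\<Sum>S\<in>Pow (Set.insert i J). integral\<^sup>N (Pi\<^sub>M (insert i J) N) (?K S))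
      = (\<Sum>S\<in>Pow J. integral\<^sup>N (Pi\<^sub>M (insert i J) N) (?K S))
        + (\<Sum>S\<in>Pow J. integral\<^sup>N (Pi\<^sub>M (insert i J) N) (?K (Set.insert i S)))"
    using insert.hyps by (simp add: sum.union_disjoint sum.reindex)
  also have "(\<Sum>S\<in>Pow J. integral\<^sup>N (Pi\<^sub>M (insert i J) N) (?K S))
      = (\<Sum>S\<in>Pow J. integral\<^sup>N (Pi\<^sub>M (insert i J) N) (?H (-1) S))"
    by (intro sum.cong refl nn_integral_cong K2)
  also have "(\<Sum>S\<in>Pow J. integral\<^sup>N (Pi\<^sub>M (insert i J) N) (?K (Set.insert i S)))
      = (\<Sum>S\<in>Pow J. integral\<^sup>N (Pi\<^sub>M (insert i J) N) (?H 1 S))"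
    by (intro sum.cong refl nn_integral_cong K1)
  finally have sum: "(\<Sum>S\<in>Pow (Set.insert i J). integral\<^sup>N (Pi\<^sub>M (insert i J) N) (?K S))
      = (\<Sum>S\<in>Pow J. integral\<^sup>N (Pi\<^sub>M (insert i J) N) (?H (-1) S))
        + (\<Sum>S\<in>Pow J. integral\<^sup>N (Pi\<^sub>M (insert i J) N) (?H 1 S))" .
  have pow: "ennreal ((1/2) ^ card (Set.insert i J)) = ennreal (1/2) * ennreal ((1/2) ^ card J)"
    unfolding card_insert_disjoint[OF insert.hyps(1,2)] power_Suc by (rule ennreal_mult) auto
  show ?case
    using main unfolding sum pow by (simp add: algebra_simps)
qed


section \<open>Uniform deviations over intervals\<close>

text \<open>
  The parameter \<open>\<epsilon> / 4\<close> optimizes the exponential moment; in contrast to a union bound over a net,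
  no factor depending on \<open>\<epsilon>\<close> appears in front of the exponential.
\<close>

theorem (in prob_space) interval_deviation:
  fixes Y :: "nat \<Rightarrow> 'a \<Rightarrow> real" and T :: "(real \<times> real) set"
  assumes m: "m \<ge> 1" and indep: "indep_vars (\<lambda>_. borel) Y {..<m}" and T: "countable T"
    and T_le: "\<And>s. s \<in> T \<Longrightarrow> fst s \<le> snd s" and \<epsilon>: "\<epsilon> > 0"
  shows "{\<omega> \<in> space M. \<exists>s\<in>T. \<bar>\<Sum>j<m. indicator {fst s<..snd s} (Y j \<omega>)
        - expectation (\<lambda>\<omega>. indicator {fst s<..snd s} (Y j \<omega>))\<bar> > 4 * \<epsilon> * real m} \<in> events" (is "?bad \<in> _")
    and "prob {\<omega> \<in> space M. \<exists>s\<in>T. \<bar>\<Sum>j<m. indicator {fst s<..snd s} (Y j \<omega>)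
        - expectation (\<lambda>\<omega>. indicator {fst s<..snd s} (Y j \<omega>))\<bar> > 4 * \<epsilon> * real m}
      \<le> 2 * exp (- real m * \<epsilon>\<^sup>2 / 2)"
proof -
  define t where "t = \<epsilon> / 4"
  have t: "t \<ge> 0" using \<epsilon> by (simp add: t_def)
  define h where "h = (\<lambda>(s::real \<times> real) y. indicator {fst s<..snd s} y :: real)"
  have h_meas [measurable]: "h s \<in> borel_measurable borel" for s by (simp add: h_def)
  have rv [measurable]: "random_variable borel (Y j)" if "j < m" for j
    using indep that by (auto simp: indep_vars_def)
  define N where "N = (\<lambda>j. if j < m then distr M borel (Y j) else return borel 0)"
  have N: "prob_space (N j)" for j
    using rv by (auto simp: N_def intro: prob_space_distr prob_space_return)
  have hN: "h s \<in> borel_measurable (N j)" for s j by (simp add: N_def h_def)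
  define e where "e = (\<lambda>s j. expectation (\<lambda>\<omega>. h s (Y j \<omega>)))"
  have eN: "(LINT y|N j. h s y) = e s j" if "j < m" for s j
    using rv[OF that] that by (simp add: N_def e_def integral_distr)
  let ?D = "\<lambda>\<omega> s. \<Sum>j<m. h s (Y j \<omega>) - e s j"
  let ?U = "\<lambda>\<omega>. exp_sup t T (?D \<omega>)"
  have D_meas [measurable]: "(\<lambda>\<omega>. ?D \<omega> s) \<in> borel_measurable M" for s
    by (intro borel_measurable_sum borel_measurable_diff borel_measurable_const)
      (auto intro: measurable_compose[OF rv h_meas])
  have U_meas: "?U \<in> borel_measurable M" by (intro exp_sup_measurable[OF T] D_meas)
  have bad_eq: "?bad = (\<Union>s\<in>T. {\<omega> \<in> space M. \<bar>?D \<omega> s\<bar> > 4 * \<epsilon> * real m})"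
    by (auto simp: h_def e_def)
  show bad: "?bad \<in> events"
    unfolding bad_eq
  proof (intro sets.countable_UN' T image_subsetI)
    fix s
    have "(\<lambda>\<omega>. \<bar>?D \<omega> s\<bar>) \<in> borel_measurable M" by (intro borel_measurable_abs D_meas)
    then show "{\<omega> \<in> space M. \<bar>?D \<omega> s\<bar> > 4 * \<epsilon> * real m} \<in> events"
      unfolding borel_measurable_iff_greater by blast
  qed
  have joint: "distr M (Pi\<^sub>M {..<m} (\<lambda>_. borel)) (\<lambda>\<omega>. \<lambda>j\<in>{..<m}. Y j \<omega>) = Pi\<^sub>M {..<m} N"
  proof -
    have "distr M (Pi\<^sub>M {..<m} (\<lambda>_. borel)) (\<lambda>\<omega>. \<lambda>j\<in>{..<m}. Y j \<omega>) = Pi\<^sub>M {..<m} (\<lambda>j. distr M borel (Y j))"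
      using indep_vars_iff_distr_eq_PiM'[where I="{..<m}" and M'="\<lambda>_. borel" and X=Y] indep rv m by (auto simp: lessThan_empty_iff)
    also have "\<dots> = Pi\<^sub>M {..<m} N" by (intro PiM_cong) (auto simp: N_def)
    finally show ?thesis .
  qed
  have sets_eq: "sets (Pi\<^sub>M {..<m} N) = sets (Pi\<^sub>M {..<m} (\<lambda>_. borel))"
    by (intro sets_PiM_cong) (auto simp: N_def)
  have comp: "(\<lambda>x. h s (x j)) \<in> borel_measurable (Pi\<^sub>M {..<m} (\<lambda>_. borel))" if "j < m" for s j
  proof -
    have "(\<lambda>x. x j) \<in> Pi\<^sub>M {..<m} (\<lambda>_. borel) \<rightarrow>\<^sub>M (borel :: real measure)"
      using measurable_component_singleton[of j "{..<m}" "\<lambda>_. borel"] that by simp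
    then show ?thesis by (rule measurable_compose[OF _ h_meas])
  qed
  let ?V = "\<lambda>S x. exp_sup t T (\<lambda>s. 0 + 2 * (\<Sum>j<m. sign_of S j * h s (x j)))"
  have V_meas: "?V S \<in> borel_measurable (Pi\<^sub>M {..<m} N)" for S
    unfolding measurable_cong_sets[OF sets_eq refl]
    by (intro exp_sup_measurable[OF T] borel_measurable_add borel_measurable_times
        borel_measurable_sum borel_measurable_const comp) auto
  interpret Pi: prob_space "Pi\<^sub>M {..<m} N" using N by (intro prob_space_PiM)
  have "(\<integral>\<^sup>+\<omega>. ?U \<omega> \<partial>M) = (\<integral>\<^sup>+x. exp_sup t T (\<lambda>s. 0 + (\<Sum>j<m. h s (x j) - e s j)) \<partial>Pi\<^sub>M {..<m} N)"
    unfolding joint[symmetric]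
  proof (subst nn_integral_distr)
    show "(\<lambda>\<omega>. \<lambda>j\<in>{..<m}. Y j \<omega>) \<in> M \<rightarrow>\<^sub>M Pi\<^sub>M {..<m} (\<lambda>_. borel)"
      by (intro measurable_restrict) (auto intro: rv)
    show "(\<lambda>x. exp_sup t T (\<lambda>s. 0 + (\<Sum>j<m. h s (x j) - e s j)))
        \<in> borel_measurable (distr M (Pi\<^sub>M {..<m} (\<lambda>_. borel)) (\<lambda>\<omega>. \<lambda>j\<in>{..<m}. Y j \<omega>))"
      unfolding measurable_distr_eq1
      by (intro exp_sup_measurable[OF T] borel_measurable_add borel_measurable_diff
        borel_measurable_sum borel_measurable_const comp) auto
  qed simp
  also have "\<dots> = (\<integral>\<^sup>+x. exp_sup t T (\<lambda>s. 0 + (\<Sum>j<m. h s (x j) - (LINT y|N j. h s y))) \<partial>Pi\<^sub>M {..<m} N)"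
    by (simp add: eN)
  also have "\<dots> \<le> ennreal ((1/2) ^ card {..<m}) * (\<Sum>S\<in>Pow {..<m}. integral\<^sup>N (Pi\<^sub>M {..<m} N) (?V S))"
    by (rule product_symmetrize[OF _ N T hN _ t]) (auto simp: h_def indicator_def)
  also have "(\<Sum>S\<in>Pow {..<m}. integral\<^sup>N (Pi\<^sub>M {..<m} N) (?V S)) = (\<integral>\<^sup>+x. (\<Sum>S\<in>Pow {..<m}. ?V S x) \<partial>Pi\<^sub>M {..<m} N)"
    by (rule nn_integral_sum[symmetric]) (rule V_meas)
  also have "\<dots> \<le> (\<integral>\<^sup>+x. ennreal (2 * (2 * exp (2 * (2 * t)\<^sup>2)) ^ m) \<partial>Pi\<^sub>M {..<m} N)"
  proof (rule nn_integral_mono)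
    fix x :: "nat \<Rightarrow> real"
    have "2 * t \<ge> 0" using t by simp
    then obtain W where W: "\<And>S a b. S \<subseteq> {..<m} \<Longrightarrow> a \<le> b \<Longrightarrow>
          exp (2 * t * \<bar>\<Sum>j<m. sign_of S j * indicator {a<..b} (x j)\<bar>) \<le> W S"
        "(\<Sum>S\<in>Pow {..<m}. W S) \<le> 2 * (2 * exp (2 * (2 * t)\<^sup>2)) ^ card {..<m}"
      using sum_exp_interval_le[of "{..<m}" "2 * t" x] by blast
    have W0: "0 \<le> W S" if "S \<subseteq> {..<m}" for S
      using W(1)[OF that order.refl] exp_ge_zero order_trans by blast
    have "(\<Sum>S\<in>Pow {..<m}. ?V S x) \<le> (\<Sum>S\<in>Pow {..<m}. ennreal (W S))"
    proof (rule sum_mono)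
      fix S assume S: "S \<in> Pow {..<m}"
      show "?V S x \<le> ennreal (W S)"
        unfolding exp_sup_def
      proof (rule SUP_least)
        fix s assume s: "s \<in> T"
        have "t * \<bar>0 + 2 * (\<Sum>j<m. sign_of S j * h s (x j))\<bar>
            = 2 * t * \<bar>\<Sum>j<m. sign_of S j * indicator {fst s<..snd s} (x j)\<bar>"
          by (simp add: h_def abs_mult)
        then show "ennreal (exp (t * \<bar>0 + 2 * (\<Sum>j<m. sign_of S j * h s (x j))\<bar>)) \<le> ennreal (W S)"
          using W(1)[OF _ T_le[OF s], of S] S by (simp only: ennreal_leI Pow_iff)
      qed
    qed
    also have "\<dots> = ennreal (\<Sum>S\<in>Pow {..<m}. W S)" using W0 by (intro sum_ennreal) auto
    also have "\<dots> \<le> ennreal (2 * (2 * exp (2 * (2 * t)\<^sup>2)) ^ m)"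
      using W(2) by (intro ennreal_leI) simp
    finally show "(\<Sum>S\<in>Pow {..<m}. ?V S x) \<le> ennreal (2 * (2 * exp (2 * (2 * t)\<^sup>2)) ^ m)" .
  qed
  also have "\<dots> = ennreal (2 * (2 * exp (2 * (2 * t)\<^sup>2)) ^ m)" by (simp add: Pi.emeasure_space_1)
  also have "ennreal ((1/2) ^ card {..<m}) * \<dots> = ennreal (2 * exp (real m * \<epsilon>\<^sup>2 / 2))"
  proof -
    have "exp (2 * (2 * t)\<^sup>2) ^ m = exp (real m * \<epsilon>\<^sup>2 / 2)"
      by (simp add: t_def power2_eq_square flip: exp_of_nat_mult)
    then show ?thesis
      by (simp add: power_mult_distrib power_one_over flip: ennreal_mult)
  qed
  finally have int: "(\<integral>\<^sup>+\<omega>. ?U \<omega> \<partial>M) \<le> ennreal (2 * exp (real m * \<epsilon>\<^sup>2 / 2))"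
    by (simp add: mult_left_mono)
  let ?c = "ennreal (exp (- real m * \<epsilon>\<^sup>2))"
  have "?bad \<subseteq> {\<omega> \<in> space M. 1 \<le> ?c * ?U \<omega>}"
  proof
    fix \<omega> assume "\<omega> \<in> ?bad"
    then obtain s where s: "\<omega> \<in> space M" "s \<in> T" "\<bar>?D \<omega> s\<bar> > 4 * \<epsilon> * real m"
      unfolding bad_eq by auto
    have "real m * \<epsilon>\<^sup>2 \<le> t * \<bar>?D \<omega> s\<bar>"
      using mult_left_mono[OF less_imp_le[OF s(3)] t] by (simp add: t_def power2_eq_square mult_ac)
    then have "ennreal 1 \<le> ennreal (exp (- real m * \<epsilon>\<^sup>2) * exp (t * \<bar>?D \<omega> s\<bar>))"
      by (intro ennreal_leI) (simp flip: exp_add)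
    also have "\<dots> = ?c * ennreal (exp (t * \<bar>?D \<omega> s\<bar>))" by (rule ennreal_mult) auto
    also have "\<dots> \<le> ?c * ?U \<omega>"
      unfolding exp_sup_def using s(2) by (intro mult_left_mono SUP_upper) auto
    finally show "\<omega> \<in> {\<omega> \<in> space M. 1 \<le> ?c * ?U \<omega>}" using s(1) by simp
  qed
  then have "emeasure M ?bad \<le> emeasure M {\<omega> \<in> space M. 1 \<le> ?c * ?U \<omega>}"
    using U_meas by (intro emeasure_mono) measurable
  also have "\<dots> \<le> ?c * (\<integral>\<^sup>+\<omega>. ?U \<omega> * indicator (space M) \<omega> \<partial>M)"
    using U_meas by (intro nn_integral_Markov_inequality) auto
  also have "(\<integral>\<^sup>+\<omega>. ?U \<omega> * indicator (space M) \<omega> \<partial>M) = (\<integral>\<^sup>+\<omega>. ?U \<omega> \<partial>M)"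
    by (intro nn_integral_cong) simp
  also have "?c * \<dots> \<le> ?c * ennreal (2 * exp (real m * \<epsilon>\<^sup>2 / 2))"
    using int by (intro mult_left_mono) auto
  also have "\<dots> = ennreal (2 * exp (- real m * \<epsilon>\<^sup>2 / 2))"
    by (simp flip: ennreal_mult exp_add)
  finally show "prob ?bad \<le> 2 * exp (- real m * \<epsilon>\<^sup>2 / 2)"
    by (simp add: emeasure_eq_measure)
qed

section \<open>Lines in the plane\<close>

text \<open>
  For \<open>w = sin b\<close>, \<open>p = cos b\<close>, \<open>r = sin a\<close>, \<open>s = cos a\<close> this compares \<open>sin (a + b)\<close> with \<open>sin a + sin b\<close>.
\<close>

lemma sgn_chord:
  fixes r s w p :: real
  assumes "s \<ge> 0" "p > 0" "s\<^sup>2 + r\<^sup>2 = 1" "w\<^sup>2 + p\<^sup>2 = 1"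
  shows "sgn (s * w + r * p) = sgn (r + w)"
proof -
  have "(s * w + r * p) * (1 + s * p + r * w) = s * w + r * p + w * p * (s\<^sup>2 + r\<^sup>2) + r * s * (w\<^sup>2 + p\<^sup>2)"
    by (simp add: power2_eq_square algebra_simps)
  also have "\<dots> = (r + w) * (s + p)" using assms by (simp add: algebra_simps)
  finally have id: "(s * w + r * p) * (1 + s * p + r * w) = (r + w) * (s + p)" .
  have sp: "s + p > 0" using assms by simp
  have "2 * (1 + s * p + r * w) = (s\<^sup>2 + r\<^sup>2) + (w\<^sup>2 + p\<^sup>2) + 2 * (s * p + r * w)" using assms by simp
  also have "\<dots> = (s + p)\<^sup>2 + (r + w)\<^sup>2" by (simp add: power2_eq_square algebra_simps)
  also have "\<dots> > 0" using sp by (simp add: add_pos_nonneg)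
  finally have pos: "1 + s * p + r * w > 0" by simp
  have "sgn (s * w + r * p) = sgn ((s * w + r * p) * (1 + s * p + r * w))"
    using pos by (simp add: sgn_mult)
  also have "\<dots> = sgn (r + w)" unfolding id using sp by (simp add: sgn_mult)
  finally show ?thesis .
qed

text \<open>
  Along the upper half circle, ordered by the first coordinate, the sign changes only at one position.
  The half circle contains \<open>(1, 0)\<close> but not \<open>(- 1, 0)\<close>, so that it meets every line once; this makes the
  half planes with normal \<open>(0, 1)\<close> or \<open>(0, - 1)\<close> a separate case.
\<close>

lemma half_plane_ray:
  fixes X1 X2 :: real
  assumes X: "X1\<^sup>2 + X2\<^sup>2 = 1"
  obtains k :: real and e :: bool where
    "\<And>v1 v2. v1\<^sup>2 + v2\<^sup>2 = 1 \<Longrightarrow> v2 > 0 \<or> v2 = 0 \<and> v1 = 1 \<Longrightarrow> v1 = k \<Longrightarrow> v1 * X1 + v2 * X2 = 0"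
    "\<And>v1 v2. v1\<^sup>2 + v2\<^sup>2 = 1 \<Longrightarrow> v2 > 0 \<or> v2 = 0 \<and> v1 = 1 \<Longrightarrow> v1 \<noteq> k \<Longrightarrow>
      v1 * X1 + v2 * X2 \<noteq> 0 \<and> (v1 * X1 + v2 * X2 > 0 \<longleftrightarrow> (v1 > k) = e)"
proof -
  consider "X1 > 0" | "X1 < 0" | "X1 = 0" by linarith
  then show thesis
  proof cases
    case 1
    have *: "sgn (v1 * X1 + v2 * X2) = sgn (v1 - (- X2))"
      if "v1\<^sup>2 + v2\<^sup>2 = 1" "v2 > 0 \<or> v2 = 0 \<and> v1 = 1" for v1 v2
      using sgn_chord[of v2 X1 v1 X2] that 1 X by (auto simp: add.commute)
    show thesis
    proof (rule that[of "- X2" True])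
      fix v1 v2 :: real assume v: "v1\<^sup>2 + v2\<^sup>2 = 1" "v2 > 0 \<or> v2 = 0 \<and> v1 = 1"
      show "v1 * X1 + v2 * X2 = 0" if "v1 = - X2" using *[OF v] that by (simp add: sgn_0_0)
      show "v1 * X1 + v2 * X2 \<noteq> 0 \<and> (v1 * X1 + v2 * X2 > 0 \<longleftrightarrow> (v1 > - X2) = True)" if "v1 \<noteq> - X2"
        using *[OF v] that by (auto simp: sgn_if split: if_splits)
    qed
  next
    case 2
    have *: "sgn (v1 * - X1 + v2 * - X2) = sgn (v1 - X2)"
      if "v1\<^sup>2 + v2\<^sup>2 = 1" "v2 > 0 \<or> v2 = 0 \<and> v1 = 1" for v1 v2
      using sgn_chord[of v2 "- X1" v1 "- X2"] that 2 X by (auto simp: add.commute)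
    show thesis
    proof (rule that[of X2 False])
      fix v1 v2 :: real assume v: "v1\<^sup>2 + v2\<^sup>2 = 1" "v2 > 0 \<or> v2 = 0 \<and> v1 = 1"
      show "v1 * X1 + v2 * X2 = 0" if "v1 = X2" using *[OF v] that by (simp add: sgn_if split: if_splits)
      show "v1 * X1 + v2 * X2 \<noteq> 0 \<and> (v1 * X1 + v2 * X2 > 0 \<longleftrightarrow> (v1 > X2) = False)" if "v1 \<noteq> X2"
        using *[OF v] that by (auto simp: sgn_if split: if_splits)
    qed
  next
    case 3
    show thesis
    proof (rule that[of 1 "X2 < 0"])
      fix v1 v2 :: real assume v: "v1\<^sup>2 + v2\<^sup>2 = 1" "v2 > 0 \<or> v2 = 0 \<and> v1 = 1"
      show "v1 * X1 + v2 * X2 = 0" if "v1 = 1" using v that 3 by simp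
      have "X2 \<noteq> 0" using X 3 by auto
      have "v1\<^sup>2 \<le> 1" using v(1) zero_le_power2[of v2] by linarith
      then have "v1 \<le> 1" by (metis abs_le_square_iff abs_one abs_le_D1 one_power2)
      then show "v1 * X1 + v2 * X2 \<noteq> 0 \<and> (v1 * X1 + v2 * X2 > 0 \<longleftrightarrow> (v1 > 1) = (X2 < 0))" if "v1 \<noteq> 1"
        using v(2) that 3 \<open>X2 \<noteq> 0\<close> by (auto simp: zero_less_mult_iff)
    qed
  qed
qed

text \<open>The position on the upper half circle of the point \<open>(u1, u2)\<close> or its antipode.\<close>

definition half_circle_pos :: "real \<Rightarrow> real \<Rightarrow> real" where
  "half_circle_pos u1 u2 = (if u2 > 0 \<or> u2 = 0 \<and> u1 \<ge> 0 then u1 else - u1)"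

text \<open>
  Whether two half planes disagree about a point is the same for its antipode, up to points on their
  boundaries; so this depends only on the position, and it describes an interval or its complement.
\<close>

lemma separation_interval:
  fixes X1 X2 Z1 Z2 :: real
  assumes X: "X1\<^sup>2 + X2\<^sup>2 = 1" and Z: "Z1\<^sup>2 + Z2\<^sup>2 = 1"
  obtains a b :: real and e :: bool where "a \<le> b"
    "\<And>u1 u2. u1\<^sup>2 + u2\<^sup>2 = 1 \<Longrightarrow> half_circle_pos u1 u2 = a \<or> half_circle_pos u1 u2 = b \<Longrightarrow>
      u1 * X1 + u2 * X2 = 0 \<or> u1 * Z1 + u2 * Z2 = 0"
    "\<And>u1 u2. u1\<^sup>2 + u2\<^sup>2 = 1 \<Longrightarrow> half_circle_pos u1 u2 \<noteq> a \<Longrightarrow> half_circle_pos u1 u2 \<noteq> b \<Longrightarrow>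
      ((u1 * X1 + u2 * X2 \<ge> 0) \<noteq> (u1 * Z1 + u2 * Z2 \<ge> 0)) = e \<longleftrightarrow> a < half_circle_pos u1 u2 \<and> half_circle_pos u1 u2 < b"
proof -
  obtain k e where k:
    "\<And>v1 v2. v1\<^sup>2 + v2\<^sup>2 = 1 \<Longrightarrow> v2 > 0 \<or> v2 = 0 \<and> v1 = 1 \<Longrightarrow> v1 = k \<Longrightarrow> v1 * X1 + v2 * X2 = 0"
    "\<And>v1 v2. v1\<^sup>2 + v2\<^sup>2 = 1 \<Longrightarrow> v2 > 0 \<or> v2 = 0 \<and> v1 = 1 \<Longrightarrow> v1 \<noteq> k \<Longrightarrow>
      v1 * X1 + v2 * X2 \<noteq> 0 \<and> (v1 * X1 + v2 * X2 > 0 \<longleftrightarrow> (v1 > k) = e)"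
    by (rule half_plane_ray[OF X]) blast
  obtain l f where l:
    "\<And>v1 v2. v1\<^sup>2 + v2\<^sup>2 = 1 \<Longrightarrow> v2 > 0 \<or> v2 = 0 \<and> v1 = 1 \<Longrightarrow> v1 = l \<Longrightarrow> v1 * Z1 + v2 * Z2 = 0"
    "\<And>v1 v2. v1\<^sup>2 + v2\<^sup>2 = 1 \<Longrightarrow> v2 > 0 \<or> v2 = 0 \<and> v1 = 1 \<Longrightarrow> v1 \<noteq> l \<Longrightarrow>
      v1 * Z1 + v2 * Z2 \<noteq> 0 \<and> (v1 * Z1 + v2 * Z2 > 0 \<longleftrightarrow> (v1 > l) = f)"
    by (rule half_plane_ray[OF Z]) blast
  have rep: "\<exists>d. (d = 1 \<or> d = - 1) \<and> half_circle_pos u1 u2 = d * u1 \<and> (d * u2 > 0 \<or> d * u2 = 0 \<and> d * u1 = 1)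
      \<and> (d * u1)\<^sup>2 + (d * u2)\<^sup>2 = 1" if u: "u1\<^sup>2 + u2\<^sup>2 = 1" for u1 u2
  proof -
    have "u2 = 0 \<Longrightarrow> u1 = 1 \<or> u1 = - 1" using u by (simp add: power2_eq_1_iff)
    then show ?thesis
      using u by (intro exI[of _ "if u2 > 0 \<or> u2 = 0 \<and> u1 \<ge> 0 then 1 else - 1"])
        (auto simp: half_circle_pos_def)
  qed
  show thesis
  proof (rule that[of "min k l" "max k l" "e = f"])
    show "min k l \<le> max k l" by simp
    fix u1 u2 :: real assume u: "u1\<^sup>2 + u2\<^sup>2 = 1"
    let ?c = "half_circle_pos u1 u2"
    obtain d where d: "d = 1 \<or> d = - 1" "?c = d * u1" "d * u2 > 0 \<or> d * u2 = 0 \<and> d * u1 = 1"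
        "(d * u1)\<^sup>2 + (d * u2)\<^sup>2 = 1" using rep[OF u] by blast
    have X': "d * u1 * X1 + d * u2 * X2 = d * (u1 * X1 + u2 * X2)"
      and Z': "d * u1 * Z1 + d * u2 * Z2 = d * (u1 * Z1 + u2 * Z2)" by (simp_all add: algebra_simps)
    show "u1 * X1 + u2 * X2 = 0 \<or> u1 * Z1 + u2 * Z2 = 0" if "?c = min k l \<or> ?c = max k l"
    proof -
      from that have "d * u1 = k \<or> d * u1 = l" unfolding d(2) by (auto simp: min_def max_def split: if_splits)
      then show ?thesis using k(1)[OF d(4,3)] l(1)[OF d(4,3)] d(1) unfolding X' Z' by auto
    qed
    show "((u1 * X1 + u2 * X2 \<ge> 0) \<noteq> (u1 * Z1 + u2 * Z2 \<ge> 0)) = (e = f) \<longleftrightarrow> min k l < ?c \<and> ?c < max k l"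
      if c: "?c \<noteq> min k l" "?c \<noteq> max k l"
    proof -
      have ne: "d * u1 \<noteq> k" "d * u1 \<noteq> l" using c unfolding d(2) by (auto simp: min_def max_def split: if_splits)
      have Xs: "u1 * X1 + u2 * X2 \<noteq> 0" "d * (u1 * X1 + u2 * X2) > 0 \<longleftrightarrow> (d * u1 > k) = e"
        using k(2)[OF d(4,3) ne(1)] unfolding X' by auto
      have Zs: "u1 * Z1 + u2 * Z2 \<noteq> 0" "d * (u1 * Z1 + u2 * Z2) > 0 \<longleftrightarrow> (d * u1 > l) = f"
        using l(2)[OF d(4,3) ne(2)] unfolding Z' by auto
      have "((u1 * X1 + u2 * X2 \<ge> 0) \<noteq> (u1 * Z1 + u2 * Z2 \<ge> 0))
          \<longleftrightarrow> (d * (u1 * X1 + u2 * X2) > 0) \<noteq> (d * (u1 * Z1 + u2 * Z2) > 0)"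
        using d(1) Xs(1) Zs(1) by auto
      also have "\<dots> \<longleftrightarrow> ((d * u1 > k) = e) \<noteq> ((d * u1 > l) = f)" unfolding Xs(2) Zs(2) ..
      finally show ?thesis using ne unfolding d(2) by (auto simp: min_def max_def)
    qed
  qed
qed

section \<open>From half-open rational intervals to all intervals\<close>

lemma rational_sequence_above:
  obtains r :: "nat \<Rightarrow> real" where "\<And>k. r k \<in> \<rat>" "\<And>k. a < r k" "r \<longlonglongrightarrow> a"
proof -
  have "\<exists>q\<in>\<rat>. a < q \<and> q < a + 1 / real (Suc k)" for k
    by (rule Rats_dense_in_real) simp
  then obtain r where r: "\<And>k. r k \<in> \<rat> \<and> a < r k \<and> r k < a + 1 / real (Suc k)" by metis
  have lim: "(\<lambda>k. a + 1 / real (Suc k)) \<longlonglongrightarrow> a"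
    using tendsto_add[OF tendsto_const[of a] LIMSEQ_inverse_real_of_nat] by (simp add: inverse_eq_divide)
  have lo: "\<forall>\<^sub>F k in sequentially. a \<le> r k" and up: "\<forall>\<^sub>F k in sequentially. r k \<le> a + 1 / real (Suc k)"
    using r by (auto intro!: always_eventually less_imp_le)
  have "r \<longlonglongrightarrow> a" by (rule tendsto_sandwich[OF lo up tendsto_const lim])
  then show thesis using that r by blast
qed

lemma rational_sequence_below:
  obtains r :: "nat \<Rightarrow> real" where "\<And>k. r k \<in> \<rat>" "\<And>k. r k < a" "r \<longlonglongrightarrow> a"
proof -
  obtain r :: "nat \<Rightarrow> real" where r: "\<And>k. r k \<in> \<rat>" "\<And>k. - a < r k" "r \<longlonglongrightarrow> - a"
    using rational_sequence_above by blast
  have "- r k < a" for k using r(2)[of k] by simp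
  then show thesis using that[of "\<lambda>k. - r k"] r tendsto_minus[OF r(3)] by simp
qed

context prob_space
begin

definition deviation :: "nat \<Rightarrow> (nat \<Rightarrow> 'a \<Rightarrow> real) \<Rightarrow> real set \<Rightarrow> 'a \<Rightarrow> real" where
  "deviation m Y A \<omega> = (\<Sum>j<m. indicator A (Y j \<omega>) - expectation (\<lambda>\<omega>. indicator A (Y j \<omega>)))"

lemma deviation_limit:
  assumes rv: "\<And>j. j < m \<Longrightarrow> random_variable borel (Y j)"
    and bound: "\<And>k::nat. \<bar>deviation m Y (A k) \<omega>\<bar> \<le> K" and A: "\<And>k. A k \<in> sets borel" and B: "B \<in> sets borel"
    and conv: "\<And>y. (\<lambda>k. indicator (A k) y :: real) \<longlonglongrightarrow> indicator B y"
  shows "\<bar>deviation m Y B \<omega>\<bar> \<le> K"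
proof -
  have "(\<lambda>k. expectation (\<lambda>\<omega>. indicator (A k) (Y j \<omega>))) \<longlonglongrightarrow> expectation (\<lambda>\<omega>. indicator B (Y j \<omega>) :: real)"
    if "j < m" for j
  proof (rule integral_dominated_convergence[where w="\<lambda>_. 1"])
    show "(\<lambda>\<omega>. indicator B (Y j \<omega>) :: real) \<in> borel_measurable M"
      by (rule measurable_compose[OF rv[OF that] borel_measurable_indicator[OF B]])
    show "(\<lambda>\<omega>. indicator (A k) (Y j \<omega>) :: real) \<in> borel_measurable M" for k
      by (rule measurable_compose[OF rv[OF that] borel_measurable_indicator[OF A]])
  qed (use conv in \<open>auto simp: indicator_def\<close>)
  then have "(\<lambda>k. deviation m Y (A k) \<omega>) \<longlonglongrightarrow> deviation m Y B \<omega>"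
    unfolding deviation_def using conv by (intro tendsto_sum tendsto_diff) auto
  then have "(\<lambda>k. \<bar>deviation m Y (A k) \<omega>\<bar>) \<longlonglongrightarrow> \<bar>deviation m Y B \<omega>\<bar>" by (rule tendsto_rabs)
  then show ?thesis by (rule LIMSEQ_le_const2) (use bound in auto)
qed

lemma deviation_intervals:
  assumes rv: "\<And>j. j < m \<Longrightarrow> random_variable borel (Y j)" and K: "K \<ge> 0"
    and bound: "\<And>r s. r \<in> \<rat> \<Longrightarrow> s \<in> \<rat> \<Longrightarrow> r \<le> s \<Longrightarrow> \<bar>deviation m Y {r<..s} \<omega>\<bar> \<le> K"
  shows "\<bar>deviation m Y {a<..<b} \<omega>\<bar> \<le> K" "\<bar>deviation m Y {a..b} \<omega>\<bar> \<le> K"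
proof -
  have bound': "\<bar>deviation m Y {r<..s} \<omega>\<bar> \<le> K" if "r \<in> \<rat>" "s \<in> \<rat>" for r s
  proof (cases "r \<le> s")
    case False
    then have "{r<..s} = {}" by auto
    then show ?thesis using K by (simp add: deviation_def)
  qed (use bound that in auto)
  obtain au al bu bl where seqs: "\<And>k. au k \<in> \<rat>" "\<And>k. a < au k" "au \<longlonglongrightarrow> a"
      "\<And>k. al k \<in> \<rat>" "\<And>k. al k < a" "al \<longlonglongrightarrow> a"
      "\<And>k. bu k \<in> \<rat>" "\<And>k. b < bu k" "bu \<longlonglongrightarrow> b"
      "\<And>k. bl k \<in> \<rat>" "\<And>k. bl k < b" "bl \<longlonglongrightarrow> b"
    using rational_sequence_above[of a] rational_sequence_below[of a]
      rational_sequence_above[of b] rational_sequence_below[of b] by metis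
  have conv: "(\<lambda>k. indicator (A k) y :: real) \<longlonglongrightarrow> indicator B y"
    if "\<forall>\<^sub>F k in sequentially. y \<in> A k \<longleftrightarrow> y \<in> B" for A B and y :: real
    by (rule tendsto_eventually, rule eventually_mono[OF that]) (auto simp: indicator_def)
  show "\<bar>deviation m Y {a<..<b} \<omega>\<bar> \<le> K"
  proof (rule deviation_limit[OF rv, where A="\<lambda>k. {au k<..bl k}"])
    fix y
    show "(\<lambda>k. indicator {au k<..bl k} y :: real) \<longlonglongrightarrow> indicator {a<..<b} y"
    proof (rule conv)
      show "\<forall>\<^sub>F k in sequentially. y \<in> {au k<..bl k} \<longleftrightarrow> y \<in> {a<..<b}"
      proof (cases "a < y \<and> y < b")
        case True
        then have "\<forall>\<^sub>F k in sequentially. au k < y" "\<forall>\<^sub>F k in sequentially. y < bl k"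
          using order_tendstoD seqs by blast+
        then show ?thesis by eventually_elim (use True in auto)
      next
        case False
        then have "y \<notin> {au k<..bl k}" for k using seqs(2)[of k] seqs(11)[of k] by auto
        then show ?thesis using False by auto
      qed
    qed
  qed (use bound' seqs in auto)
  show "\<bar>deviation m Y {a..b} \<omega>\<bar> \<le> K"
  proof (rule deviation_limit[OF rv, where A="\<lambda>k. {al k<..bu k}"])
    fix y
    show "(\<lambda>k. indicator {al k<..bu k} y :: real) \<longlonglongrightarrow> indicator {a..b} y"
    proof (rule conv)
      consider "y < a" | "y > b" | "a \<le> y" "y \<le> b" by linarith
      then show "\<forall>\<^sub>F k in sequentially. y \<in> {al k<..bu k} \<longleftrightarrow> y \<in> {a..b}"
      proof cases
        case 1
        then have "\<forall>\<^sub>F k in sequentially. y < al k" using order_tendstoD seqs by blast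
        then show ?thesis by eventually_elim (use 1 in auto)
      next
        case 2
        then have "\<forall>\<^sub>F k in sequentially. bu k < y" using order_tendstoD seqs by blast
        then show ?thesis by eventually_elim (use 2 in auto)
      next
        case 3
        then have "y \<in> {al k<..bu k}" for k using seqs(5)[of k] seqs(8)[of k] by auto
        then show ?thesis using 3 by auto
      qed
    qed
  qed (use bound' seqs in auto)
qed

end

section \<open>The real plane: Bloch vectors\<close>

lemma one_dim_scalar:
  assumes "DIM('a::real_or_complex) = 1"
  shows "(z::'a) = of_real (sre z)"
proof -
  have "Basis = {1::'a}"
    using Basis_cases[where 'a='a]
  proof
    assume "\<exists>i::'a. i * i = - 1 \<and> Basis = {1, i}"
    then obtain i :: 'a where i: "Basis = {1, i}" by blast
    then have "card {1, i} = 1" using assms by simp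
    then have "i = 1" by (metis card_1_singletonE insert_iff singletonD)
    then show ?thesis using i by simp
  qed
  then have "z = (inner z 1) *\<^sub>R 1"
    using euclidean_representation[of z] by (metis finite.emptyI empty_iff sum.empty sum.insert add.right_neutral)
  then show ?thesis by (simp add: sre_inner of_real_def)
qed

text \<open>The parameter \<open>ty\<close> ties the scalar field to the locale, since no other parameter mentions it.\<close>

locale plane_indices =
  fixes i1 i2 :: "'n::finite" and ty :: "'a::real_or_complex itself"
  assumes one_dim: "DIM('a) = 1" and i12: "i1 \<noteq> i2" and UNIV_n: "UNIV = {i1, i2}"
begin

text \<open>
  The four functions are the coordinates of points of the unit circle, for a projection onto a line and
  for a unit vector of the line; the angle of the point is twice that of the line.
\<close>

definition bloch1 :: "'a^'n^'n \<Rightarrow> real" where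
  "bloch1 A = 2 * inner (axis i1 1) (A *v axis i1 1) - 1"

definition bloch2 :: "'a^'n^'n \<Rightarrow> real" where
  "bloch2 A = 2 * inner (axis i1 1) (A *v axis i2 1)"

definition double1 :: "'a^'n \<Rightarrow> real" where
  "double1 x = (sre (x $ i1))\<^sup>2 - (sre (x $ i2))\<^sup>2"

definition double2 :: "'a^'n \<Rightarrow> real" where
  "double2 x = 2 * sre (x $ i1) * sre (x $ i2)"

lemma bloch_measurable [measurable]:
  "bloch1 \<in> borel_measurable borel" "bloch2 \<in> borel_measurable borel"
  unfolding bloch1_def bloch2_def by measurable

lemma inner_plane: "inner x y = sre (x $ i1) * sre (y $ i1) + sre (x $ i2) * sre (y $ i2)"
  for x y :: "'a^'n"
proof -
  have scal: "inner u v = sre u * sre v" for u v :: 'a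
    by (subst one_dim_scalar[OF one_dim, of u], subst one_dim_scalar[OF one_dim, of v])
      (simp add: of_real_def)
  show ?thesis unfolding inner_vec_def UNIV_n using i12 by (simp add: scal)
qed

lemma inner_outer: "inner a (outer p *v b) = inner p a * inner p b" for a b p :: "'a^'n"
proof -
  have "herm p b = of_real (inner p b)"
    using one_dim_scalar[OF one_dim, of "herm p b"] by (simp add: sre_herm)
  then show ?thesis by (simp add: outer_vector scaleR_eq_smult[symmetric] inner_commute)
qed

lemma sre_axis: "sre ((axis i 1 :: 'a^'n) $ j) = (if i = j then 1 else 0)"
  by (simp add: axis_def)

lemma unit_plane: "norm (x::'a^'n) = 1 \<longleftrightarrow> (sre (x $ i1))\<^sup>2 + (sre (x $ i2))\<^sup>2 = 1"
  by (simp add: norm_eq_1 inner_plane power2_eq_square)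

lemma bloch_outer:
  assumes "norm (p::'a^'n) = 1"
  shows "bloch1 (outer p) = (sre (p $ i1))\<^sup>2 - (sre (p $ i2))\<^sup>2"
    "bloch2 (outer p) = 2 * sre (p $ i1) * sre (p $ i2)"
proof -
  have e: "inner p (axis i1 1) = sre (p $ i1)" "inner p (axis i2 1) = sre (p $ i2)"
    using i12 by (simp_all add: inner_plane sre_axis del: inner_axis)
  show "bloch1 (outer p) = (sre (p $ i1))\<^sup>2 - (sre (p $ i2))\<^sup>2"
    using assms unfolding unit_plane bloch1_def inner_outer e by (simp add: power2_eq_square)
  show "bloch2 (outer p) = 2 * sre (p $ i1) * sre (p $ i2)"
    unfolding bloch2_def inner_outer e by simp
qed

lemma bloch_unit:
  assumes "A \<in> Proj 1"
  shows "(bloch1 A)\<^sup>2 + (bloch2 A)\<^sup>2 = 1"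
proof -
  obtain p where p: "norm p = 1" "A = outer p" using assms by (rule Proj_1_outer)
  define a b where "a = sre (p $ i1)" and "b = sre (p $ i2)"
  have ab: "a\<^sup>2 + b\<^sup>2 = 1" using p(1) unfolding unit_plane a_def b_def .
  have bl: "bloch1 A = a\<^sup>2 - b\<^sup>2" "bloch2 A = 2 * a * b"
    by (simp_all add: p(2) bloch_outer[OF p(1)] a_def b_def)
  have "(bloch1 A)\<^sup>2 + (bloch2 A)\<^sup>2 = (a\<^sup>2 + b\<^sup>2)\<^sup>2"
    unfolding bl by (simp add: power2_eq_square algebra_simps)
  then show ?thesis using ab by simp
qed

lemma double_unit:
  assumes "norm x = 1"
  shows "(double1 x)\<^sup>2 + (double2 x)\<^sup>2 = 1"
proof -
  have "(double1 x)\<^sup>2 + (double2 x)\<^sup>2 = ((sre (x $ i1))\<^sup>2 + (sre (x $ i2))\<^sup>2)\<^sup>2"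
    by (simp add: double1_def double2_def power2_eq_square algebra_simps)
  then show ?thesis using assms unfolding unit_plane by simp
qed

lemma quadratic_form_bloch:
  assumes A: "A \<in> Proj 1" and x: "norm x = 1"
  shows "2 * inner x (A *v x) - 1 = bloch1 A * double1 x + bloch2 A * double2 x"
proof -
  obtain p where p: "norm p = 1" "A = outer p" using A by (rule Proj_1_outer)
  define a b c d where "a = sre (p $ i1)" and "b = sre (p $ i2)" and "c = sre (x $ i1)" and "d = sre (x $ i2)"
  have ab: "a\<^sup>2 + b\<^sup>2 = 1" using p(1) unfolding unit_plane a_def b_def .
  have cd: "c\<^sup>2 + d\<^sup>2 = 1" using x unfolding unit_plane c_def d_def .
  have bl: "bloch1 A = a\<^sup>2 - b\<^sup>2" "bloch2 A = 2 * a * b"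
    by (simp_all add: p(2) bloch_outer[OF p(1)] a_def b_def)
  have "2 * inner x (A *v x) - 1 = 2 * (a * c + b * d)\<^sup>2 - 1"
    unfolding p(2) inner_outer unfolding inner_plane a_def b_def c_def d_def
    by (simp add: power2_eq_square)
  also have "\<dots> = 2 * (a * c + b * d)\<^sup>2 - (a\<^sup>2 + b\<^sup>2) * (c\<^sup>2 + d\<^sup>2)" by (simp add: ab cd)
  also have "\<dots> = (a\<^sup>2 - b\<^sup>2) * (c\<^sup>2 - d\<^sup>2) + 2 * a * b * (2 * c * d)"
    by (simp add: power2_eq_square algebra_simps)
  finally show ?thesis by (simp add: bl double1_def double2_def c_def d_def)
qed

lemma half_angle:
  assumes z: "z1\<^sup>2 + z2\<^sup>2 = (1::real)"
  obtains x where "norm x = 1" "double1 x = z1" "double2 x = z2"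
proof -
  define a where "a = sqrt ((1 + z1) / 2)"
  define b where "b = (if z2 \<ge> 0 then sqrt ((1 - z1) / 2) else - sqrt ((1 - z1) / 2))"
  have "z1\<^sup>2 \<le> 1" using z zero_le_power2[of z2] by linarith
  then have "\<bar>z1\<bar> \<le> 1" by (simp add: abs_square_le_1)
  then have sq: "a\<^sup>2 = (1 + z1) / 2" "b\<^sup>2 = (1 - z1) / 2" by (auto simp: a_def b_def)
  have "(1 + z1) / 2 * ((1 - z1) / 2) = (z2 / 2)\<^sup>2" using z by (simp add: power2_eq_square field_simps)
  then have "sqrt ((1 + z1) / 2) * sqrt ((1 - z1) / 2) = \<bar>z2 / 2\<bar>"
    unfolding real_sqrt_mult[symmetric] by simp
  then have ab: "2 * a * b = z2" by (auto simp: a_def b_def)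
  define x :: "'a^'n" where "x = (\<chi> i. if i = i1 then of_real a else of_real b)"
  have "sre (x $ i1) = a" "sre (x $ i2) = b"
    using i12 by (simp_all add: x_def sre_inner of_real_def)
  then show thesis
    using that[of x] sq ab by (simp add: unit_plane double1_def double2_def) (simp add: field_simps)
qed

end

section \<open>The uniform estimate in the real plane\<close>

locale random_lines = random_Projs M P m n + plane_indices i1 i2 "TYPE('a)"
  for M :: "'w measure" and P :: "nat \<Rightarrow> 'w \<Rightarrow> 'a::real_or_complex^'n^'n" and m n :: nat and i1 i2 :: 'n +
  assumes n1: "n = 1"
begin

definition positive :: "real \<times> real \<Rightarrow> 'a^'n^'n \<Rightarrow> bool" where
  "positive X A \<longleftrightarrow> bloch1 A * fst X + bloch2 A * snd X \<ge> 0"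

definition separated :: "real \<times> real \<Rightarrow> real \<times> real \<Rightarrow> ('a^'n^'n) set" where
  "separated X Z = {A. positive X A \<noteq> positive Z A}"

definition circle :: "(real \<times> real) set" where
  "circle = {X. (fst X)\<^sup>2 + (snd X)\<^sup>2 = 1}"

definition pos :: "'a^'n^'n \<Rightarrow> real" where
  "pos A = half_circle_pos (bloch1 A) (bloch2 A)"

lemma pos_measurable [measurable]: "pos \<in> borel_measurable borel"
  unfolding pos_def half_circle_pos_def by measurable

lemma separated_sets: "separated X Z \<in> sets borel"
proof -
  have "{A \<in> space borel. (bloch1 A * fst X + bloch2 A * snd X \<ge> 0) \<noteq> (bloch1 A * fst Z + bloch2 A * snd Z \<ge> 0)} \<in> sets borel"
    by measurable
  then show ?thesis by (simp add: separated_def positive_def)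
qed

lemma P_Proj_1: "j < m \<Longrightarrow> \<omega> \<in> space M \<Longrightarrow> P j \<omega> \<in> Proj 1"
  using P_Proj n1 by simp

lemma AE_no_tie:
  assumes j: "j < m" and X: "X \<in> circle"
  shows "AE \<omega> in M. bloch1 (P j \<omega>) * fst X + bloch2 (P j \<omega>) * snd X \<noteq> 0"
proof -
  interpret U: uniform_Proj "distr M (proj_space n) (P j)" n by (rule uniform_Proj_P[OF j])
  obtain x where x: "norm x = 1" "double1 x = fst X" "double2 x = snd X"
    using half_angle X unfolding circle_def by blast
  have "AE \<omega> in M. inner x (P j \<omega> *v x) \<noteq> 1/2"
    using AE_distrD[OF random_variable_P[OF j] U.AE_quadratic_form_neq[OF x(1)]] .
  then show ?thesis
  proof (rule AE_mp, intro AE_I2 impI)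
    fix \<omega> assume "\<omega> \<in> space M" "inner x (P j \<omega> *v x) \<noteq> 1/2"
    then show "bloch1 (P j \<omega>) * fst X + bloch2 (P j \<omega>) * snd X \<noteq> 0"
      using quadratic_form_bloch[OF P_Proj_1[OF j] x(1), of \<omega>] x by auto
  qed
qed

text \<open>
  A tie of a sample point is possible for suitable half planes. The separating set therefore lies
  only between the open and the closed interval, but these have the same probability.
\<close>

lemma separated_deviation:
  assumes \<omega>: "\<omega> \<in> space M" and X: "X \<in> circle" and Z: "Z \<in> circle" and K: "K \<ge> 0"
    and bound: "\<And>r s. r \<in> \<rat> \<Longrightarrow> s \<in> \<rat> \<Longrightarrow> r \<le> s \<Longrightarrow> \<bar>deviation m (\<lambda>j \<omega>. pos (P j \<omega>)) {r<..s} \<omega>\<bar> \<le> K"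
  shows "\<bar>\<Sum>j<m. indicator (separated X Z) (P j \<omega>) - expectation (\<lambda>\<omega>. indicator (separated X Z) (P j \<omega>))\<bar> \<le> K"
proof -
  let ?Y = "\<lambda>j \<omega>. pos (P j \<omega>)"
  obtain a b :: real and e :: bool where ab: "a \<le> b"
    and tie: "\<And>u1 u2. u1\<^sup>2 + u2\<^sup>2 = 1 \<Longrightarrow> half_circle_pos u1 u2 = a \<or> half_circle_pos u1 u2 = b \<Longrightarrow>
      u1 * fst X + u2 * snd X = 0 \<or> u1 * fst Z + u2 * snd Z = 0"
    and sep: "\<And>u1 u2. u1\<^sup>2 + u2\<^sup>2 = 1 \<Longrightarrow> half_circle_pos u1 u2 \<noteq> a \<Longrightarrow> half_circle_pos u1 u2 \<noteq> b \<Longrightarrow>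
      ((u1 * fst X + u2 * snd X \<ge> 0) \<noteq> (u1 * fst Z + u2 * snd Z \<ge> 0)) = e
        \<longleftrightarrow> a < half_circle_pos u1 u2 \<and> half_circle_pos u1 u2 < b"
  proof -
    have XZ: "(fst X)\<^sup>2 + (snd X)\<^sup>2 = 1" "(fst Z)\<^sup>2 + (snd Z)\<^sup>2 = 1"
      using X Z by (simp_all add: circle_def)
    show thesis by (rule separation_interval[OF XZ], rule that) assumption+
  qed
  have rv: "random_variable borel (?Y j)" if "j < m" for j
    using that by (intro random_variable_comp[OF pos_measurable])
  note dev = deviation_intervals[OF rv K bound, of a b]
  define B where "B = (if e then separated X Z else - separated X Z)"
  have B: "B \<in> sets borel" using separated_sets[of X Z] by (auto simp: B_def)
  have B_iff: "P j \<omega>' \<in> B \<longleftrightarrow> a < ?Y j \<omega>' \<and> ?Y j \<omega>' < b"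
    if "j < m" "\<omega>' \<in> space M" "?Y j \<omega>' \<noteq> a" "?Y j \<omega>' \<noteq> b" for j \<omega>'
    using sep[OF bloch_unit[OF P_Proj_1[OF that(1,2)]]] that(3,4)
    by (auto simp: B_def separated_def positive_def pos_def)
  let ?I = "\<lambda>A x. indicator A x :: real"
  have E_eq: "expectation (\<lambda>\<omega>. ?I {a<..<b} (?Y j \<omega>)) = expectation (\<lambda>\<omega>. ?I B (P j \<omega>))"
    "expectation (\<lambda>\<omega>. ?I {a..b} (?Y j \<omega>)) = expectation (\<lambda>\<omega>. ?I B (P j \<omega>))" if j: "j < m" for j
  proof -
    have m1: "(\<lambda>\<omega>. ?I B (P j \<omega>)) \<in> borel_measurable M"
      by (rule random_variable_comp[OF borel_measurable_indicator[OF B] j])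
    have m2: "(\<lambda>\<omega>. ?I A (?Y j \<omega>)) \<in> borel_measurable M" if "A \<in> sets borel" for A
      by (rule measurable_compose[OF rv[OF j] borel_measurable_indicator[OF that]])
    have ae: "AE \<omega> in M. ?Y j \<omega> \<noteq> a \<and> ?Y j \<omega> \<noteq> b"
    proof -
      have "AE \<omega> in M. \<omega> \<in> space M" by (rule AE_space)
      with AE_no_tie[OF j X] AE_no_tie[OF j Z] show ?thesis
      proof eventually_elim
        case (elim \<omega>)
        then show ?case
          using tie[OF bloch_unit[OF P_Proj_1[OF j elim(3)]]] unfolding pos_def by blast
      qed
    qed
    show "expectation (\<lambda>\<omega>. ?I {a<..<b} (?Y j \<omega>)) = expectation (\<lambda>\<omega>. ?I B (P j \<omega>))"
      by (rule integral_cong_AE[OF m2 m1], simp, use ae in \<open>rule AE_mp\<close>)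
        (intro AE_I2 impI, auto simp: indicator_def B_iff[OF j])
    show "expectation (\<lambda>\<omega>. ?I {a..b} (?Y j \<omega>)) = expectation (\<lambda>\<omega>. ?I B (P j \<omega>))"
      by (rule integral_cong_AE[OF m2 m1], simp, use ae in \<open>rule AE_mp\<close>)
        (intro AE_I2 impI, auto simp: indicator_def B_iff[OF j] less_le)
  qed
  have between: "?I {a<..<b} (?Y j \<omega>) \<le> ?I B (P j \<omega>)" "?I B (P j \<omega>) \<le> ?I {a..b} (?Y j \<omega>)" if j: "j < m" for j
    using B_iff[OF j \<omega>] ab by (auto simp: indicator_def less_le)
  let ?devB = "\<Sum>j<m. ?I B (P j \<omega>) - expectation (\<lambda>\<omega>. ?I B (P j \<omega>))"
  have "deviation m ?Y {a<..<b} \<omega> \<le> ?devB"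
    unfolding deviation_def by (rule sum_mono) (use between E_eq in simp)
  moreover have "?devB \<le> deviation m ?Y {a..b} \<omega>"
    unfolding deviation_def by (rule sum_mono) (use between E_eq in simp)
  ultimately have devB: "\<bar>?devB\<bar> \<le> K" using dev by linarith
  show ?thesis
  proof (cases e)
    case True
    then show ?thesis using devB by (simp add: B_def)
  next
    case False
    have "?I B (P j \<omega>) - expectation (\<lambda>\<omega>. ?I B (P j \<omega>))
        = - (?I (separated X Z) (P j \<omega>) - expectation (\<lambda>\<omega>. ?I (separated X Z) (P j \<omega>)))" if j: "j < m" for j
    proof -
      have meas: "(\<lambda>\<omega>. ?I (separated X Z) (P j \<omega>)) \<in> borel_measurable M"
        by (rule random_variable_comp[OF borel_measurable_indicator[OF separated_sets] j])
      have int: "integrable M (\<lambda>\<omega>. ?I (separated X Z) (P j \<omega>))"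
        using meas by (intro integrable_const_bound[of _ 1]) auto
      have compl: "?I B A = 1 - ?I (separated X Z) A" for A
        using False by (simp add: B_def indicator_def)
      show ?thesis unfolding compl using int by (simp add: prob_space)
    qed
    then have "?devB = - (\<Sum>j<m. ?I (separated X Z) (P j \<omega>) - expectation (\<lambda>\<omega>. ?I (separated X Z) (P j \<omega>)))"
      unfolding sum_negf[symmetric] by (intro sum.cong) auto
    then show ?thesis using devB by simp
  qed
qed


text \<open>
  The response is an average of separation indicators: rotating the normal of a half plane from
  one direction orthogonal to \<open>W\<close> through \<open>W\<close> to the opposite one, at a speed for which the component \<open>r\<close>
  orthogonal to \<open>W\<close> is uniform, a unit vector \<open>u\<close> belongs to it for the
  proportion \<open>(1 + u \<bullet> W) / 2\<close> of the time.
\<close>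

definition sweep :: "real \<times> real \<Rightarrow> real \<Rightarrow> real \<times> real" where
  "sweep W r = (sqrt (1 - r\<^sup>2) * fst W - r * snd W, sqrt (1 - r\<^sup>2) * snd W + r * fst W)"

lemma sweep_circle:
  assumes "W \<in> circle" "r \<in> {-1..1}"
  shows "sweep W r \<in> circle"
proof -
  have "r\<^sup>2 \<le> 1" using assms(2) by (simp add: abs_square_le_1 abs_le_iff)
  then have "(sqrt (1 - r\<^sup>2))\<^sup>2 = 1 - r\<^sup>2" by simp
  moreover have "(s * w1 - r * w2)\<^sup>2 + (s * w2 + r * w1)\<^sup>2 = (s\<^sup>2 + r\<^sup>2) * (w1\<^sup>2 + w2\<^sup>2)" for s w1 w2
    by (simp add: power2_eq_square algebra_simps)
  ultimately show ?thesis using assms(1) by (simp add: circle_def sweep_def)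
qed

definition sweep_time :: "real measure" where
  "sweep_time = uniform_measure lborel {-1..1}"

sublocale sweep: prob_space sweep_time
  unfolding sweep_time_def by (rule prob_space_uniform_measure) auto

lemma sets_sweep_time [measurable_cong]: "sets sweep_time = sets borel"
  by (simp add: sweep_time_def)

lemma AE_sweep_time: "AE r in sweep_time. r \<in> {-1..1}"
  unfolding sweep_time_def by (rule AE_uniform_measureI) auto

lemma measure_sweep_time:
  assumes "A \<in> sets borel"
  shows "measure sweep_time A = measure lborel ({-1..1} \<inter> A) / 2"
  using assms by (simp add: sweep_time_def measure_uniform_measure)

lemma prob_sweep_positive:
  assumes W: "W \<in> circle" and A: "A \<in> Proj 1"
  shows "measure sweep_time {r. positive (sweep W r) A} = (1 + (bloch1 A * fst W + bloch2 A * snd W)) / 2"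
proof -
  define w where "w = bloch1 A * fst W + bloch2 A * snd W"
  define p where "p = bloch2 A * fst W - bloch1 A * snd W"
  have "w\<^sup>2 + p\<^sup>2 = ((bloch1 A)\<^sup>2 + (bloch2 A)\<^sup>2) * ((fst W)\<^sup>2 + (snd W)\<^sup>2)"
    by (simp add: w_def p_def power2_eq_square algebra_simps)
  then have wp: "w\<^sup>2 + p\<^sup>2 = 1" using W bloch_unit[OF A] by (simp add: circle_def)
  then have "w\<^sup>2 \<le> 1" using zero_le_power2[of p] by linarith
  then have w1: "- 1 \<le> w" "w \<le> 1" by (simp_all add: abs_square_le_1 abs_le_iff)
  have pos: "positive (sweep W r) A \<longleftrightarrow> sqrt (1 - r\<^sup>2) * w + r * p \<ge> 0" for r
    by (simp add: positive_def sweep_def w_def p_def algebra_simps)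
  have sr: "sqrt (1 - r\<^sup>2) \<ge> 0" "(sqrt (1 - r\<^sup>2))\<^sup>2 + r\<^sup>2 = 1" if "r \<in> {-1..1}" for r
  proof -
    have "r\<^sup>2 \<le> 1" using that by (simp add: abs_square_le_1 abs_le_iff)
    then show "sqrt (1 - r\<^sup>2) \<ge> 0" "(sqrt (1 - r\<^sup>2))\<^sup>2 + r\<^sup>2 = 1" by simp_all
  qed
  have sgn_le: "x \<ge> 0 \<longleftrightarrow> y \<ge> 0" if "sgn x = sgn y" for x y :: real
    using that by (auto simp: sgn_if split: if_splits)
  have meas: "{r. positive (sweep W r) A} \<in> sets borel"
  proof -
    have "{r \<in> space borel. sqrt (1 - r\<^sup>2) * w + r * p \<ge> 0} \<in> sets borel" by measurable
    then show ?thesis by (simp add: pos)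
  qed
  have "measure lborel ({-1..1} \<inter> {r. positive (sweep W r) A}) = 1 + w"
  proof -
    consider "p > 0" | "p < 0" | "p = 0" "w = 1" | "p = 0" "w = - 1"
      using wp by (cases "p = 0") (auto simp: power2_eq_1_iff linorder_neq_iff)
    then show ?thesis
    proof cases
      case 1
      have "{-1..1} \<inter> {r. positive (sweep W r) A} = {- w..1}"
        using sgn_le[OF sgn_chord[OF sr(1) 1 sr(2) wp]] w1 by (fastforce simp: pos)
      then show ?thesis using w1 by simp
    next
      case 2
      have "w\<^sup>2 + (- p)\<^sup>2 = 1" "- p > 0" using wp 2 by simp_all
      then have "sqrt (1 - r\<^sup>2) * w + r * p \<ge> 0 \<longleftrightarrow> - r + w \<ge> 0" if "r \<in> {-1..1}" for r
        using sgn_le[OF sgn_chord[of "sqrt (1 - r\<^sup>2)" "- p" "- r" w]] sr[OF that] by simp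
      then have "{-1..1} \<inter> {r. positive (sweep W r) A} = {- 1..w}"
        using w1 by (fastforce simp: pos)
      then show ?thesis using w1 by simp
    next
      case 3
      then have "{-1..1} \<inter> {r. positive (sweep W r) A} = {-1..1}" using sr by (auto simp: pos)
      then show ?thesis using 3 by simp
    next
      case 4
      have "{-1..1} \<inter> {r. positive (sweep W r) A} \<subseteq> {-1, 1}"
      proof
        fix r assume r: "r \<in> {-1..1} \<inter> {r. positive (sweep W r) A}"
        then have "sqrt (1 - r\<^sup>2) \<le> 0" using 4 by (simp add: pos)
        then have "sqrt (1 - r\<^sup>2) = 0" using sr(1)[of r] r by auto
        then have "r\<^sup>2 = 1" using sr(2)[of r] r by simp
        then show "r \<in> {-1, 1}" by (simp add: power2_eq_1_iff disj_commute)
      qed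
      then have "emeasure lborel ({-1..1} \<inter> {r. positive (sweep W r) A}) \<le> emeasure lborel {-1, 1::real}"
        by (rule emeasure_mono) simp
      also have "\<dots> = 0" by (intro emeasure_lborel_countable) simp
      finally show ?thesis using 4 by (simp add: measure_def)
    qed
  qed
  then show ?thesis unfolding measure_sweep_time[OF meas] w_def by simp
qed


lemma response_sweep:
  assumes A: "A \<in> Proj 1" and x: "norm x = 1" and y: "norm y = 1"
  shows "inner y (response x A y)
    = 1 - sweep.expectation (\<lambda>r. indicator (separated (double1 x, double2 x) (sweep (double1 y, double2 y) r)) A)"
proof -
  let ?X = "(double1 x, double2 x)" and ?W = "(double1 y, double2 y)"
  have W: "?W \<in> circle" using double_unit[OF y] by (simp add: circle_def)
  have space: "space sweep_time = UNIV" using sets_eq_imp_space_eq[OF sets_sweep_time] by simp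
  define \<pi> where "\<pi> = measure sweep_time {r. positive (sweep ?W r) A}"
  have \<pi>: "\<pi> = inner y (A *v y)"
    using prob_sweep_positive[OF W A] quadratic_form_bloch[OF A y] by (simp add: \<pi>_def)
  have meas: "{r. positive (sweep ?W r) A} \<in> sets sweep_time"
  proof -
    have "{r \<in> space borel. bloch1 A * fst (sweep ?W r) + bloch2 A * snd (sweep ?W r) \<ge> 0} \<in> sets borel"
      unfolding sweep_def by measurable
    then show ?thesis by (simp add: positive_def sets_sweep_time)
  qed
  have pos_x: "positive ?X A \<longleftrightarrow> inner x (A *v x) \<ge> 1/2"
    using quadratic_form_bloch[OF A x] by (simp add: positive_def) linarith
  have E: "sweep.expectation (\<lambda>r. indicator (separated ?X (sweep ?W r)) A)
      = measure sweep_time {r. positive ?X A \<noteq> positive (sweep ?W r) A}"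
  proof -
    have "(\<lambda>r. indicator (separated ?X (sweep ?W r)) A :: real)
        = indicator {r. positive ?X A \<noteq> positive (sweep ?W r) A}"
      by (auto simp: indicator_def separated_def)
    then show ?thesis by (simp add: space)
  qed
  show ?thesis
  proof (cases "positive ?X A")
    case True
    then have "{r. positive ?X A \<noteq> positive (sweep ?W r) A} = space sweep_time - {r. positive (sweep ?W r) A}"
      by (auto simp: space)
    then have "measure sweep_time {r. positive ?X A \<noteq> positive (sweep ?W r) A} = 1 - \<pi>"
      using sweep.prob_compl[OF meas] by (simp add: \<pi>_def)
    then show ?thesis using True pos_x unfolding E response_diag[OF A y] by (simp add: \<pi>)
  next
    case False
    then have "measure sweep_time {r. positive ?X A \<noteq> positive (sweep ?W r) A} = \<pi>" by (simp add: \<pi>_def)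
    then show ?thesis using False pos_x unfolding E response_diag[OF A y] by (simp add: \<pi>)
  qed
qed

text \<open>
  Up to the sign, the deviation of the average response from its mean is the average over the sweep of
  that of the frequency of a separating set, and the latter deviation is small for all pairs of half planes simultaneously.
\<close>

theorem uniform_estimate_plane:
  assumes \<epsilon>: "\<epsilon> > 0"
  obtains E where "E \<in> sets M" "prob E \<ge> 1 - 2 * exp (- real m * \<epsilon>\<^sup>2 / 2)"
    "\<And>\<omega> x y. \<omega> \<in> E \<Longrightarrow> norm x = 1 \<Longrightarrow> norm y = 1 \<Longrightarrow>
      \<bar>(\<Sum>j<m. inner y (response x (P j \<omega>) y)) / real m - mean x y\<bar> \<le> 4 * \<epsilon>"
proof -
  let ?Y = "\<lambda>j \<omega>. pos (P j \<omega>)"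
  define T where "T = {s::real \<times> real. fst s \<in> \<rat> \<and> snd s \<in> \<rat> \<and> fst s \<le> snd s}"
  have T: "countable T"
    by (rule countable_subset[of _ "\<rat> \<times> \<rat>"]) (auto simp: T_def countable_rat)
  have indepY: "indep_vars (\<lambda>_. borel) ?Y {..<m}"
    by (rule indep_vars_compose2[OF indep]) (rule measurable_proj_space[OF pos_measurable])
  define bad where "bad = {\<omega> \<in> space M. \<exists>s\<in>T. \<bar>deviation m ?Y {fst s<..snd s} \<omega>\<bar> > 4 * \<epsilon> * real m}"
  have bad: "bad \<in> events" "prob bad \<le> 2 * exp (- real m * \<epsilon>\<^sup>2 / 2)"
    unfolding bad_def deviation_def
    using interval_deviation[OF m_pos indepY T _ \<epsilon>] by (auto simp: T_def)
  show thesis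
  proof (rule that[of "space M - bad"])
    show "space M - bad \<in> events" using bad by auto
    show "prob (space M - bad) \<ge> 1 - 2 * exp (- real m * \<epsilon>\<^sup>2 / 2)"
      using bad prob_compl[OF bad(1)] by simp
    fix \<omega> and x y :: "'a^'n"
    assume \<omega>: "\<omega> \<in> space M - bad" and x: "norm x = 1" and y: "norm y = 1"
    let ?X = "(double1 x, double2 x)" and ?W = "(double1 y, double2 y)"
    have X: "?X \<in> circle" and W: "?W \<in> circle"
      using double_unit[OF x] double_unit[OF y] by (simp_all add: circle_def)
    define h where "h = (\<lambda>j r \<omega>. indicator (separated ?X (sweep ?W r)) (P j \<omega>) :: real)"
    interpret Pr: pair_prob_space sweep_time M ..
    have int: "integrable (sweep_time \<Otimes>\<^sub>M M) (\<lambda>(r, \<omega>). h j r \<omega>)" if j: "j < m" for j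
    proof -
      have [measurable]: "(\<lambda>\<omega>. bloch1 (P j \<omega>)) \<in> borel_measurable M" "(\<lambda>\<omega>. bloch2 (P j \<omega>)) \<in> borel_measurable M"
        using j by (auto intro: random_variable_comp bloch_measurable)
      have [measurable]: "(\<lambda>r. fst (sweep ?W r)) \<in> borel_measurable sweep_time"
        "(\<lambda>r. snd (sweep ?W r)) \<in> borel_measurable sweep_time"
        unfolding sweep_def fst_conv snd_conv by measurable
      have "(\<lambda>p. if (bloch1 (P j (snd p)) * fst ?X + bloch2 (P j (snd p)) * snd ?X \<ge> 0)
            \<noteq> (bloch1 (P j (snd p)) * fst (sweep ?W (fst p)) + bloch2 (P j (snd p)) * snd (sweep ?W (fst p)) \<ge> 0)
          then 1 else 0 :: real) \<in> borel_measurable (sweep_time \<Otimes>\<^sub>M M)"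
        by measurable
      then have "(\<lambda>p. h j (fst p) (snd p)) \<in> borel_measurable (sweep_time \<Otimes>\<^sub>M M)"
        by (simp add: h_def indicator_def separated_def positive_def)
      then show ?thesis
        by (intro Pr.P.integrable_const_bound[of _ 1]) (auto simp: h_def case_prod_unfold)
    qed
    define e where "e = (\<lambda>j r. expectation (h j r))"
    have int_e: "integrable sweep_time (e j)" if "j < m" for j
      using Pr.integrable_fst[OF int[OF that]] by (simp add: e_def)
    have int_h: "integrable sweep_time (\<lambda>r. h j r \<omega>')" if j: "j < m" for j \<omega>'
    proof -
      have [measurable]: "(\<lambda>r. fst (sweep ?W r)) \<in> borel_measurable sweep_time"
        "(\<lambda>r. snd (sweep ?W r)) \<in> borel_measurable sweep_time"
        unfolding sweep_def fst_conv snd_conv by measurable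
      have "(\<lambda>r. if (bloch1 (P j \<omega>') * fst ?X + bloch2 (P j \<omega>') * snd ?X \<ge> 0)
            \<noteq> (bloch1 (P j \<omega>') * fst (sweep ?W r) + bloch2 (P j \<omega>') * snd (sweep ?W r) \<ge> 0)
          then 1 else 0 :: real) \<in> borel_measurable sweep_time"
        by measurable
      then have "(\<lambda>r. h j r \<omega>') \<in> borel_measurable sweep_time"
        by (simp add: h_def indicator_def separated_def positive_def)
      then show ?thesis by (intro sweep.integrable_const_bound[of _ 1]) (auto simp: h_def)
    qed
    have resp: "inner y (response x (P j \<omega>') y) = 1 - sweep.expectation (\<lambda>r. h j r \<omega>')"
      if "j < m" "\<omega>' \<in> space M" for j \<omega>'
      unfolding h_def by (rule response_sweep[OF P_Proj_1[OF that] x y])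
    have mean: "mean x y = 1 - sweep.expectation (e j)" if j: "j < m" for j
    proof -
      have i: "integrable M (\<lambda>\<omega>'. sweep.expectation (\<lambda>r. h j r \<omega>'))"
        using Pr.integrable_snd[OF int[OF j]] by simp
      have "mean x y = expectation (\<lambda>\<omega>'. 1 - sweep.expectation (\<lambda>r. h j r \<omega>'))"
        unfolding expectation_response_P[OF j x y, symmetric]
        by (intro Bochner_Integration.integral_cong refl) (use resp j in auto)
      also have "\<dots> = 1 - expectation (\<lambda>\<omega>'. sweep.expectation (\<lambda>r. h j r \<omega>'))"
        using i by (simp add: prob_space)
      also have "expectation (\<lambda>\<omega>'. sweep.expectation (\<lambda>r. h j r \<omega>')) = sweep.expectation (e j)"
        unfolding e_def using Pr.Fubini_integral[OF int[OF j]] by simp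
      finally show ?thesis .
    qed
    have \<omega>M: "\<omega> \<in> space M" using \<omega> by simp
    have "(\<Sum>j<m. inner y (response x (P j \<omega>) y)) - real m * mean x y
        = (\<Sum>j<m. inner y (response x (P j \<omega>) y) - mean x y)"
      by (simp add: sum_subtractf)
    also have "\<dots> = (\<Sum>j<m. - sweep.expectation (\<lambda>r. h j r \<omega> - e j r))"
    proof (rule sum.cong[OF refl])
      fix j assume "j \<in> {..<m}"
      then have j: "j < m" by simp
      show "inner y (response x (P j \<omega>) y) - mean x y = - sweep.expectation (\<lambda>r. h j r \<omega> - e j r)"
        unfolding resp[OF j \<omega>M] mean[OF j]
        by (simp add: Bochner_Integration.integral_diff[OF int_h[OF j] int_e[OF j]])
    qed
    also have "\<dots> = - sweep.expectation (\<lambda>r. \<Sum>j<m. h j r \<omega> - e j r)"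
      unfolding sum_negf
      by (subst Bochner_Integration.integral_sum) (auto intro: Bochner_Integration.integrable_diff int_h int_e)
    finally have eq: "\<bar>(\<Sum>j<m. inner y (response x (P j \<omega>) y)) - real m * mean x y\<bar>
        = \<bar>sweep.expectation (\<lambda>r. \<Sum>j<m. h j r \<omega> - e j r)\<bar>" by simp
    have pointwise: "\<bar>\<Sum>j<m. h j r \<omega> - e j r\<bar> \<le> 4 * \<epsilon> * real m" if r: "r \<in> {-1..1}" for r
      unfolding h_def e_def
    proof (rule separated_deviation[OF \<omega>M X sweep_circle[OF W r]])
      show "0 \<le> 4 * \<epsilon> * real m" using \<epsilon> by simp
      fix a b :: real assume "a \<in> \<rat>" "b \<in> \<rat>" "a \<le> b"
      then have "(a, b) \<in> T" by (simp add: T_def)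
      then show "\<bar>deviation m ?Y {a<..b} \<omega>\<bar> \<le> 4 * \<epsilon> * real m"
        using \<omega> unfolding bad_def by force
    qed
    have "\<bar>sweep.expectation (\<lambda>r. \<Sum>j<m. h j r \<omega> - e j r)\<bar> \<le> sweep.expectation (\<lambda>r. \<bar>\<Sum>j<m. h j r \<omega> - e j r\<bar>)"
      by (rule integral_abs_bound)
    also have "\<dots> \<le> sweep.expectation (\<lambda>_. 4 * \<epsilon> * real m)"
    proof (rule integral_mono_AE)
      show "integrable sweep_time (\<lambda>r. \<bar>\<Sum>j<m. h j r \<omega> - e j r\<bar>)"
        by (intro integrable_abs Bochner_Integration.integrable_sum Bochner_Integration.integrable_diff)
          (auto intro: int_h int_e)
      show "AE r in sweep_time. \<bar>\<Sum>j<m. h j r \<omega> - e j r\<bar> \<le> 4 * \<epsilon> * real m"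
        using AE_sweep_time by eventually_elim (rule pointwise)
    qed simp
    also have "\<dots> = 4 * \<epsilon> * real m" by (simp add: sweep.prob_space)
    finally have "\<bar>(\<Sum>j<m. inner y (response x (P j \<omega>) y)) - real m * mean x y\<bar> \<le> 4 * \<epsilon> * real m"
      unfolding eq .
    then show "\<bar>(\<Sum>j<m. inner y (response x (P j \<omega>) y)) / real m - mean x y\<bar> \<le> 4 * \<epsilon>"
      using m_pos by (simp add: abs_le_iff field_simps)
  qed
qed

end

section \<open>The error of the Principal Eigenspace Program\<close>

lemma op_norm_lines_le_1:
  assumes "X \<in> Proj 1" "Y \<in> Proj 1"
  shows "op_norm (Y - X) \<le> 1"
proof -
  obtain x y where xy: "norm x = 1" "X = outer x" "norm y = 1" "Y = outer y"
    using assms Proj_1_outer by metis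
  have "op_norm (Y - X) \<le> sqrt (1 - (norm (herm x y))\<^sup>2)"
    using op_norm_outer_diff xy by simp
  also have "\<dots> \<le> sqrt 1" by (rule real_sqrt_le_mono) simp
  finally show ?thesis by simp
qed

text \<open>
  Each side is quadratic in \<open>1 / \<epsilon>\<close>; as \<open>\<pi> < 4\<close>, the square of the constant on the right is at least
  \<open>512 q\<close>, while the coefficients on the left add up to at most \<open>32 q\<close>.
\<close>

lemma net_size_bound:
  fixes q \<epsilon> :: real
  assumes q: "q \<ge> 1" and \<epsilon>: "0 < \<epsilon>" "\<epsilon> \<le> 1"
  shows "(1 + 10 * q / \<epsilon>) * (1 + 2 / \<epsilon>) \<le> (1 + 128 * (sqrt (2 * q - 1) / (2 * sqrt (2 * pi))) * (1 / \<epsilon>))\<^sup>2"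
proof -
  define c where "c = sqrt (2 * q - 1) / (2 * sqrt (2 * pi))"
  have c0: "c \<ge> 0" using q by (simp add: c_def)
  have "c\<^sup>2 = (2 * q - 1) / (8 * pi)"
    using q by (simp add: c_def power_divide power_mult_distrib)
  moreover have "q / (8 * 4) \<le> (2 * q - 1) / (8 * pi)"
    using q pi_less_4 by (intro frac_le) auto
  ultimately have "q / 32 \<le> c\<^sup>2" by simp
  then have c2: "512 * q \<le> 16384 * c\<^sup>2" by linarith
  define i where "i = 1 / \<epsilon>"
  have i: "i \<ge> 1" using \<epsilon> by (simp add: i_def)
  have "(1 + 10 * q * i) * (1 + 2 * i) = 1 + (10 * q + 2) * i + 20 * q * i\<^sup>2"
    by (simp add: algebra_simps power2_eq_square)
  also have "\<dots> \<le> 1 + (12 * q) * (i * i) + 20 * q * i\<^sup>2"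
    using q i by (intro add_mono mult_mono order.refl) auto
  also have "\<dots> = 1 + 32 * q * i\<^sup>2" by (simp add: power2_eq_square)
  also have "\<dots> \<le> 1 + 16384 * c\<^sup>2 * i\<^sup>2" using c2 q by (intro add_mono mult_right_mono) auto
  also have "\<dots> \<le> 1 + 16384 * c\<^sup>2 * i\<^sup>2 + 256 * (c * i)" using c0 i by simp
  also have "\<dots> = (1 + 128 * c * i)\<^sup>2" by (simp add: power2_eq_square algebra_simps)
  finally show ?thesis by (simp add: c_def i_def)
qed

theorem corollary3p3p3:
  fixes M :: "'w measure"
    and P :: "nat \<Rightarrow> 'w \<Rightarrow> 'a::real_or_complex^'d^'d"
    and n m :: nat
    and \<beta> \<delta> \<tau> \<epsilon> D :: real
  assumes "prob_space M"
    and "n \<ge> 1" and "CARD('d) = 2 * n"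
    and "\<beta> = field_beta TYPE('a)"
    and "\<delta> > 0" and "0 < \<tau>" and "\<tau> < 1"
    and "\<epsilon> = (\<mu>\<^sub>1 \<beta> n - \<mu>\<^sub>2 \<beta> n) / 8 * \<delta>"
    and "m \<ge> 1"
    and "real m \<ge> 2 * (1 / \<epsilon>\<^sup>2) *
           (8 * \<beta> * real n *
              ln (1 + 128 * (sqrt (2 * \<beta> * real n - 1) / (2 * sqrt (2 * pi))) * (1 / \<epsilon>))
            + 2 * ln 2 + D)"
    and "\<forall>j<m. uniform_on_Proj n (distr M (proj_space n) (P j))"
    and "prob_space.indep_vars M (\<lambda>_. proj_space n) P {..<m}"
  shows "\<exists>E\<in>sets M. measure M E \<ge> 1 - exp (- D) \<and>
           (\<forall>\<omega>\<in>E. \<forall>X\<in>Proj 1. \<forall>b. hamming_dist m (\<Phi> (\<lambda>j. P j \<omega>) X) b \<le> \<tau> \<longrightarrow>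
              (\<forall>Y. PEP_solution m (\<lambda>j. P j \<omega>) b Y \<longrightarrow>
                 op_norm (Y - X) \<le> \<delta> + 2 * (1 / (\<mu>\<^sub>1 \<beta> n - \<mu>\<^sub>2 \<beta> n)) * \<tau>))"
proof -
  interpret prob_space M by fact
  interpret random_Projs M P m n
    using assms(2,3,9,11,12) by unfold_locales auto
  have q: "q = \<beta> * real n" by (simp add: q_def assms(4) field_beta_def)
  have \<mu>: "\<mu>\<^sub>1 \<beta> n = 1/2 + beta_dev q" "\<mu>\<^sub>2 \<beta> n = 1/2 - beta_dev q / (2 * real n - 1)"
    by (simp_all add: \<mu>\<^sub>1_def \<mu>\<^sub>2_def beta_dev_def q mult_ac)
  have gap: "\<mu>\<^sub>1 \<beta> n - \<mu>\<^sub>2 \<beta> n = gap" by (simp add: \<mu> gap_def)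
  have \<epsilon>: "\<epsilon> = gap / 8 * \<delta>" using assms(8) unfolding gap .
  have \<epsilon>0: "\<epsilon> > 0" using gap_bounds assms(5) by (simp add: \<epsilon>)
  have \<tau>gap: "2 * (1 / gap) * \<tau> > 0" using gap_bounds assms(6) by simp
  show ?thesis
  proof (cases "\<delta> \<ge> 1")
    \<comment> \<open>the distance of two lines is at most 1, so \<open>\<delta> < 1\<close> may be assumed, which makes \<open>\<epsilon>\<close> small\<close>
    case True
    have "op_norm (Y - X) \<le> \<delta> + 2 * (1 / gap) * \<tau>" if "X \<in> Proj 1" "PEP_solution m (\<lambda>j. P j \<omega>) b Y" for \<omega> X Y b
      using op_norm_lines_le_1[of X Y] that \<tau>gap True by (simp add: PEP_solution_def)
    then show ?thesis unfolding gap by (intro bexI[of _ "space M"]) (auto simp: prob_space)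
  next
    case False
    have "gap * \<delta> \<le> 1 * 1" using gap_bounds False assms(5) by (intro mult_mono) auto
    then have \<epsilon>1: "\<epsilon> \<le> 1" by (simp add: \<epsilon>)
    define l where "l = ln (1 + 128 * (sqrt (2 * q - 1) / (2 * sqrt (2 * pi))) * (1 / \<epsilon>))"
    have "2 * (1 / \<epsilon>\<^sup>2) * (8 * q * l + 2 * ln 2 + D) \<le> real m"
      using assms(10) by (simp add: l_def q mult.assoc)
    then have m_bound: "8 * q * l + 2 * ln 2 + D \<le> real m * \<epsilon>\<^sup>2 / 2"
      using \<epsilon>0 by (simp add: field_simps)
    have exp4: "exp (2 * ln 2) = (4::real)" by (simp add: exp_double)
    have "\<exists>E\<in>sets M. prob E \<ge> 1 - exp (- D) \<and> (\<forall>\<omega>\<in>E. \<forall>x y. norm x = 1 \<longrightarrow> norm y = 1 \<longrightarrow>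
      \<bar>(\<Sum>j<m. inner y (response x (P j \<omega>) y)) / real m - mean x y\<bar> \<le> 4 * \<epsilon>)"
    proof (cases "q \<ge> 1")
      case True
      let ?N = "(1 + 10 * q / \<epsilon>) * (1 + 2 / \<epsilon>)" and ?L = "DIM('a^'d)"
      obtain E where E: "E \<in> sets M" "prob E \<ge> 1 - 4 * ?N ^ ?L * exp (- real m * \<epsilon>\<^sup>2 / 2)"
        "\<And>\<omega> x y. \<omega> \<in> E \<Longrightarrow> norm x = 1 \<Longrightarrow> norm y = 1 \<Longrightarrow>
          \<bar>(\<Sum>j<m. inner y (response x (P j \<omega>) y)) / real m - mean x y\<bar> \<le> 4 * \<epsilon>"
        using uniform_estimate[OF True \<epsilon>0] by blast
      have L: "real ?L = 4 * q" by (simp add: q_def card_n)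
      have "sqrt (2 * q - 1) \<ge> 0" using True by simp
      then have K: "exp l = 1 + 128 * (sqrt (2 * q - 1) / (2 * sqrt (2 * pi))) * (1 / \<epsilon>)"
        using \<epsilon>0 unfolding l_def by (intro exp_ln) (simp add: add_pos_nonneg)
      have "?N ^ ?L \<le> ((exp l)\<^sup>2) ^ ?L"
        unfolding K using net_size_bound[OF True \<epsilon>0 \<epsilon>1] True \<epsilon>0 by (intro power_mono) auto
      also have "\<dots> = exp (real ?L * (2 * l))" by (simp only: exp_of_nat_mult exp_double)
      also have "\<dots> = exp (8 * q * l)" 
      proof -
        have "4 * q * (2 * l) = 8 * q * l" by simp
        then show ?thesis unfolding L by (simp only:)
      qed
      finally have "4 * ?N ^ ?L * exp (- real m * \<epsilon>\<^sup>2 / 2) \<le> 4 * exp (8 * q * l) * exp (- real m * \<epsilon>\<^sup>2 / 2)"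
        by (intro mult_right_mono mult_left_mono) auto
      also have "\<dots> = exp (2 * ln 2) * exp (8 * q * l) * exp (- real m * \<epsilon>\<^sup>2 / 2)"
        by (simp only: exp4)
      also have "\<dots> = exp (2 * ln 2 + 8 * q * l + - real m * \<epsilon>\<^sup>2 / 2)"
        by (simp only: exp_add)
      also have "\<dots> \<le> exp (- D)" unfolding exp_le_cancel_iff using m_bound by linarith
      finally show ?thesis using E by (intro bexI[of _ E]) auto
    next
      case False
      then have "DIM('a) * n < 2" by (simp add: q_def flip: of_nat_mult)
      moreover have "DIM('a) * n \<ge> 1" using n_pos DIM_positive[where 'a='a] by (simp add: Suc_le_eq)
      ultimately have "DIM('a) * n = 1" by linarith
      then have dn: "DIM('a) = 1" "n = 1" by simp_all
      then have "CARD('d) = 2" using card_n by simp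
      then obtain i1 i2 :: 'd where i: "i1 \<noteq> i2" "UNIV = {i1, i2}" by (metis card_2_iff)
      interpret random_lines M P m n i1 i2 using dn i by unfold_locales auto
      obtain E where E: "E \<in> sets M" "prob E \<ge> 1 - 2 * exp (- real m * \<epsilon>\<^sup>2 / 2)"
        "\<And>\<omega> x y. \<omega> \<in> E \<Longrightarrow> norm x = 1 \<Longrightarrow> norm y = 1 \<Longrightarrow>
          \<bar>(\<Sum>j<m. inner y (response x (P j \<omega>) y)) / real m - mean x y\<bar> \<le> 4 * \<epsilon>"
        using uniform_estimate_plane[OF \<epsilon>0] by blast
      have "real DIM('a) * real n / 2 = 1/2" unfolding dn by simp
      with q_def have "q = 1/2" by (rule trans)
      then have zero: "2 * q - 1 = 0" by linarith
      have "l = 0" unfolding l_def zero by simp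
      then have "2 * ln 2 + - real m * \<epsilon>\<^sup>2 / 2 \<le> - D" using m_bound by simp
      then have "exp (2 * ln 2) * exp (- real m * \<epsilon>\<^sup>2 / 2) \<le> exp (- D)"
        unfolding exp_add[symmetric] exp_le_cancel_iff .
      then have "2 * exp (- real m * \<epsilon>\<^sup>2 / 2) \<le> exp (- D)"
        unfolding exp4 using exp_gt_zero[of "- real m * \<epsilon>\<^sup>2 / 2"] by linarith
      then show ?thesis using E by (intro bexI[of _ E]) auto
    qed
    then obtain E where E: "E \<in> sets M" "prob E \<ge> 1 - exp (- D)"
      "\<And>\<omega> x y. \<omega> \<in> E \<Longrightarrow> norm x = 1 \<Longrightarrow> norm y = 1 \<Longrightarrow>
        \<bar>(\<Sum>j<m. inner y (response x (P j \<omega>) y)) / real m - mean x y\<bar> \<le> 4 * \<epsilon>" by blast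
    have "op_norm (Y - X) \<le> \<delta> + 2 * (1 / gap) * \<tau>"
      if \<omega>: "\<omega> \<in> E" and X: "X \<in> Proj 1" and ham: "hamming_dist m (\<Phi> (\<lambda>j. P j \<omega>) X) b \<le> \<tau>"
        and sol: "PEP_solution m (\<lambda>j. P j \<omega>) b Y" for \<omega> X b Y
    proof -
      have "\<omega> \<in> space M" using \<omega> sets.sets_into_space[OF E(1)] by blast
      then have "op_norm (Y - X) \<le> 2 * (4 * \<epsilon> + \<tau>) / gap"
        using E(3)[OF \<omega>] unfolding mean_def
        by (intro PEP_solution_close[OF m_pos P_Proj gap_bounds(1) _ X ham sol])
      also have "\<dots> = \<delta> + 2 * (1 / gap) * \<tau>" using gap_bounds(1) by (simp add: \<epsilon> field_simps)
      finally show ?thesis .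
    qed
    then show ?thesis unfolding gap using E(1,2) by (intro bexI[of _ E]) auto
  qed
qed

end
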